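(* Let $d\ge 3$. For every $a\in(1/2,1)$, every $u>0$ and every $c>0$, $\mathbb{P}^u[\,\cdot\mid \boldsymbol 0\in\mathcal{C}]$-almost surely there exists a finite $R_0>0$ such that $$(\mathcal{C}\cap B_R)\subseteq B^{\rho}_{R+cR^a}\qquad\text{for all } R>R_0 .$$
   Context: Let $\mathbb{L}$ be the space of lines (1-dimensional affine subspaces) of $\mathbb{R}^d$ with its usual topology and Borel $\sigma$-algebra, and let $\mu$ be the Haar measure on $\mathbb{L}$ invariant under all isometries of $\mathbb{R}^d$ (unique up to a positive constant; fix any normalization). Under $\mathbb{P}^u$, $\omega$ is a Poisson point process on $\mathbb{L}$ with intensity measure $u\mu$. Let $B_r$ be the closed Euclidean ball of radius $r$ centered at the origin $\boldsymbol 0$, let $\mathrm{Cyl}(l)=l+B_1$ for a line $l$, and let $\mathcal{C}=\bigcup_{l\in\omega}\mathrm{Cyl}(l)$ (union over the lines in the support of $\omega$). The internal distance $\rho$ is $$\rho(\boldsymbol x,\boldsymbol y)=\inf\Big\{\sum_{j=1}^n|\boldsymbol z_j-\boldsymbol z_{j-1}|\Big\},$$ where the infimum is over all $n\ge1$ and all finite sequences $(\boldsymbol z_j)_{j=0}^n$ in $\mathbb{R}^d$ with $\boldsymbol z_0=\boldsymbol x$, $\boldsymbol z_n=\boldsymbol y$ and every segment $[\boldsymbol z_{k-1},\boldsymbol z_k]\subseteq\mathcal{C}$, with $\inf\emptyset=+\infty$. Finally $B_r^\rho=\{\boldsymbol y\in\mathbb{R}^d:\rho(\boldsymbol 0,\boldsymbol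 y)\le r\}$. *)

theory Defs
  imports "HOL-Probability.Probability"
begin

section \<open>The space of lines\<close>

definition lines :: "'a::euclidean_space set set" where
  "lines = {l. affine l \<and> aff_dim l = 1}"

definition line_through :: "'a::euclidean_space \<Rightarrow> 'a \<Rightarrow> 'a set" where
  "line_through x v = range (\<lambda>t. x + t *\<^sub>R v)"

text \<open>The usual topology of the affine Grassmannian: the quotient topology with respect to
  the parametrisation of lines by a base point and a nonzero direction vector, see
  \<open>quotient_map_line_through\<close> below.\<close>

definition line_topology :: "'a::euclidean_space set topology" where
  "line_topology = topology (\<lambda>U. U \<subseteq> lines \<and>
     open {p. snd p \<noteq> 0 \<and> line_through (fst p) (snd p) \<in> U})"

lemma lines_eq: "lines = {line_through x v | x v :: 'a::euclidean_space. v \<noteq> 0}"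
proof (intro set_eqI iffI)
  fix l :: "'a set" assume "l \<in> lines"
  then have l: "affine l" "aff_dim l = 1" by (auto simp: lines_def)
  then obtain b where b: "b \<subseteq> l" "\<not> affine_dependent b" "l = affine hull b" "of_nat (card b) = aff_dim l + 1"
    by (metis aff_dim_basis_exists affine_hull_eq hull_subset order_trans)
  then have "card b = 2" using l by linarith
  then obtain x y where xy: "b = {x, y}" "x \<noteq> y" by (meson card_2_iff)
  have "l = line_through x (y - x)"
    unfolding b(3) xy affine_hull_2_alt line_through_def by simp
  then show "l \<in> {line_through x v | x v. v \<noteq> 0}" using xy by fastforce
next
  fix l :: "'a set" assume "l \<in> {line_through x v | x v. v \<noteq> 0}"
  then obtain x v where l: "l = line_through x v" and v: "v \<noteq> 0" by auto
  have "l = affine hull {x, x + v}"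
    unfolding l line_through_def affine_hull_2_alt by simp
  then show "l \<in> lines" using v by (simp add: lines_def aff_dim_affine_hull aff_dim_2)
qed

lemma openin_line_topology:
  "openin line_topology U \<longleftrightarrow>
     U \<subseteq> lines \<and> open {p. snd p \<noteq> 0 \<and> line_through (fst p) (snd p) \<in> U}"
proof -
  let ?Q = "\<lambda>U. {p :: 'a \<times> 'a. snd p \<noteq> 0 \<and> line_through (fst p) (snd p) \<in> U}"
  have "istopology (\<lambda>U. U \<subseteq> lines \<and> open (?Q U))"
    unfolding istopology_def
  proof (intro conjI allI impI)
    fix S T :: "'a set set" assume "S \<subseteq> lines \<and> open (?Q S)" "T \<subseteq> lines \<and> open (?Q T)"
    moreover have "?Q (S \<inter> T) = ?Q S \<inter> ?Q T" by auto
    ultimately show "S \<inter> T \<subseteq> lines" "open (?Q (S \<inter> T))" by auto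
  next
    fix K :: "'a set set set" assume K: "\<forall>S\<in>K. S \<subseteq> lines \<and> open (?Q S)"
    moreover have "?Q (\<Union>K) = (\<Union>S\<in>K. ?Q S)" by auto
    ultimately show "\<Union>K \<subseteq> lines" "open (?Q (\<Union>K))" by auto
  qed
  then show ?thesis by (simp add: line_topology_def topology_inverse')
qed

lemma topspace_line_topology: "topspace line_topology = (lines :: 'a::euclidean_space set set)"
proof -
  have "{p :: 'a \<times> 'a. snd p \<noteq> 0 \<and> line_through (fst p) (snd p) \<in> lines} = UNIV \<times> (- {0})"
    unfolding lines_eq by (auto; blast)
  moreover have "open (UNIV \<times> (- {0}) :: ('a \<times> 'a) set)" by (intro open_Times) auto
  ultimately have "openin line_topology (lines :: 'a set set)"
    by (simp add: openin_line_topology)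
  then show ?thesis
    by (meson openin_line_topology openin_subset openin_topspace subset_antisym)
qed

lemma quotient_map_line_through:
  "quotient_map (top_of_set (UNIV \<times> (- {0}))) (line_topology :: 'a::euclidean_space set topology)
     (\<lambda>(x, v). line_through x v)"
proof -
  have op: "open (UNIV \<times> (- {0}) :: ('a \<times> 'a) set)" by (intro open_Times) auto
  have eq: "{x \<in> UNIV \<times> (- {0}). (case x of (x, v) \<Rightarrow> line_through x v) \<in> U} =
            {p :: 'a \<times> 'a. snd p \<noteq> 0 \<and> line_through (fst p) (snd p) \<in> U}" for U
    by auto
  have "(\<lambda>(x, v). line_through x v) ` (UNIV \<times> (- {0})) = (lines :: 'a set set)"
    by (force simp: lines_eq image_iff)
  moreover have "openin (top_of_set (UNIV \<times> (- {0}))) {p :: 'a \<times> 'a. snd p \<noteq> 0 \<and> line_through (fst p) (snd p) \<in> U}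
      \<longleftrightarrow> open {p :: 'a \<times> 'a. snd p \<noteq> 0 \<and> line_through (fst p) (snd p) \<in> U}" for U
    by (subst openin_open_eq[OF op]) auto
  ultimately show ?thesis
    unfolding quotient_map_def
    by (simp add: topspace_line_topology openin_line_topology eq)
qed

definition line_borel :: "'a::euclidean_space set measure" where
  "line_borel = sigma lines {U. openin line_topology U}"

text \<open>An isometry of a finite-dimensional Euclidean space is automatically bijective.\<close>

definition haar_line_measure :: "'a::euclidean_space set measure \<Rightarrow> bool" where
  "haar_line_measure \<mu> \<longleftrightarrow>
     sets \<mu> = sets line_borel \<and>
     emeasure \<mu> lines \<noteq> 0 \<and>
     (\<forall>K. compactin line_topology K \<longrightarrow> emeasure \<mu> K < \<infinity>) \<and>
     (\<forall>f :: 'a \<Rightarrow> 'a. (\<forall>x y. dist (f x) (f y) = dist x y) \<longrightarrow>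
        (\<forall>A\<in>sets \<mu>. emeasure \<mu> ((\<lambda>l. f ` l) ` A) = emeasure \<mu> A))"


section \<open>Poisson point processes of lines\<close>

text \<open>Locally finite sums of Dirac masses at lines, with multiplicities allowed: the measure
  \<^term>\<open>distr (count_space I) line_borel l\<close> is the sum over \<open>i \<in> I\<close> of the
  unit masses at \<open>l i\<close>.\<close>

definition line_point_measure :: "'a::euclidean_space set measure \<Rightarrow> bool" where
  "line_point_measure N \<longleftrightarrow>
     (\<exists>(I :: nat set) l. l \<in> I \<rightarrow> lines \<and> N = distr (count_space I) line_borel l) \<and>
     (\<forall>K. compactin line_topology K \<longrightarrow> emeasure N K < \<infinity>)"

definition line_support :: "'a::euclidean_space set measure \<Rightarrow> 'a set set" where
  "line_support N =
     {l \<in> lines. \<forall>U. openin line_topology U \<and> l \<in> U \<longrightarrow> emeasure N U > 0}"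

definition poisson_line_process ::
    "'w measure \<Rightarrow> 'a::euclidean_space set measure \<Rightarrow> ('w \<Rightarrow> 'a set measure) \<Rightarrow> bool" where
  "poisson_line_process P \<Lambda> \<omega> \<longleftrightarrow>
     prob_space P \<and>
     (\<forall>w\<in>space P. line_point_measure (\<omega> w)) \<and>
     (\<forall>A\<in>sets line_borel. (\<lambda>w. emeasure (\<omega> w) A) \<in> borel_measurable P) \<and>
     (\<forall>A\<in>sets line_borel. emeasure \<Lambda> A < \<infinity> \<longrightarrow>
        (\<forall>k::nat. measure P {w \<in> space P. emeasure (\<omega> w) A = of_nat k} =
           measure \<Lambda> A ^ k / fact k * exp (- measure \<Lambda> A))) \<and>
     (\<forall>A\<in>sets line_borel. emeasure \<Lambda> A = \<infinity> \<longrightarrow> (AE w in P. emeasure (\<omega> w) A = \<infinity>)) \<and>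
     (\<forall>(I :: nat set) A. disjoint_family_on A I \<and> (\<forall>i\<in>I. A i \<in> sets line_borel) \<longrightarrow>
        prob_space.indep_vars P (\<lambda>_. borel) (\<lambda>i w. emeasure (\<omega> w) (A i)) I)"


section \<open>Cylinders and the internal distance\<close>

definition cyl :: "'a::euclidean_space set \<Rightarrow> 'a set" where
  "cyl l = {x + y | x y. x \<in> l \<and> y \<in> cball 0 1}"

definition cylinder_set :: "'a::euclidean_space set measure \<Rightarrow> 'a set" where
  "cylinder_set N = (\<Union>l\<in>line_support N. cyl l)"

definition internal_dist :: "'a::euclidean_space set \<Rightarrow> 'a \<Rightarrow> 'a \<Rightarrow> ereal" where
  "internal_dist C x y = Inf {ereal (\<Sum>j=1..n. norm (z j - z (j - 1))) | (n::nat) z.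
     n \<ge> 1 \<and> z 0 = x \<and> z n = y \<and> (\<forall>k\<in>{1..n}. closed_segment (z (k - 1)) (z k) \<subseteq> C)}"

definition internal_ball :: "'a::euclidean_space set \<Rightarrow> real \<Rightarrow> 'a set" where
  "internal_ball C r = {y. internal_dist C 0 y \<le> ereal r}"

end

theory Submission
  imports Defs
begin

text \<open>Put \<open>s = R powr b\<close> with \<open>1/2 < b < a\<close>. The lines that meet two balls of radius \<open>s\<close> at distance at
  most \<open>R\<close> have measure at least of order \<open>(s\<^sup>2/R) ^ (d - 1)\<close>, so with overwhelming probability some line of the
  process passes near \<open>0\<close> and near \<open>x\<close>. It remains to connect two lines that meet a common ball of
  radius \<open>s\<close> by a path of length \<open>O(s)\<close> inside the cylinders.

  Consider two lines, transversal to the segment of length \<open>D\<close> that joins them, and put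
  \<open>r = 1 - 1/(2d)\<close>. The lines that meet a given cylinder and run inside a given tube of length \<open>D\<close> and
  width \<open>w = D powr r\<close> have measure of order \<open>w ^ d / D ^ (d - 1) = D powr (1/2)\<close>. Hence the process contains a line that starts
  from the first one and a line that starts from the second one which are nearly parallel, at distance
  about \<open>w\<close>, over the length \<open>D\<close>. Along this pair there are of order \<open>D powr (1 - r)\<close> windows of size \<open>w\<close>. Attempts to
  connect the pair in different windows use disjoint sets of lines, since those lines are transversal
  to the pair, and so they are independent.

  If one attempt at scale \<open>w\<close> succeeds with probability at least of order \<open>w powr (-\<kappa>)\<close>, then all
  attempts fail with probability at most \<open>exp (- (D powr \<beta>))\<close> as soon as \<open>\<kappa>\<close> is small. A single connecting line
  gives \<open>\<kappa> = d - 1\<close>; passing once more from scale \<open>s\<close> to a nearly parallel pair at scale \<open>s powr r\<close> replaces \<open>\<kappa>\<close>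
  by \<open>r \<kappa>\<close>, and iterating makes it arbitrarily small. All failure probabilities decay faster than any power, so a union
  bound over a grid and the Borel--Cantelli lemma conclude.\<close>


section \<open>Lines and the balls they meet\<close>

text \<open>The exponent r is fixed by counting: \<open>r * d = d - 1/2\<close> turns
  \<open>w ^ d / D ^ (d - 1)\<close> into \<open>D powr (1/2)\<close>, so a pair of parallel lines
  exists with probability close to 1, while about \<open>D powr (1 / (2 * d))\<close> windows
  remain. A single line bridges a window only with probability of order
  \<open>w powr - (d - 1)\<close>, hopeless against that many windows; hence \<kappa> is first
  pushed below \<open>1 / (4 * d)\<close>. The obstacle is to keep transversality through this
  recursion. Pairs at successive scales are tilted against each other by an angle of order \<Gamma>,
  and every line used for a bridge along a direction v has to stay in the angular annulus between
  \<Gamma>/8 and \<Gamma> around v. Each level therefore calls the next one with the smaller angle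
  \<Gamma>/32, and the induction hypothesis has to cover all small \<Gamma>. The exponent 1/2 of the
  theorem comes from the long line alone: for \<open>s = R powr b\<close> the quantity
  \<open>s\<^sup>2 / R = R powr (2 * b - 1)\<close> grows exactly when b > 1/2. The strict
  inequality b < a then absorbs every multiplicative constant.\<close>

definition hit :: "'a::euclidean_space \<Rightarrow> real \<Rightarrow> 'a set set" where
  "hit x r = {l \<in> lines. l \<inter> ball x r \<noteq> {}}"

text \<open>A line has exactly two unit directions, \<open>u\<close> and \<open>- u\<close>. A
  relation instead of a choice function lets each statement pick the sign that is close to its
  reference direction.\<close>

definition dirn :: "'a::euclidean_space set \<Rightarrow> 'a \<Rightarrow> bool" where
  "dirn l u \<longleftrightarrow> norm u = 1 \<and> (\<exists>x. l = line_through x u)"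

lemma hit_subset_lines: "hit x r \<subseteq> lines"
  by (auto simp: hit_def)

lemma hitI: "l \<in> lines \<Longrightarrow> a \<in> l \<Longrightarrow> dist x a < r \<Longrightarrow> l \<in> hit x r"
  by (auto simp: hit_def)

lemma hitE:
  assumes "l \<in> hit x r"
  obtains a where "l \<in> lines" "a \<in> l" "dist x a < r"
  using assms by (auto simp: hit_def)

lemma hit_mono: "dist x y + r \<le> s \<Longrightarrow> hit x r \<subseteq> hit y s"
proof
  fix l assume h: "dist x y + r \<le> s" "l \<in> hit x r"
  then obtain a where a: "l \<in> lines" "a \<in> l" "dist x a < r" by (auto elim: hitE)
  have "dist y a \<le> dist x y + dist x a" using dist_triangle[of y a x] by (simp add: dist_commute)
  then show "l \<in> hit y s" using a h by (intro hitI[of _ a]) auto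
qed

lemma open_line_through_meets:
  fixes U :: "'a::euclidean_space set"
  assumes "open U"
  shows "open {p. snd p \<noteq> 0 \<and> line_through (fst p) (snd p) \<inter> U \<noteq> {}}"
proof -
  have "{p :: 'a \<times> 'a. snd p \<noteq> 0 \<and> line_through (fst p) (snd p) \<inter> U \<noteq> {}} =
      {p. snd p \<noteq> 0} \<inter> (\<Union>t. (\<lambda>p. fst p + t *\<^sub>R snd p) -` U)"
    by (auto simp: line_through_def)
  moreover have "open {p :: 'a \<times> 'a. snd p \<noteq> 0}"
    by (intro open_Collect_neq continuous_intros)
  moreover have "open ((\<lambda>p. fst p + t *\<^sub>R snd p) -` U)" for t
    by (intro open_vimage assms continuous_intros)
  ultimately show ?thesis by (simp add: open_Int open_UN)
qed

text \<open>Open balls are used in \<open>hit\<close> so that these sets are open: a line of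
  \<open>line_support\<close> lying in such a set then forces a positive count there.\<close>

lemma openin_hit: "openin line_topology (hit x r)"
proof -
  have "{p. snd p \<noteq> 0 \<and> line_through (fst p) (snd p) \<in> hit x r} =
      {p. snd p \<noteq> 0 \<and> line_through (fst p) (snd p) \<inter> ball x r \<noteq> {}}"
    by (auto simp: hit_def lines_eq)
  then show ?thesis
    using open_line_through_meets[of "ball x r"] by (simp add: openin_line_topology hit_subset_lines)
qed

lemma sets_line_borel: "sets line_borel = sigma_sets lines {U. openin line_topology U}"
  unfolding line_borel_def
  by (rule sets_measure_of) (auto simp: openin_line_topology)

lemma space_line_borel: "space line_borel = lines"
  unfolding line_borel_def
  by (rule space_measure_of) (auto simp: openin_line_topology)

lemma openin_line_borel: "openin line_topology U \<Longrightarrow> U \<in> sets line_borel"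
  by (auto simp: sets_line_borel)

lemma hit_in_line_borel [measurable]: "hit x r \<in> sets line_borel"
  by (simp add: openin_line_borel openin_hit)

lemma line_through_scale:
  assumes "c \<noteq> 0" shows "line_through x (c *\<^sub>R v) = line_through x v"
proof -
  have "x + t *\<^sub>R c *\<^sub>R v \<in> line_through x v" for t
    unfolding line_through_def by (intro image_eqI[of _ _ "t * c"]) auto
  moreover have "x + t *\<^sub>R v \<in> line_through x (c *\<^sub>R v)" for t
    unfolding line_through_def using assms by (intro image_eqI[of _ _ "t / c"]) auto
  ultimately show ?thesis unfolding line_through_def by blast
qed

lemma line_through_shift: "line_through (x + s *\<^sub>R v) v = line_through x v"
proof -
  have "x + t *\<^sub>R v \<in> line_through (x + s *\<^sub>R v) v" for t
    unfolding line_through_def by (intro image_eqI[of _ _ "t - s"]) (auto simp: algebra_simps)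
  moreover have "x + s *\<^sub>R v + t *\<^sub>R v \<in> line_through x v" for t
    unfolding line_through_def by (intro image_eqI[of _ _ "s + t"]) (auto simp: algebra_simps)
  ultimately show ?thesis unfolding line_through_def by blast
qed

text \<open>The set is the image of \<open>cball x r\<close> times the unit sphere under the
  quotient map. Point measures are assumed finite on compact sets of lines only; this makes the
  assumption applicable to the lines meeting a ball.\<close>

lemma compactin_meets_cball:
  "compactin line_topology {l \<in> lines. l \<inter> cball (x::'a::euclidean_space) r \<noteq> {}}"
proof -
  let ?f = "\<lambda>(x::'a, v). line_through x v"
  have "compact (cball x r \<times> sphere (0::'a) 1)" by (intro compact_Times) auto
  moreover have "cball x r \<times> sphere (0::'a) 1 \<subseteq> UNIV \<times> (- {0})" by auto
  ultimately have "compactin (top_of_set (UNIV \<times> (- {0}))) (cball x r \<times> sphere (0::'a) 1)"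
    by (simp add: compactin_subtopology)
  then have "compactin line_topology (?f ` (cball x r \<times> sphere 0 1))"
    by (rule image_compactin) (rule quotient_imp_continuous_map[OF quotient_map_line_through])
  moreover have "?f ` (cball x r \<times> sphere 0 1) = {l \<in> lines. l \<inter> cball x r \<noteq> {}}"
  proof (intro set_eqI iffI)
    fix l assume "l \<in> ?f ` (cball x r \<times> sphere 0 1)"
    then obtain y v where l: "l = line_through y v" "y \<in> cball x r" "norm v = 1" by auto
    have "y \<in> l" unfolding l(1) line_through_def by (rule image_eqI[of _ _ 0]) auto
    moreover have "v \<noteq> 0" using l by auto
    ultimately show "l \<in> {l \<in> lines. l \<inter> cball x r \<noteq> {}}" using l by (auto simp: lines_eq)
  next
    fix l assume "l \<in> {l \<in> lines. l \<inter> cball x r \<noteq> {}}"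
    then have "l \<in> lines" "l \<inter> cball x r \<noteq> {}" by auto
    then obtain y a v where l: "l = line_through a v" "v \<noteq> 0" "y \<in> cball x r" "y \<in> l"
      unfolding lines_eq by blast
    obtain t where t: "y = a + t *\<^sub>R v" using l by (auto simp: line_through_def)
    have "l = line_through y (v /\<^sub>R norm v)"
      using l(2) by (simp add: l(1) t line_through_shift line_through_scale)
    then show "l \<in> ?f ` (cball x r \<times> sphere 0 1)"
      using l by (intro image_eqI[of _ _ "(y, v /\<^sub>R norm v)"]) auto
  qed
  ultimately show ?thesis by simp
qed

lemma lines_affine: "l \<in> lines \<Longrightarrow> affine l"
  by (auto simp: lines_def)

lemma lines_convex: "l \<in> lines \<Longrightarrow> convex l"
  by (simp add: lines_affine affine_imp_convex)

lemma dirn_norm: "dirn l u \<Longrightarrow> norm u = 1"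
  by (simp add: dirn_def)

lemma dirn_exists:
  assumes "l \<in> lines" obtains u where "dirn l u"
proof -
  obtain a v where l: "l = line_through a v" "v \<noteq> 0" using assms by (auto simp: lines_eq)
  then have "line_through a v = line_through a (v /\<^sub>R norm v)"
    by (simp add: line_through_scale)
  then have "dirn l (v /\<^sub>R norm v)" using l by (auto simp: dirn_def)
  then show ?thesis using that by blast
qed

lemma dirn_mem: "dirn l u \<Longrightarrow> a \<in> l \<Longrightarrow> a + t *\<^sub>R u \<in> l"
  by (auto simp: dirn_def line_through_def image_iff) (metis add.assoc scaleR_add_left)

lemma dirn_between: "dirn l u \<Longrightarrow> a \<in> l \<Longrightarrow> b \<in> l \<Longrightarrow> \<exists>t. b = a + t *\<^sub>R u"
proof -
  assume h: "dirn l u" "a \<in> l" "b \<in> l"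
  then obtain x s t where "a = x + s *\<^sub>R u" "b = x + t *\<^sub>R u"
    by (auto simp: dirn_def line_through_def)
  then have "b = a + (t - s) *\<^sub>R u" by (simp add: algebra_simps)
  then show ?thesis ..
qed

lemma dirn_unique:
  assumes "dirn l u" "dirn l v"
  shows "v = u \<or> v = - u"
proof -
  obtain x where "l = line_through x u" using assms by (auto simp: dirn_def)
  then have x: "x \<in> l" unfolding line_through_def by (auto intro: image_eqI[of _ _ 0])
  then have "x + 1 *\<^sub>R v \<in> l" using assms dirn_mem by blast
  then obtain t where t: "x + 1 *\<^sub>R v = x + t *\<^sub>R u" using dirn_between[OF assms(1) x] by blast
  then have v: "v = t *\<^sub>R u" by simp
  have "\<bar>t\<bar> = 1" using assms v by (simp add: dirn_def)
  then have "t = 1 \<or> t = -1" by linarith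
  then show ?thesis using v by auto
qed

lemma dirn_minus: "dirn l u \<Longrightarrow> dirn l (- u)"
proof -
  assume u: "dirn l u"
  then obtain x where x: "l = line_through x u" "norm u = 1" by (auto simp: dirn_def)
  have "line_through x u = line_through x (- u)" using line_through_scale[of "-1" x u] by simp
  then show ?thesis using x by (auto simp: dirn_def)
qed

lemma dirn_diff:
  assumes l: "l \<in> lines" and "a \<in> l" "b \<in> l" "a \<noteq> b"
  shows "dirn l ((b - a) /\<^sub>R norm (b - a))"
proof -
  obtain u where u: "dirn l u" using dirn_exists l by blast
  obtain t where t: "b = a + t *\<^sub>R u" using dirn_between[OF u assms(2,3)] by blast
  have "t \<noteq> 0" using t assms by auto
  have "norm (b - a) = \<bar>t\<bar>" using t u by (simp add: dirn_def)
  then have "(b - a) /\<^sub>R norm (b - a) = sgn t *\<^sub>R u"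
    using t by (simp add: real_sgn_eq divide_inverse mult.commute)
  moreover have "sgn t = 1 \<or> sgn t = -1" using \<open>t \<noteq> 0\<close> by (auto simp: sgn_real_def)
  ultimately show ?thesis using u dirn_minus[OF u] by auto
qed

text \<open>Rescaling \<open>v\<close> to unit length costs \<open>norm v - D\<close> on top of the
  displacement \<open>v - D e\<close>, and the former is bounded by the latter; hence the factor
  2.\<close>

lemma norm_normalize_diff:
  fixes v e :: "'a::real_normed_vector"
  assumes "norm e = 1" "D > 0"
  shows "norm (v /\<^sub>R norm v - e) \<le> 2 * norm (v - D *\<^sub>R e) / D"
proof (cases "v = 0")
  case True
  \<comment> \<open>Here \<open>v /\<^sub>R norm v\<close> is 0 by the convention for division by
    zero, so the left side is 1 and the right side 2.\<close>
  then show ?thesis using assms by simp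
next
  case False
  have "v /\<^sub>R norm v - e = ((v - D *\<^sub>R e) - (norm v - D) *\<^sub>R (v /\<^sub>R norm v)) /\<^sub>R D"
    using assms False by (simp add: algebra_simps)
  then have "norm (v /\<^sub>R norm v - e) = norm ((v - D *\<^sub>R e) - (norm v - D) *\<^sub>R (v /\<^sub>R norm v)) / D"
    using assms by (simp add: divide_inverse mult.commute)
  also have "\<dots> \<le> (norm (v - D *\<^sub>R e) + norm ((norm v - D) *\<^sub>R (v /\<^sub>R norm v))) / D"
    using assms by (intro divide_right_mono norm_triangle_ineq4) auto
  also have "norm ((norm v - D) *\<^sub>R (v /\<^sub>R norm v)) = \<bar>norm v - norm (D *\<^sub>R e)\<bar>"
    using False assms unfolding norm_scaleR by simp
  also have "\<dots> \<le> norm (v - D *\<^sub>R e)" by (rule norm_triangle_ineq3)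
  finally show ?thesis using assms by (simp add: divide_right_mono)
qed

lemma dirn_near:
  assumes l: "l \<in> lines" and a: "a \<in> l" and b: "b \<in> l"
    and e: "norm e = 1" and D: "D > 0" and r: "norm (b - a - D *\<^sub>R e) \<le> r" "r < D"
  obtains u where "dirn l u" "norm (u - e) \<le> 2 * r / D"
proof -
  have "a \<noteq> b" using e D r by (auto simp: norm_minus_commute)
  then have "dirn l ((b - a) /\<^sub>R norm (b - a))" using dirn_diff l a b by blast
  moreover have "norm ((b - a) /\<^sub>R norm (b - a) - e) \<le> 2 * r / D"
    using norm_normalize_diff[OF e D, of "b - a"] r D
    by (smt (verit) divide_right_mono)
  ultimately show ?thesis using that by blast
qed

text \<open>Take the same convex combination of two points of the line as of \<open>x\<close> and
  \<open>y\<close>; the errors average. Controlling a line at the two ends of a segment thus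
  controls it along the whole segment.\<close>

lemma hit_convex:
  assumes x: "l \<in> hit x r" and y: "l \<in> hit y r" and "q \<in> closed_segment x y"
  shows "l \<in> hit q r"
proof -
  obtain a where a: "l \<in> lines" "a \<in> l" "dist x a < r" using x by (auto elim: hitE)
  obtain b where b: "b \<in> l" "dist y b < r" using y by (auto elim: hitE)
  obtain t where t: "q = (1 - t) *\<^sub>R x + t *\<^sub>R y" "0 \<le> t" "t \<le> 1"
    using assms(3) by (auto simp: closed_segment_def)
  let ?c = "(1 - t) *\<^sub>R a + t *\<^sub>R b"
  have "?c \<in> l" using lines_convex[OF a(1)] a(2) b(1) t by (auto simp: convex_alt)
  moreover have "dist q ?c < r"
  proof -
    have "q - ?c = (1 - t) *\<^sub>R (x - a) + t *\<^sub>R (y - b)" by (simp add: t algebra_simps)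
    then have "dist q ?c \<le> (1 - t) * dist x a + t * dist y b"
      using norm_triangle_ineq[of "(1 - t) *\<^sub>R (x - a)" "t *\<^sub>R (y - b)"] t
      by (simp add: dist_norm)
    also have "\<dots> < r" using a(3) b(2) t convex_bound_lt[of "dist x a" r "dist y b" "1 - t" t] by simp
    finally show ?thesis .
  qed
  ultimately show ?thesis using a(1) hitI by blast
qed

lemma line_through_image:
  assumes "linear f"
  shows "(\<lambda>y. z + f y) ` line_through x v = line_through (z + f x) (f v)"
  using assms unfolding line_through_def
  by (auto simp: image_image linear_add linear_scale algebra_simps)

lemma hit_image_isometry:
  fixes f :: "'a::euclidean_space \<Rightarrow> 'a"
  assumes f: "orthogonal_transformation f"
  shows "(\<lambda>l. (\<lambda>y. z + f y) ` l) ` hit x r = hit (z + f x) r"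
proof -
  have lin: "linear f" using f by (simp add: orthogonal_transformation_def)
  have sub: "(\<lambda>l. (\<lambda>y. z + f y) ` l) ` hit x r \<subseteq> hit (z + f x) r"
    if f: "orthogonal_transformation f" for f z and x :: 'a
  proof safe
    fix l assume "l \<in> hit x r"
    then obtain a where a: "l \<in> lines" "a \<in> l" "dist x a < r" by (auto elim: hitE)
    then obtain y v where l: "l = line_through y v" "v \<noteq> 0" by (auto simp: lines_eq)
    have n: "norm (f w) = norm w" for w using f by (simp add: orthogonal_transformation_norm)
    have lin: "linear f" using f by (simp add: orthogonal_transformation_def)
    have "f v \<noteq> 0" using n[of v] l by auto
    then have "(\<lambda>y. z + f y) ` l \<in> lines"
      unfolding l(1) line_through_image[OF lin] by (auto simp: lines_eq)
    moreover have "dist (z + f x) (z + f a) < r"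
      using a n[of "x - a"] by (simp add: dist_norm linear_diff[OF lin])
    ultimately show "(\<lambda>y. z + f y) ` l \<in> hit (z + f x) r" using a by (intro hitI) auto
  qed
  let ?g = "inv f"
  have g: "orthogonal_transformation ?g" using f by (rule orthogonal_transformation_inv)
  have fg: "f (?g y) = y" for y
    by (rule surj_f_inv_f) (rule orthogonal_transformation_surj[OF f])
  have "hit (z + f x) r \<subseteq> (\<lambda>l. (\<lambda>y. z + f y) ` l) ` hit x r"
  proof
    fix l assume l: "l \<in> hit (z + f x) r"
    \<comment> \<open>The candidate preimage is the image of \<open>l\<close> under the inverse
      isometry, to which the inclusion already shown applies.\<close>
    let ?m = "(\<lambda>y. - ?g z + ?g y) ` l"
    have "?m \<in> hit (- ?g z + ?g (z + f x)) r" using sub[OF g] l by blast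
    moreover have "- ?g z + ?g (z + f x) = x"
    proof -
      have "linear ?g" using g by (simp add: orthogonal_transformation_def)
      moreover have "?g (f x) = x" using f by (simp add: inv_f_f orthogonal_transformation_inj)
      ultimately show ?thesis by (simp add: linear_add)
    qed
    moreover have "l = (\<lambda>y. z + f y) ` ?m"
    proof -
      have "z + f (- ?g z + ?g y) = y" for y
        by (simp add: linear_add[OF lin] linear_neg[OF lin] fg del: add_uminus_conv_diff uminus_add_conv_diff)
      then show ?thesis by (simp add: image_image)
    qed
    ultimately show "l \<in> (\<lambda>l. (\<lambda>y. z + f y) ` l) ` hit x r" by (intro image_eqI[of _ _ ?m]) simp_all
  qed
  then show ?thesis by (intro subset_antisym sub[OF f])
qed

text \<open>Reflection in the hyperplane orthogonal to \<open>a - b\<close>. Combined with a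
  translation it moves any pair of points to any other pair at the same distance, see
  \<open>emeasure_hit2_cong\<close>.\<close>

lemma orthogonal_transformation_reflect_exists:
  fixes a b :: "'a::euclidean_space"
  assumes "norm a = norm b"
  shows "\<exists>f. orthogonal_transformation f \<and> f a = b"
proof (cases "a = b")
  case True
  then show ?thesis by (auto intro!: exI[of _ id] simp: orthogonal_transformation_def linear_id)
next
  case False
  define u where "u = a - b"
  have u0: "u \<bullet> u \<noteq> 0" using False by (simp add: u_def)
  define f where "f x = x - (2 * (x \<bullet> u) / (u \<bullet> u)) *\<^sub>R u" for x
  have ab: "a \<bullet> a = b \<bullet> b" using assms by (simp add: dot_square_norm)
  have "linear f"
    by (rule linearI) (simp_all add: f_def algebra_simps inner_add_left add_divide_distrib)
  moreover have "f v \<bullet> f w = v \<bullet> w" for v w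
  proof -
    define p q where "p = 2 * (v \<bullet> u) / (u \<bullet> u)" and "q = 2 * (w \<bullet> u) / (u \<bullet> u)"
    have p: "p * (u \<bullet> u) = 2 * (v \<bullet> u)" and q: "q * (u \<bullet> u) = 2 * (w \<bullet> u)"
      using u0 by (simp_all add: p_def q_def)
    have "f v \<bullet> f w = v \<bullet> w - q * (v \<bullet> u) - p * (w \<bullet> u) + p * (q * (u \<bullet> u))"
      unfolding f_def p_def[symmetric] q_def[symmetric]
      by (simp add: inner_diff_left inner_diff_right inner_commute)
    also have "\<dots> = v \<bullet> w"
      using p q by algebra
    finally show ?thesis .
  qed
  moreover have "f a = b"
  proof -
    have "u \<bullet> u = 2 * (a \<bullet> u)"
      using ab by (simp add: u_def inner_diff_left inner_diff_right inner_commute)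
    then show ?thesis using u0 by (simp add: f_def) (simp add: u_def)
  qed
  ultimately show ?thesis unfolding orthogonal_transformation_def by blast
qed


section \<open>Coverings and packings\<close>

lemma cube_cover:
  fixes J :: "'a::euclidean_space set"
  assumes "J \<subseteq> Basis" "\<delta> > 0"
  shows "\<exists>G. finite G \<and> card G \<le> (2 * N + 1) ^ card J \<and> (\<forall>g\<in>G. \<forall>i\<in>Basis - J. g \<bullet> i = 0) \<and>
    (\<forall>y. (\<forall>i\<in>Basis. \<bar>y \<bullet> i\<bar> \<le> real N * \<delta>) \<and> (\<forall>i\<in>Basis - J. y \<bullet> i = 0) \<longrightarrow>
      (\<exists>g\<in>G. dist y g \<le> real (card J) * \<delta>))"
proof -
  have "finite J" using assms finite_subset finite_Basis by blast
  then show ?thesis using assms(1)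
  proof (induction J rule: finite_induct)
    case empty
    have "y = 0" if "\<forall>i\<in>Basis. y \<bullet> i = 0" for y :: 'a
      using that by (simp add: euclidean_all_zero_iff)
    then show ?case by (intro exI[of _ "{0}"]) auto
  next
    case (insert j J)
    then obtain G where G: "finite G" "card G \<le> (2 * N + 1) ^ card J"
      "\<And>g i. g \<in> G \<Longrightarrow> i \<in> Basis - J \<Longrightarrow> g \<bullet> i = 0"
      "\<And>y. (\<forall>i\<in>Basis. \<bar>y \<bullet> i\<bar> \<le> real N * \<delta>) \<Longrightarrow> (\<forall>i\<in>Basis - J. y \<bullet> i = 0) \<Longrightarrow>
        (\<exists>g\<in>G. dist y g \<le> real (card J) * \<delta>)"
      by auto
    have j: "j \<in> Basis" "j \<notin> J" using insert by auto
    let ?f = "\<lambda>(g, k::int). g + (of_int k * \<delta>) *\<^sub>R j"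
    let ?G = "?f ` (G \<times> {- int N..int N})"
    have "card ?G \<le> card (G \<times> {- int N..int N})" by (rule card_image_le) (simp add: G)
    also have "\<dots> = card G * (2 * N + 1)" by (simp add: card_cartesian_product nat_add_distrib nat_mult_distrib)
    also have "\<dots> \<le> (2 * N + 1) ^ card J * (2 * N + 1)" using G(2) by (rule mult_right_mono) simp
    also have "\<dots> = (2 * N + 1) ^ card (insert j J)" using insert by simp
    finally have c: "card ?G \<le> (2 * N + 1) ^ card (insert j J)" .
    have z: "g \<bullet> i = 0" if "g \<in> ?G" "i \<in> Basis - insert j J" for g i
      using that G(3) j by (auto simp: inner_add_left inner_Basis)
    have cov: "\<exists>g\<in>?G. dist y g \<le> real (card (insert j J)) * \<delta>"
      if y: "\<forall>i\<in>Basis. \<bar>y \<bullet> i\<bar> \<le> real N * \<delta>" "\<forall>i\<in>Basis - insert j J. y \<bullet> i = 0" for y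
    proof -
      let ?y = "y - (y \<bullet> j) *\<^sub>R j"
      have yi: "?y \<bullet> i = (if i = j then 0 else y \<bullet> i)" if "i \<in> Basis" for i
        using that j by (simp add: inner_diff_left inner_Basis)
      have "\<exists>g\<in>G. dist ?y g \<le> real (card J) * \<delta>"
      proof (rule G(4))
        show "\<forall>i\<in>Basis. \<bar>?y \<bullet> i\<bar> \<le> real N * \<delta>" using yi y(1) assms by auto
        show "\<forall>i\<in>Basis - J. ?y \<bullet> i = 0" using yi y(2) by auto
      qed
      then obtain g where g: "g \<in> G" "dist ?y g \<le> real (card J) * \<delta>" ..
      define k where "k = \<lfloor>(y \<bullet> j) / \<delta>\<rfloor>"
      have yj: "\<bar>(y \<bullet> j) / \<delta>\<bar> \<le> real N" using y(1) j assms by (auto simp: field_simps)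
      have k1: "of_int k \<le> (y \<bullet> j) / \<delta>" "(y \<bullet> j) / \<delta> < of_int k + 1" unfolding k_def by linarith+
      have "- real N \<le> (y \<bullet> j) / \<delta>" "(y \<bullet> j) / \<delta> \<le> real N"
        using yj unfolding abs_le_iff by linarith+
      then have "k \<in> {- int N..int N}" unfolding k_def by (auto simp: le_floor_iff floor_le_iff)
      then have m: "?f (g, k) \<in> ?G" using g by blast
      have "\<bar>y \<bullet> j - of_int k * \<delta>\<bar> \<le> \<delta>" using k1 assms by (auto simp: field_simps)
      moreover have "y - (g + (of_int k * \<delta>) *\<^sub>R j) = (?y - g) + (y \<bullet> j - of_int k * \<delta>) *\<^sub>R j"
        by (simp add: algebra_simps)
      then have "norm (y - (g + (of_int k * \<delta>) *\<^sub>R j)) \<le> norm (?y - g) + \<bar>y \<bullet> j - of_int k * \<delta>\<bar>"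
        using norm_triangle_ineq[of "?y - g" "(y \<bullet> j - of_int k * \<delta>) *\<^sub>R j"] j
        by (metis mult.right_neutral norm_Basis norm_scaleR)
      then have "dist y (?f (g, k)) \<le> dist ?y g + \<bar>y \<bullet> j - of_int k * \<delta>\<bar>"
        by (simp add: dist_norm)
      ultimately have "dist y (?f (g, k)) \<le> real (card (insert j J)) * \<delta>"
        using g insert by (simp add: algebra_simps)
      then show ?thesis using m by blast
    qed
    show ?case
      using c z cov G(1) by (intro exI[of _ ?G] conjI) auto
  qed
qed

lemma ball_cover:
  obtains C :: real where "C > 0"
    "\<And>(x::'a::euclidean_space) R. R \<ge> 1 \<Longrightarrow> \<exists>G. finite G \<and> real (card G) \<le> C * R ^ DIM('a) \<and>
      (\<forall>y\<in>cball x R. \<exists>g\<in>G. dist g y < 1 / 10)"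
proof -
  let ?d = "real DIM('a)"
  define C where "C = (40 * ?d + 3) ^ DIM('a)"
  have d: "?d \<ge> 1" by (simp add: Suc_leI)
  have "\<exists>G. finite G \<and> real (card G) \<le> C * R ^ DIM('a) \<and> (\<forall>y\<in>cball x R. \<exists>g\<in>G. dist g y < 1 / 10)"
    if R: "R \<ge> 1" for R and x :: 'a
  proof -
    \<comment> \<open>Rounding all coordinates at this mesh costs at most 1/20 in total, below the
      required 1/10.\<close>
    define \<delta> where "\<delta> = 1 / (20 * ?d)"
    have \<delta>: "\<delta> > 0" using d by (simp add: \<delta>_def)
    define N where "N = nat \<lceil>R / \<delta>\<rceil>"
    have N: "R / \<delta> \<le> real N" "real N \<le> R / \<delta> + 1" using R \<delta> unfolding N_def by (auto simp: le_of_int_ceiling)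
    obtain G :: "'a set" where G: "finite G" "card G \<le> (2 * N + 1) ^ DIM('a)"
      "\<And>y. (\<forall>i\<in>Basis. \<bar>y \<bullet> i\<bar> \<le> real N * \<delta>) \<Longrightarrow> (\<exists>g\<in>G. dist y g \<le> ?d * \<delta>)"
      using cube_cover[OF subset_refl \<delta>, of N, where 'a = 'a] by auto
    have "real (2 * N + 1) \<le> (40 * ?d + 3) * R"
      using N(2) R by (simp add: \<delta>_def algebra_simps)
    then have "real (2 * N + 1) ^ DIM('a) \<le> C * R ^ DIM('a)"
      unfolding C_def power_mult_distrib[symmetric] by (intro power_mono) auto
    moreover have "real (card G) \<le> real (2 * N + 1) ^ DIM('a)"
      using G(2) by (metis of_nat_le_iff of_nat_power)
    ultimately have c: "real (card ((+) x ` G)) \<le> C * R ^ DIM('a)"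
      using card_image_le[OF G(1), of "(+) x"] by linarith
    have "\<exists>g\<in>(+) x ` G. dist g y < 1 / 10" if y: "y \<in> cball x R" for y
    proof -
      have "\<bar>(y - x) \<bullet> i\<bar> \<le> real N * \<delta>" if "i \<in> Basis" for i
      proof -
        have "\<bar>(y - x) \<bullet> i\<bar> \<le> norm (y - x)" using that by (rule Basis_le_norm)
        also have "\<dots> \<le> R" using y by (simp add: dist_norm norm_minus_commute)
        also have "\<dots> \<le> real N * \<delta>" using N(1) \<delta> by (simp add: field_simps)
        finally show ?thesis .
      qed
      then obtain g where g: "g \<in> G" "dist (y - x) g \<le> ?d * \<delta>" using G(3)[of "y - x"] by auto
      have "dist (x + g) y = dist (y - x) g" by (simp add: dist_norm norm_minus_commute algebra_simps)
      also have "\<dots> < 1 / 10" using g(2) d by (simp add: \<delta>_def)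
      finally show ?thesis using g by blast
    qed
    then show ?thesis using c G(1) by blast
  qed
  moreover have "C > 0" using d by (simp add: C_def)
  ultimately show ?thesis using that by blast
qed

lemma infnorm_sphere_cover:
  obtains C :: real where "C > 0"
    "\<And>\<rho> D. 0 < \<rho> \<Longrightarrow> \<rho> \<le> D \<Longrightarrow> \<exists>G. finite G \<and> real (card G) \<le> C * (D / \<rho>) ^ (DIM('a) - 1) \<and>
      (\<forall>y::'a::euclidean_space. infnorm y = D \<longrightarrow> (\<exists>g\<in>G. norm g \<ge> D \<and> dist g y < \<rho>))"
proof -
  let ?d = "real DIM('a)"
  define C where "C = 2 * ?d * (4 * ?d + 3) ^ (DIM('a) - 1)"
  have d: "?d \<ge> 1" by (simp add: Suc_leI)
  have "\<exists>G. finite G \<and> real (card G) \<le> C * (D / \<rho>) ^ (DIM('a) - 1) \<and>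
      (\<forall>y::'a::euclidean_space. infnorm y = D \<longrightarrow> (\<exists>g\<in>G. norm g \<ge> D \<and> dist g y < \<rho>))"
    if \<rho>: "0 < \<rho>" "\<rho> \<le> D" for \<rho> D
  proof -
    define \<delta> where "\<delta> = \<rho> / (2 * ?d)"
    have \<delta>: "\<delta> > 0" using d \<rho> by (simp add: \<delta>_def)
    define N where "N = nat \<lceil>D / \<delta>\<rceil>"
    have N: "D / \<delta> \<le> real N" "real N \<le> D / \<delta> + 1" using \<rho> \<delta> unfolding N_def by (auto simp: le_of_int_ceiling)
    have ND: "D \<le> real N * \<delta>" using N(1) \<delta> by (simp add: field_simps)
    have "\<exists>G. finite G \<and> card G \<le> (2 * N + 1) ^ (DIM('a) - 1) \<and> (\<forall>g\<in>G. g \<bullet> j = 0) \<and>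
      (\<forall>y. (\<forall>i\<in>Basis. \<bar>y \<bullet> i\<bar> \<le> real N * \<delta>) \<and> y \<bullet> j = 0 \<longrightarrow> (\<exists>g\<in>G. dist y g \<le> ?d * \<delta>))"
      if j: "j \<in> Basis" for j :: 'a
    proof -
      have J: "card (Basis - {j}) = DIM('a) - 1" "Basis - (Basis - {j}) = {j}" using j by auto
      have "\<exists>G. finite G \<and> card G \<le> (2 * N + 1) ^ (DIM('a) - 1) \<and> (\<forall>g\<in>G. \<forall>i\<in>{j}. g \<bullet> i = 0) \<and>
        (\<forall>y. (\<forall>i\<in>Basis. \<bar>y \<bullet> i\<bar> \<le> real N * \<delta>) \<and> (\<forall>i\<in>{j}. y \<bullet> i = 0) \<longrightarrow>
          (\<exists>g\<in>G. dist y g \<le> real (DIM('a) - 1) * \<delta>))"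
        using cube_cover[OF Diff_subset[of Basis "{j}"] \<delta>, of N] unfolding J .
      then obtain G where G: "finite G" "card G \<le> (2 * N + 1) ^ (DIM('a) - 1)" "\<forall>g\<in>G. g \<bullet> j = 0"
        "\<And>y. (\<forall>i\<in>Basis. \<bar>y \<bullet> i\<bar> \<le> real N * \<delta>) \<Longrightarrow> y \<bullet> j = 0 \<Longrightarrow>
          \<exists>g\<in>G. dist y g \<le> real (DIM('a) - 1) * \<delta>"
        by auto
      have le: "real (DIM('a) - 1) * \<delta> \<le> ?d * \<delta>" using \<delta> by (intro mult_right_mono) auto
      have "\<exists>g\<in>G. dist y g \<le> ?d * \<delta>"
        if "\<forall>i\<in>Basis. \<bar>y \<bullet> i\<bar> \<le> real N * \<delta>" "y \<bullet> j = 0" for y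
        using G(4)[OF that] le by (meson order_trans)
      then show ?thesis using G(1-3) by blast
    qed
    then obtain G :: "'a \<Rightarrow> 'a set" where G: "\<And>j. j \<in> Basis \<Longrightarrow> finite (G j)"
      "\<And>j. j \<in> Basis \<Longrightarrow> card (G j) \<le> (2 * N + 1) ^ (DIM('a) - 1)"
      "\<And>j g. j \<in> Basis \<Longrightarrow> g \<in> G j \<Longrightarrow> g \<bullet> j = 0"
      "\<And>j y. j \<in> Basis \<Longrightarrow> (\<forall>i\<in>Basis. \<bar>y \<bullet> i\<bar> \<le> real N * \<delta>) \<Longrightarrow> y \<bullet> j = 0 \<Longrightarrow> (\<exists>g\<in>G j. dist y g \<le> ?d * \<delta>)"
      by metis
    let ?G = "\<Union>p\<in>Basis \<times> {D, - D}. (\<lambda>g. g + snd p *\<^sub>R fst p) ` G (fst p)"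
    have fin: "finite ?G" using G(1) by auto
    have "card ?G \<le> (\<Sum>p\<in>Basis \<times> {D, - D}. card ((\<lambda>g. g + snd p *\<^sub>R fst p) ` G (fst p)))"
      by (rule card_UN_le) simp
    also have "\<dots> \<le> (\<Sum>p\<in>(Basis::'a set) \<times> {D, - D}. (2 * N + 1) ^ (DIM('a) - 1))"
      using G(1,2) by (intro sum_mono) (auto intro: order_trans[OF card_image_le])
    also have "\<dots> = (DIM('a) * card {D, - D}) * (2 * N + 1) ^ (DIM('a) - 1)"
      by (simp add: card_cartesian_product nat_add_distrib nat_mult_distrib)
    also have "\<dots> \<le> (DIM('a) * 2) * (2 * N + 1) ^ (DIM('a) - 1)"
      by (intro mult_mono) (auto simp: card_insert_if)
    finally have "real (card ?G) \<le> real ((DIM('a) * 2) * (2 * N + 1) ^ (DIM('a) - 1))"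
      by (rule of_nat_mono)
    also have "\<dots> = 2 * ?d * real (2 * N + 1) ^ (DIM('a) - 1)" by (simp only: of_nat_mult of_nat_power)
    also have "\<dots> \<le> 2 * ?d * ((4 * ?d + 3) * (D / \<rho>)) ^ (DIM('a) - 1)"
    proof -
      define X where "X = D / \<rho>"
      have "D / \<delta> = 2 * ?d * X" by (simp add: \<delta>_def X_def)
      moreover have "X \<ge> 1" using \<rho> by (simp add: X_def)
      ultimately have "real (2 * N + 1) \<le> (4 * ?d + 3) * X" using N(2) by (simp add: distrib_right)
      then have "real (2 * N + 1) \<le> (4 * ?d + 3) * (D / \<rho>)" by (simp only: X_def)
      then show ?thesis using d by (intro mult_left_mono power_mono) auto
    qed
    also have "\<dots> = C * (D / \<rho>) ^ (DIM('a) - 1)" by (simp only: C_def power_mult_distrib mult.assoc)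
    finally have c: "real (card ?G) \<le> C * (D / \<rho>) ^ (DIM('a) - 1)" .
    have "\<exists>g\<in>?G. norm g \<ge> D \<and> dist g y < \<rho>" if y: "infnorm y = D" for y
    proof -
      have "D \<in> (\<lambda>i. \<bar>y \<bullet> i\<bar>) ` Basis" unfolding y[symmetric] infnorm_Max
        by (intro Max_in) auto
      then obtain j where j: "j \<in> Basis" "\<bar>y \<bullet> j\<bar> = D" by auto
      have le: "\<bar>y \<bullet> i\<bar> \<le> D" if "i \<in> Basis" for i
        unfolding y[symmetric] infnorm_Max using that by (intro Max_ge) auto
      let ?y = "y - (y \<bullet> j) *\<^sub>R j"
      have yi: "?y \<bullet> i = (if i = j then 0 else y \<bullet> i)" if "i \<in> Basis" for i
        using that j by (simp add: inner_diff_left inner_Basis)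
      have "\<exists>g\<in>G j. dist ?y g \<le> ?d * \<delta>"
      proof (rule G(4)[OF j(1)])
        show "\<forall>i\<in>Basis. \<bar>?y \<bullet> i\<bar> \<le> real N * \<delta>"
        proof
          fix i :: 'a assume "i \<in> Basis"
          then show "\<bar>?y \<bullet> i\<bar> \<le> real N * \<delta>" using yi[of i] le[of i] ND \<rho> by auto
        qed
        show "?y \<bullet> j = 0" using yi[OF j(1)] by simp
      qed
      then obtain g where g: "g \<in> G j" "dist ?y g \<le> ?d * \<delta>" ..
      let ?g = "g + (y \<bullet> j) *\<^sub>R j"
      have "?g \<in> ?G" using g j by (intro UN_I[of "(j, y \<bullet> j)"]) auto
      moreover have "norm ?g \<ge> D"
      proof -
        have "?g \<bullet> j = y \<bullet> j" using G(3)[OF j(1) g(1)] j by (simp add: inner_add_left)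
        then show ?thesis using Basis_le_norm[OF j(1), of ?g] j by simp
      qed
      moreover have "dist ?g y < \<rho>"
      proof -
        have "dist ?g y = dist ?y g" by (simp add: dist_norm norm_minus_commute algebra_simps)
        also have "\<dots> < \<rho>" using g(2) d \<rho> by (simp add: \<delta>_def)
        finally show ?thesis .
      qed
      ultimately show ?thesis by blast
    qed
    then show ?thesis using c fin by blast
  qed
  moreover have "C > 0" using d by (simp add: C_def)
  ultimately show ?thesis using that by blast
qed

text \<open>With spacing 3, points within 1/10 of two different lattice points are still more than 2
  apart; this is the use in \<open>hit_growth\<close>.\<close>

lemma lattice_packing:
  fixes J :: "'a::euclidean_space set"
  assumes "J \<subseteq> Basis"
  shows "\<exists>G. finite G \<and> card G = (n + 1) ^ card J \<and> (\<forall>g\<in>G. \<forall>i\<in>Basis - J. g \<bullet> i = 0) \<and>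
    (\<forall>g\<in>G. norm g \<le> 3 * real n * real (card J)) \<and> (\<forall>g\<in>G. \<forall>h\<in>G. g \<noteq> h \<longrightarrow> dist g h \<ge> 3)"
proof -
  have "finite J" using assms finite_subset finite_Basis by blast
  then show ?thesis using assms(1)
  proof (induction J rule: finite_induct)
    case empty
    show ?case by (intro exI[of _ "{0}"]) auto
  next
    case (insert j J)
    then obtain G where G: "finite G" "card G = (n + 1) ^ card J"
      "\<And>g i. g \<in> G \<Longrightarrow> i \<in> Basis - J \<Longrightarrow> g \<bullet> i = 0"
      "\<And>g. g \<in> G \<Longrightarrow> norm g \<le> 3 * real n * real (card J)"
      "\<And>g h. g \<in> G \<Longrightarrow> h \<in> G \<Longrightarrow> g \<noteq> h \<Longrightarrow> dist g h \<ge> 3"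
      by auto
    have j: "j \<in> Basis" "j \<notin> J" using insert by auto
    let ?f = "\<lambda>(g, k::nat). g + (3 * real k) *\<^sub>R j"
    have far: "dist (?f p) (?f q) \<ge> 3" if pq: "p \<in> G \<times> {..n}" "q \<in> G \<times> {..n}" "p \<noteq> q" for p q
    proof -
      obtain g k h m where e: "p = (g, k)" "q = (h, m)" by fastforce
      show ?thesis
      proof (cases "k = m")
        case True
        then show ?thesis using pq G(5)[of g h] e by auto
      next
        case False
        have "(?f p - ?f q) \<bullet> j = 3 * (real k - real m)"
          using G(3)[of g j] G(3)[of h j] pq j by (simp add: e inner_diff_left inner_add_left)
        moreover have "\<bar>real k - real m\<bar> \<ge> 1" using False by linarith
        ultimately show ?thesis
          using Basis_le_norm[OF j(1), of "?f p - ?f q"] by (simp add: dist_norm)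
      qed
    qed
    have "inj_on ?f (G \<times> {..n})"
    proof (rule inj_onI, rule ccontr)
      fix p q assume "p \<in> G \<times> {..n}" "q \<in> G \<times> {..n}" "?f p = ?f q" "p \<noteq> q"
      then show False using far[of p q] by simp
    qed
    then have "card (?f ` (G \<times> {..n})) = card (G \<times> {..n})" by (rule card_image)
    then have c: "card (?f ` (G \<times> {..n})) = (n + 1) ^ card (insert j J)"
      using insert G(2) by (simp add: card_cartesian_product mult.commute)
    have nrm: "norm (?f p) \<le> 3 * real n * real (card (insert j J))" if p: "p \<in> G \<times> {..n}" for p
    proof -
      obtain g k where e: "p = (g, k)" "g \<in> G" "k \<le> n" using p by auto
      have "norm (?f p) \<le> norm g + 3 * real k"
        using norm_triangle_ineq[of g "(3 * real k) *\<^sub>R j"] j by (simp add: e)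
      then show ?thesis using G(4)[OF e(2)] e insert by (simp add: algebra_simps)
    qed
    have z: "?f p \<bullet> i = 0" if "p \<in> G \<times> {..n}" "i \<in> Basis - insert j J" for p i
      using that G(3) j by (auto simp: inner_add_left inner_Basis)
    show ?case
    proof (rule exI[of _ "?f ` (G \<times> {..n})"], intro conjI ballI impI)
      show "finite (?f ` (G \<times> {..n}))" using G(1) by simp
      show "card (?f ` (G \<times> {..n})) = (n + 1) ^ card (insert j J)" by (rule c)
    next
      fix g i assume "g \<in> ?f ` (G \<times> {..n})" "i \<in> Basis - insert j J"
      then show "g \<bullet> i = 0" using z by blast
    next
      fix g assume "g \<in> ?f ` (G \<times> {..n})"
      then show "norm g \<le> 3 * real n * real (card (insert j J))" using nrm by blast
    next
      fix g h assume g: "g \<in> ?f ` (G \<times> {..n})" and h: "h \<in> ?f ` (G \<times> {..n})" and ne: "g \<noteq> h"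
      from g obtain p where p: "p \<in> G \<times> {..n}" "g = ?f p" by (rule imageE)
      from h obtain q where q: "q \<in> G \<times> {..n}" "h = ?f q" by (rule imageE)
      show "dist g h \<ge> 3" using far[OF p(1) q(1)] p q ne by auto
    qed
  qed
qed


section \<open>Lower bounds for the Haar measure of sets of lines\<close>

locale line_haar =
  fixes \<mu> :: "'a::euclidean_space set measure"
  assumes haar: "haar_line_measure \<mu>"
begin

lemma sets_mu: "sets \<mu> = sets line_borel"
  using haar by (simp add: haar_line_measure_def)

lemma hit_sets [measurable]: "hit x r \<in> sets \<mu>"
  by (simp add: sets_mu hit_in_line_borel)

lemma emeasure_hit2_cong:
  assumes "dist x y = dist x' y'"
  shows "emeasure \<mu> (hit x r \<inter> hit y s) = emeasure \<mu> (hit x' r \<inter> hit y' s)"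
proof -
  obtain f where f: "orthogonal_transformation f" "f (y - x) = y' - x'"
    using orthogonal_transformation_reflect_exists[of "y - x" "y' - x'"] assms
    by (auto simp: dist_norm norm_minus_commute)
  have lin: "linear f" using f by (simp add: orthogonal_transformation_def)
  let ?F = "\<lambda>v. (x' - f x) + f v"
  have "inj ?F" using orthogonal_transformation_inj[OF f(1)] by (auto simp: inj_def)
  then have inj: "inj (\<lambda>l. ?F ` l)" by (auto simp: inj_def inj_image_eq_iff)
  have "(\<lambda>l. ?F ` l) ` (hit x r \<inter> hit y s) = hit (?F x) r \<inter> hit (?F y) s"
    by (simp only: image_Int[OF inj] hit_image_isometry[OF f(1)])
  also have "?F x = x'" by simp
  also have "?F y = y'" using f(2) by (simp add: linear_diff[OF lin] algebra_simps)
  finally have "(\<lambda>l. ?F ` l) ` (hit x r \<inter> hit y s) = hit x' r \<inter> hit y' s" .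
  moreover have "\<forall>v w. dist (?F v) (?F w) = dist v w"
    using f(1) by (simp add: dist_norm orthogonal_transformation_norm linear_diff[OF lin, symmetric])
  then have "\<forall>A\<in>sets \<mu>. emeasure \<mu> ((\<lambda>l. ?F ` l) ` A) = emeasure \<mu> A"
    using haar unfolding haar_line_measure_def by meson
  then have "emeasure \<mu> ((\<lambda>l. ?F ` l) ` (hit x r \<inter> hit y s)) = emeasure \<mu> (hit x r \<inter> hit y s)"
    by (rule bspec) simp
  ultimately show ?thesis by simp
qed

lemma emeasure_hit_cong: "emeasure \<mu> (hit x r) = emeasure \<mu> (hit y r)"
  using emeasure_hit2_cong[of x x y y r r] by simp

text \<open>By invariance all balls of radius \<open>r\<close> are hit with the same measure, and
  the balls around a countable dense set are together hit by every line; if each contributed 0,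
  \<open>lines\<close> would be a null set.\<close>

lemma emeasure_hit_pos:
  assumes "r > 0"
  shows "emeasure \<mu> (hit x r) > 0"
proof (rule ccontr)
  assume "\<not> emeasure \<mu> (hit x r) > 0"
  then have z: "emeasure \<mu> (hit y r) = 0" for y using emeasure_hit_cong[of x r y] by simp
  obtain D :: "'a set" where D: "countable D" "\<And>X. open X \<Longrightarrow> X \<noteq> {} \<Longrightarrow> \<exists>d\<in>D. d \<in> X"
    using countable_dense_exists by metis
  have "lines \<subseteq> (\<Union>y\<in>D. hit y r)"
  proof
    fix l :: "'a set" assume l: "l \<in> lines"
    then obtain a v where "l = line_through a v" by (auto simp: lines_eq)
    then have a: "a \<in> l" unfolding line_through_def by (auto intro: image_eqI[of _ _ 0])
    obtain d where "d \<in> D" "d \<in> ball a r" using D(2)[of "ball a r"] assms by auto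
    then show "l \<in> (\<Union>y\<in>D. hit y r)" using l a by (auto intro!: hitI[of _ a] simp: dist_commute)
  qed
  then have "emeasure \<mu> lines \<le> emeasure \<mu> (\<Union>y\<in>D. hit y r)"
    using D by (intro emeasure_mono) auto
  also have "\<dots> = 0"
    using null_sets_UN'[OF D(1), of "\<lambda>y. hit y r" \<mu>] z by (auto simp: null_sets_def)
  finally show False using haar by (simp add: haar_line_measure_def)
qed

lemma line_meets_infnorm_sphere:
  fixes l :: "'a set"
  assumes l: "l \<in> lines" "a \<in> l" "infnorm a \<le> D"
  obtains y where "y \<in> l" "infnorm y = D"
proof -
  obtain u where u: "dirn l u" using dirn_exists l by blast
  \<comment> \<open>At parameter \<open>T\<close> the point has Euclidean norm at least
    \<open>sqrt d * D\<close>, hence sup-norm at least \<open>D\<close>, and the intermediate value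
    theorem applies.\<close>
  define T where "T = sqrt DIM('a) * D + norm a"
  have D: "D \<ge> 0" using l(3) infnorm_pos_le[of a] by linarith
  then have T: "T \<ge> 0" by (simp add: T_def)
  have "sqrt DIM('a) * D \<le> norm (a + T *\<^sub>R u)"
  proof -
    have "norm (T *\<^sub>R u) \<le> norm (a + T *\<^sub>R u) + norm a"
      using norm_triangle_ineq4[of "a + T *\<^sub>R u" a] by simp
    then show ?thesis using dirn_norm[OF u] T by (simp add: T_def)
  qed
  also have "\<dots> \<le> sqrt DIM('a) * infnorm (a + T *\<^sub>R u)" using norm_le_infnorm[of "a + T *\<^sub>R u"] by simp
  finally have "D \<le> infnorm (a + T *\<^sub>R u)" by simp
  moreover have "continuous_on {0..T} (\<lambda>t. infnorm (a + t *\<^sub>R u))"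
    by (intro continuous_on_infnorm continuous_intros)
  ultimately obtain t where "infnorm (a + t *\<^sub>R u) = D"
    using IVT'[of "\<lambda>t. infnorm (a + t *\<^sub>R u)" 0 D T] l(3) T by auto
  then show ?thesis using that dirn_mem[OF u l(2)] by blast
qed

text \<open>A line through the ball around \<open>x\<close> leaves the cube of side \<open>2D\<close> around \<open>x\<close>. Cover the boundary of the
  cube by balls of radius \<open>\<rho>\<close> and pull their centres back to the sphere of radius \<open>D\<close>, where all of
  them are equivalent by isometry invariance.\<close>

lemma emeasure_hit_le:
  obtains C :: real where "C > 0"
    "\<And>r \<rho> D x y. 0 < r \<Longrightarrow> r \<le> \<rho> \<Longrightarrow> \<rho> \<le> D \<Longrightarrow> dist x y = D \<Longrightarrow>
      emeasure \<mu> (hit x r) \<le> ennreal (C * (D / \<rho>) ^ (DIM('a) - 1)) * emeasure \<mu> (hit x r \<inter> hit y \<rho>)"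
proof -
  obtain C :: real where C: "C > 0"
    "\<And>\<rho> D. 0 < \<rho> \<Longrightarrow> \<rho> \<le> D \<Longrightarrow> \<exists>G. finite G \<and> real (card G) \<le> C * (D / \<rho>) ^ (DIM('a) - 1) \<and>
      (\<forall>y::'a::euclidean_space. infnorm y = D \<longrightarrow> (\<exists>g\<in>G. norm g \<ge> D \<and> dist g y < \<rho>))"
    using infnorm_sphere_cover[where 'a = 'a] by metis
  have "emeasure \<mu> (hit x r) \<le> ennreal (C * (D / \<rho>) ^ (DIM('a) - 1)) * emeasure \<mu> (hit x r \<inter> hit y \<rho>)"
    if h: "0 < r" "r \<le> \<rho>" "\<rho> \<le> D" "dist x y = D" for r \<rho> D and x y :: 'a
  proof -
    obtain G :: "'a set" where G: "finite G" "real (card G) \<le> C * (D / \<rho>) ^ (DIM('a) - 1)"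
      "\<And>y. infnorm y = D \<Longrightarrow> \<exists>g\<in>G. norm g \<ge> D \<and> dist g y < \<rho>"
      using C(2)[of \<rho> D] h by auto
    let ?E = "emeasure \<mu> (hit x r \<inter> hit y \<rho>)"
    let ?G = "{g \<in> G. norm g \<ge> D}"
    have one: "emeasure \<mu> (hit 0 r \<inter> hit g \<rho>) \<le> ?E" if g: "g \<in> ?G" for g
    proof -
      let ?g = "(D / norm g) *\<^sub>R g"
      have g0: "norm g > 0" "norm g \<ge> D" using g h by auto
      have seg: "?g \<in> closed_segment 0 g"
        using g0 h by (auto simp: closed_segment_def intro!: exI[of _ "D / norm g"])
      have "hit 0 r \<subseteq> hit (0::'a) \<rho>" using h by (intro hit_mono) auto
      then have "hit 0 r \<inter> hit g \<rho> \<subseteq> hit 0 r \<inter> hit ?g \<rho>"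
        using hit_convex[OF _ _ seg] by blast
      then have "emeasure \<mu> (hit 0 r \<inter> hit g \<rho>) \<le> emeasure \<mu> (hit 0 r \<inter> hit ?g \<rho>)"
        by (intro emeasure_mono) auto
      also have "\<dots> = ?E" using h g0 by (intro emeasure_hit2_cong) (simp add: dist_norm)
      finally show ?thesis .
    qed
    have "hit 0 r \<subseteq> (\<Union>g\<in>?G. hit 0 r \<inter> hit g \<rho>)"
    proof
      fix l assume l: "l \<in> hit (0::'a) r"
      then obtain a where a: "l \<in> lines" "a \<in> l" "norm a < r" by (auto elim: hitE)
      then have "infnorm a \<le> D" using infnorm_le_norm[of a] h by linarith
      then obtain z where z: "z \<in> l" "infnorm z = D" using line_meets_infnorm_sphere a by blast
      then obtain g where "g \<in> ?G" "dist g z < \<rho>" using G(3) by auto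
      then show "l \<in> (\<Union>g\<in>?G. hit 0 r \<inter> hit g \<rho>)" using l z a hitI[of l z g \<rho>] by auto
    qed
    then have "emeasure \<mu> (hit 0 r) \<le> emeasure \<mu> (\<Union>g\<in>?G. hit 0 r \<inter> hit g \<rho>)"
      using G(1) by (intro emeasure_mono sets.finite_UN) auto
    also have "\<dots> \<le> (\<Sum>g\<in>?G. emeasure \<mu> (hit 0 r \<inter> hit g \<rho>))"
      using G(1) by (intro emeasure_subadditive_finite) auto
    also have "\<dots> \<le> (\<Sum>g\<in>?G. ?E)" by (intro sum_mono one)
    also have "\<dots> = of_nat (card ?G) * ?E" by simp
    also have "\<dots> \<le> ennreal (C * (D / \<rho>) ^ (DIM('a) - 1)) * ?E"
    proof (rule mult_right_mono)
      have "card ?G \<le> card G" using G(1) by (intro card_mono) auto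
      then have "real (card ?G) \<le> C * (D / \<rho>) ^ (DIM('a) - 1)" using G(2) by linarith
      then show "of_nat (card ?G) \<le> ennreal (C * (D / \<rho>) ^ (DIM('a) - 1))"
        by (metis ennreal_leI ennreal_of_nat_eq_real_of_nat)
    qed simp
    finally show ?thesis using emeasure_hit_cong[of x r 0] by simp
  qed
  then show ?thesis using C(1) that by blast
qed

lemma emeasure_hit2_ge:
  assumes g: "ennreal g \<le> emeasure \<mu> (hit x r)" "g \<ge> 0" and K: "K > 0"
    and le: "emeasure \<mu> (hit x r) \<le> ennreal K * E"
  shows "ennreal (g / K) \<le> E"
proof (cases E rule: ennreal_cases)
  case (real e)
  have "ennreal g \<le> ennreal (K * e)" using g le K real by (metis order_trans ennreal_mult' less_imp_le)
  then have "g \<le> K * e" using real K by (simp add: ennreal_le_iff)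
  then have "g / K \<le> e" using K by (simp add: field_simps)
  then show ?thesis using real by (simp add: ennreal_leI)
qed auto

text \<open>Among the lines passing near \<open>x\<close>, those aiming at a ball of radius \<rho>
  at distance \<open>D\<close> make up at least a fraction of order
  \<open>(\<rho> / D) ^ (d - 1)\<close>, the relative size of that ball on the sphere of radius
  \<open>D\<close>.\<close>

lemma thin_hit_bound:
  obtains c :: real where "c > 0"
    "\<And>\<rho> D x y. 1 / 10 \<le> \<rho> \<Longrightarrow> \<rho> \<le> D \<Longrightarrow> dist x y = D \<Longrightarrow>
      ennreal (c * (\<rho> / D) ^ (DIM('a) - 1)) \<le> emeasure \<mu> (hit x (1 / 10) \<inter> hit y \<rho>)"
proof -
  obtain C where C: "C > 0"
    "\<And>r \<rho> D x y. 0 < r \<Longrightarrow> r \<le> \<rho> \<Longrightarrow> \<rho> \<le> D \<Longrightarrow> dist x y = D \<Longrightarrow>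
      emeasure \<mu> (hit x r) \<le> ennreal (C * (D / \<rho>) ^ (DIM('a) - 1)) * emeasure \<mu> (hit x r \<inter> hit y \<rho>)"
    using emeasure_hit_le by metis
  \<comment> \<open>Truncation at 1 yields a positive real lower bound without first showing that
    the measure is finite.\<close>
  define g where "g = enn2real (min 1 (emeasure \<mu> (hit 0 (1 / 10))))"
  have gm: "ennreal g = min 1 (emeasure \<mu> (hit 0 (1 / 10)))"
    unfolding g_def by (intro ennreal_enn2real) (simp add: min_less_iff_disj)
  then have "ennreal g > 0" using emeasure_hit_pos[of "1/10" 0] by simp
  then have g: "g > 0" by simp
  have gx: "ennreal g \<le> emeasure \<mu> (hit x (1 / 10))" for x
    using gm emeasure_hit_cong[of x "1/10" 0] by simp
  have "ennreal (g / C * (\<rho> / D) ^ (DIM('a) - 1)) \<le> emeasure \<mu> (hit x (1 / 10) \<inter> hit y \<rho>)"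
    if h: "1 / 10 \<le> \<rho>" "\<rho> \<le> D" "dist x y = D" for \<rho> D x y
  proof -
    have "ennreal (g / (C * (D / \<rho>) ^ (DIM('a) - 1))) \<le> emeasure \<mu> (hit x (1 / 10) \<inter> hit y \<rho>)"
      using h C g by (intro emeasure_hit2_ge[OF gx _ _ C(2)]) auto
    moreover have "g / (C * (D / \<rho>) ^ (DIM('a) - 1)) = g / C * (\<rho> / D) ^ (DIM('a) - 1)"
      by (simp add: power_divide)
    ultimately show ?thesis by simp
  qed
  moreover have "g / C > 0" using g C by simp
  ultimately show ?thesis using that by blast
qed

lemma sum_emeasure_le_Union:
  assumes "finite I" "\<And>i. i \<in> I \<Longrightarrow> B i \<in> sets \<mu>" "disjoint_family_on B I"
    and c: "\<And>i. i \<in> I \<Longrightarrow> ennreal c \<le> emeasure \<mu> (B i)" "c \<ge> 0"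
  shows "ennreal (real (card I) * c) \<le> emeasure \<mu> (\<Union>i\<in>I. B i)"
proof -
  have "ennreal (real (card I) * c) = (\<Sum>i\<in>I. ennreal c)"
    by (simp add: ennreal_mult' ennreal_of_nat_eq_real_of_nat)
  also have "\<dots> \<le> (\<Sum>i\<in>I. emeasure \<mu> (B i))" by (intro sum_mono c)
  also have "\<dots> = emeasure \<mu> (\<Union>i\<in>I. B i)" using assms by (intro sum_emeasure) auto
  finally show ?thesis .
qed

text \<open>Lines nearly parallel to \<open>e\<close> through different lattice points of the hyperplane orthogonal to \<open>e\<close>
  are different.\<close>

lemma hit_growth:
  obtains c :: real where "c > 0"
    "\<And>r x. 4 \<le> r \<Longrightarrow> ennreal (c * r ^ (DIM('a) - 1)) \<le> emeasure \<mu> (hit x r)"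
proof -
  let ?d = "real DIM('a)"
  have d: "?d \<ge> 1" by (simp add: Suc_leI)
  obtain c0 where c0: "c0 > 0" "\<And>\<rho> D x y. 1 / 10 \<le> \<rho> \<Longrightarrow> \<rho> \<le> D \<Longrightarrow> dist x y = D \<Longrightarrow>
      ennreal (c0 * (\<rho> / D) ^ (DIM('a) - 1)) \<le> emeasure \<mu> (hit x (1 / 10) \<inter> hit y \<rho>)"
    using thin_hit_bound by metis
  define c1 where "c1 = c0 * (1 / 40) ^ (DIM('a) - 1)"
  have c1: "c1 > 0" using c0 by (simp add: c1_def)
  have "ennreal (c1 * (1 / (6 * ?d)) ^ (DIM('a) - 1) * r ^ (DIM('a) - 1)) \<le> emeasure \<mu> (hit x r)"
    if r: "4 \<le> r" for r x
  proof -
    obtain e :: 'a where e: "e \<in> Basis" using nonempty_Basis by blast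
    \<comment> \<open>Lattice points then have norm at most \<open>3 * n * d \<le> r / 2\<close>, so
      their balls stay inside \<open>ball 0 r\<close>, while \<open>n + 1\<close> is still of order
      \<open>r\<close>.\<close>
    define n where "n = nat \<lfloor>r / (6 * ?d)\<rfloor>"
    have n: "real n \<le> r / (6 * ?d)" "r / (6 * ?d) \<le> real (n + 1)"
      using r d unfolding n_def by (auto intro: of_nat_floor) linarith
    obtain G where G: "finite G" "card G = (n + 1) ^ card (Basis - {e})" "\<And>g. g \<in> G \<Longrightarrow> g \<bullet> e = 0"
      "\<And>g. g \<in> G \<Longrightarrow> norm g \<le> 3 * real n * real (card (Basis - {e}))"
      "\<And>g h. g \<in> G \<Longrightarrow> h \<in> G \<Longrightarrow> g \<noteq> h \<Longrightarrow> dist g h \<ge> 3"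
      using lattice_packing[of "Basis - {e}" n] e by auto
    \<comment> \<open>A target of radius \<open>r / 40\<close> at distance \<open>r\<close> confines
      the directions to within 1/10 of \<open>e\<close>, and each of these sets has measure at least
      \<open>c1\<close>, whatever \<open>r\<close> is.\<close>
    let ?B = "\<lambda>g. hit g (1 / 10) \<inter> hit (g + r *\<^sub>R e) (r / 40)"
    have disj: "disjoint_family_on ?B G"
      unfolding disjoint_family_on_def
    proof (intro ballI impI, rule ccontr)
      fix g h assume gh: "g \<in> G" "h \<in> G" "g \<noteq> h" "?B g \<inter> ?B h \<noteq> {}"
      then obtain l where l: "l \<in> hit g (1 / 10)" "l \<in> hit h (1 / 10)" "l \<in> hit (g + r *\<^sub>R e) (r / 40)" by auto
      obtain a where a: "l \<in> lines" "a \<in> l" "dist g a < 1 / 10" using l by (auto elim: hitE)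
      obtain b where b: "b \<in> l" "dist h b < 1 / 10" using l by (auto elim: hitE)
      obtain z where z: "z \<in> l" "dist (g + r *\<^sub>R e) z < r / 40" using l by (auto elim: hitE)
      have "norm (z - a - r *\<^sub>R e) \<le> dist (g + r *\<^sub>R e) z + dist g a"
        using norm_triangle_ineq4[of "g - a" "g + r *\<^sub>R e - z"] by (simp add: dist_norm norm_minus_commute algebra_simps)
      also have "\<dots> \<le> r / 20" using a z r by linarith
      finally obtain u where u: "dirn l u" "norm (u - e) \<le> 2 * (r / 20) / r"
        using dirn_near[OF a(1,2) z(1), of e r "r / 20"] e r by auto
      obtain t where t: "b = a + t *\<^sub>R u" using dirn_between[OF u(1) a(2) b(1)] by blast
      \<comment> \<open>A line common to two of the sets travels a distance of at least 2 between
        them, nearly along \<open>e\<close>, so its component along \<open>e\<close> changes by at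
        least 9/5. Since \<open>g\<close> and \<open>h\<close> lie in the hyperplane orthogonal to
        \<open>e\<close>, that change is at most 1/5.\<close>
      have "\<bar>(b - a) \<bullet> e\<bar> \<le> \<bar>(h - g) \<bullet> e\<bar> + (dist h b + dist g a)"
      proof -
        have "(b - a) \<bullet> e = (h - g) \<bullet> e - (h - b) \<bullet> e + (g - a) \<bullet> e" by (simp add: algebra_simps)
        then show ?thesis
          using Basis_le_norm[OF e, of "h - b"] Basis_le_norm[OF e, of "g - a"] by (simp add: dist_norm)
      qed
      then have 1: "\<bar>t * (u \<bullet> e)\<bar> \<le> 1 / 5" using t G(3) gh a b by (simp add: inner_diff_left)
      have "dist g h \<le> dist g a + dist a b + dist h b" using dist_triangle[of g h a] dist_triangle[of a h b] by (simp add: dist_commute)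
      moreover have "dist a b = \<bar>t\<bar>" using t dirn_norm[OF u(1)] by (simp add: dist_norm)
      ultimately have t2: "\<bar>t\<bar> \<ge> 2" using G(5)[OF gh(1-3)] a b by linarith
      have "\<bar>u \<bullet> e - e \<bullet> e\<bar> \<le> norm (u - e)"
        using Basis_le_norm[OF e, of "u - e"] by (simp add: inner_diff_left)
      then have "\<bar>u \<bullet> e\<bar> \<ge> 9 / 10" using u(2) e r by auto
      then have "\<bar>t\<bar> * \<bar>u \<bullet> e\<bar> \<ge> 2 * (9 / 10)" using t2 by (intro mult_mono) auto
      then show False using 1 by (simp add: abs_mult)
    qed
    have m: "ennreal c1 \<le> emeasure \<mu> (?B g)" for g
    proof -
      have "ennreal (c0 * (r / 40 / r) ^ (DIM('a) - 1)) \<le> emeasure \<mu> (?B g)"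
        using r e by (intro c0(2)) (auto simp: dist_norm)
      then show ?thesis using r by (simp add: c1_def)
    qed
    have sub: "(\<Union>g\<in>G. ?B g) \<subseteq> hit 0 r"
    proof -
      have "hit g (1 / 10) \<subseteq> hit 0 r" if "g \<in> G" for g
      proof (rule hit_mono)
        have "norm g \<le> 3 * real n * ?d" using G(4)[OF that] by (rule order_trans) (intro mult_left_mono, auto intro: card_mono)
        also have "\<dots> \<le> r / 2" using n(1) d by (simp add: field_simps)
        finally show "dist g 0 + 1 / 10 \<le> r" using r by simp
      qed
      then show ?thesis by blast
    qed
    have "c1 * (1 / (6 * ?d)) ^ (DIM('a) - 1) * r ^ (DIM('a) - 1) = c1 * (r / (6 * ?d)) ^ (DIM('a) - 1)"
      by (simp add: power_divide)
    also have "\<dots> \<le> c1 * real (n + 1) ^ (DIM('a) - 1)"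
      using n(2) r d c1 by (intro mult_left_mono power_mono) auto
    also have "\<dots> = real (card G) * c1"
      using G(2) e by simp
    finally have "ennreal (c1 * (1 / (6 * ?d)) ^ (DIM('a) - 1) * r ^ (DIM('a) - 1)) \<le> ennreal (real (card G) * c1)"
      by (rule ennreal_leI)
    also have "\<dots> \<le> emeasure \<mu> (\<Union>g\<in>G. ?B g)"
      using G(1) disj m c1 by (intro sum_emeasure_le_Union) auto
    also have "\<dots> \<le> emeasure \<mu> (hit 0 r)" using sub by (intro emeasure_mono) auto
    also have "\<dots> = emeasure \<mu> (hit x r)" by (rule emeasure_hit_cong)
    finally show ?thesis .
  qed
  moreover have "c1 * (1 / (6 * ?d)) ^ (DIM('a) - 1) > 0" using c1 d by simp
  ultimately show ?thesis using that by blast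
qed

text \<open>The lines through \<open>ball x r\<close> have measure at least of order
  \<open>r ^ (d - 1)\<close>, and at least a fraction of order \<open>(r / D) ^ (d - 1)\<close> of
  them reaches the second ball.\<close>

lemma fat_hit_bound:
  obtains c :: real where "c > 0"
    "\<And>r D x y. 4 \<le> r \<Longrightarrow> r \<le> D \<Longrightarrow> dist x y = D \<Longrightarrow>
      ennreal (c * (r\<^sup>2 / D) ^ (DIM('a) - 1)) \<le> emeasure \<mu> (hit x r \<inter> hit y r)"
proof -
  obtain C where C: "C > 0"
    "\<And>r \<rho> D x y. 0 < r \<Longrightarrow> r \<le> \<rho> \<Longrightarrow> \<rho> \<le> D \<Longrightarrow> dist x y = D \<Longrightarrow>
      emeasure \<mu> (hit x r) \<le> ennreal (C * (D / \<rho>) ^ (DIM('a) - 1)) * emeasure \<mu> (hit x r \<inter> hit y \<rho>)"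
    using emeasure_hit_le by metis
  obtain g where g: "g > 0" "\<And>r x. 4 \<le> r \<Longrightarrow> ennreal (g * r ^ (DIM('a) - 1)) \<le> emeasure \<mu> (hit x r)"
    using hit_growth by metis
  have "ennreal (g / C * (r\<^sup>2 / D) ^ (DIM('a) - 1)) \<le> emeasure \<mu> (hit x r \<inter> hit y r)"
    if h: "4 \<le> r" "r \<le> D" "dist x y = D" for r D x y
  proof -
    have "ennreal ((g * r ^ (DIM('a) - 1)) / (C * (D / r) ^ (DIM('a) - 1))) \<le> emeasure \<mu> (hit x r \<inter> hit y r)"
      using h C g(1) by (intro emeasure_hit2_ge[OF g(2) _ _ C(2)]) auto
    moreover have "(g * r ^ (DIM('a) - 1)) / (C * (D / r) ^ (DIM('a) - 1)) = g / C * (r\<^sup>2 / D) ^ (DIM('a) - 1)"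
      by (simp add: power_divide power2_eq_square power_mult_distrib)
    ultimately show ?thesis by simp
  qed
  moreover have "g / C > 0" using g C by simp
  ultimately show ?thesis using that by blast
qed

text \<open>The factor \<rho> gained over \<open>thin_hit_bound\<close> comes from letting the
  starting point slide along \<open>f\<close>. Well separated starting points give disjoint
  families: a line through two of them is almost parallel to \<open>f\<close>, whereas a line
  reaching the target is almost parallel to \<open>e\<close>.\<close>

lemma transversal_family:
  assumes \<gamma>: "0 < \<gamma>" "\<gamma> \<le> 1"
  obtains c :: real where "c > 0"
    "\<And>f e x \<rho> D. norm f = 1 \<Longrightarrow> norm e = 1 \<Longrightarrow> norm (f - e) \<ge> \<gamma> \<Longrightarrow> norm (f + e) \<ge> \<gamma> \<Longrightarrow>
      1 \<le> \<rho> \<Longrightarrow> \<rho> \<le> \<gamma> / 60 * D \<Longrightarrow> \<exists>A. openin line_topology A \<and>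
      ennreal (c * \<rho> * (\<rho> / D) ^ (DIM('a) - 1)) \<le> emeasure \<mu> A \<and>
      (\<forall>l\<in>A. \<exists>t\<in>{0..\<rho>}. l \<in> hit (x + t *\<^sub>R f) (1 / 10) \<and> l \<in> hit (x + D *\<^sub>R e) \<rho>)"
proof -
  obtain c0 where c0: "c0 > 0" "\<And>\<rho> D x y. 1 / 10 \<le> \<rho> \<Longrightarrow> \<rho> \<le> D \<Longrightarrow> dist x y = D \<Longrightarrow>
      ennreal (c0 * (\<rho> / D) ^ (DIM('a) - 1)) \<le> emeasure \<mu> (hit x (1 / 10) \<inter> hit y \<rho>)"
    using thin_hit_bound by metis
  \<comment> \<open>With this spacing a line through two of the starting balls has a direction
    within \<open>2 * (1 / 5) / S = \<gamma> / 10\<close> of \<open>f\<close>.\<close>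
  define S where "S = 4 / \<gamma>"
  have S: "S \<ge> 4" using \<gamma> by (simp add: S_def field_simps)
  define c where "c = c0 / S * (1 / 2) ^ (DIM('a) - 1)"
  have c: "c > 0" using c0 S by (simp add: c_def)
  have "\<exists>A. openin line_topology A \<and>
      ennreal (c * \<rho> * (\<rho> / D) ^ (DIM('a) - 1)) \<le> emeasure \<mu> A \<and>
      (\<forall>l\<in>A. \<exists>t\<in>{0..\<rho>}. l \<in> hit (x + t *\<^sub>R f) (1 / 10) \<and> l \<in> hit (x + D *\<^sub>R e) \<rho>)"
    if h: "norm f = 1" "norm e = 1" "norm (f - e) \<ge> \<gamma>" "norm (f + e) \<ge> \<gamma>"
      "1 \<le> \<rho>" "\<rho> \<le> \<gamma> / 60 * D" for f e x :: 'a and \<rho> D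
  proof -
    have D0: "0 < D" using h \<gamma> by (smt (verit) mult_nonneg_nonpos divide_nonneg_pos)
    have "\<gamma> / 60 * D \<le> 1 / 60 * D" using \<gamma> D0 by (intro mult_right_mono) auto
    then have D: "D \<ge> 60 * \<rho>" using h by linarith
    define N where "N = nat \<lfloor>\<rho> / S\<rfloor>"
    have N: "real N \<le> \<rho> / S" "\<rho> / S \<le> real (card {..N})"
      using h S unfolding N_def by (auto intro: of_nat_floor) linarith
    let ?x = "\<lambda>i. x + (real i * S) *\<^sub>R f"
    let ?B = "\<lambda>i. hit (?x i) (1 / 10) \<inter> hit (x + D *\<^sub>R e) \<rho>"
    have iS: "real i * S \<le> \<rho>" if "i \<le> N" for i
    proof -
      have "real i \<le> \<rho> / S" using that N(1) by linarith
      then show ?thesis using S by (simp add: field_simps)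
    qed
    have no: "?B i \<inter> ?B j = {}" if ij: "i < j" "j \<le> N" for i j
    proof (rule ccontr)
      assume "?B i \<inter> ?B j \<noteq> {}"
      then obtain l where l: "l \<in> hit (?x i) (1 / 10)" "l \<in> hit (?x j) (1 / 10)" "l \<in> hit (x + D *\<^sub>R e) \<rho>" by auto
      obtain a where a: "l \<in> lines" "a \<in> l" "dist (?x i) a < 1 / 10" using l by (auto elim: hitE)
      obtain b where b: "b \<in> l" "dist (?x j) b < 1 / 10" using l by (auto elim: hitE)
      obtain z where z: "z \<in> l" "dist (x + D *\<^sub>R e) z < \<rho>" using l by (auto elim: hitE)
      define E where "E = (real j - real i) * S"
      have E: "E \<ge> S" using ij S by (simp add: E_def)
      have "norm (b - a - E *\<^sub>R f) \<le> dist (?x j) b + dist (?x i) a"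
        using norm_triangle_ineq4[of "?x i - a" "?x j - b"]
        by (simp add: dist_norm norm_minus_commute algebra_simps E_def)
      then have "norm (b - a - E *\<^sub>R f) \<le> 1 / 5" using a b by linarith
      then obtain u where u: "dirn l u" "norm (u - f) \<le> 2 * (1 / 5) / E"
        using dirn_near[OF a(1,2) b(1) h(1), of E "1 / 5"] E S by auto
      have "2 * (1 / 5) / E \<le> 2 * (1 / 5) / S" using E S by (intro divide_left_mono) auto
      then have u1: "norm (u - f) \<le> \<gamma> / 10" using u(2) by (simp add: S_def)
      have "norm (z - a - D *\<^sub>R e) \<le> dist (x + D *\<^sub>R e) z + dist (?x i) a + real i * S"
      proof -
        have "z - a - D *\<^sub>R e = (z - (x + D *\<^sub>R e)) + (?x i - a) - (real i * S) *\<^sub>R f" by simp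
        also have "norm \<dots> \<le> norm (z - (x + D *\<^sub>R e)) + norm (?x i - a) + norm ((real i * S) *\<^sub>R f)"
          by (meson norm_triangle_ineq4 norm_triangle_ineq order_trans add_right_mono)
        finally show ?thesis using h(1) S by (simp add: dist_norm norm_minus_commute)
      qed
      also have "\<dots> \<le> 3 * \<rho>" using a z iS[of i] ij h by linarith
      finally obtain u' where u': "dirn l u'" "norm (u' - e) \<le> 2 * (3 * \<rho>) / D"
        using dirn_near[OF a(1,2) z(1) h(2) D0, of "3 * \<rho>"] D h by auto
      have "2 * (3 * \<rho>) / D \<le> \<gamma> / 10" using h D0 by (simp add: field_simps)
      then have u'1: "norm (u' - e) \<le> \<gamma> / 10" using u'(2) by linarith
      \<comment> \<open>The line is within \<gamma>/10 of \<open>f\<close> and of \<open>e\<close>,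
        up to sign. This contradicts the separation of \<open>f\<close> from both \<open>e\<close>
        and \<open>- e\<close>.\<close>
      from dirn_unique[OF u(1) u'(1)] show False
      proof
        assume "u' = u"
        then have "f - e = (u' - e) - (u - f)" by simp
        then have "norm (f - e) \<le> norm (u' - e) + norm (u - f)" by (metis norm_triangle_ineq4)
        then show False using u1 u'1 h \<gamma> by linarith
      next
        assume "u' = - u"
        then have "f + e = - ((u' - e) + (u - f))" by simp
        then have "norm (f + e) \<le> norm (u' - e) + norm (u - f)" by (metis norm_minus_cancel norm_triangle_ineq)
        then show False using u1 u'1 h \<gamma> by linarith
      qed
    qed
    have disj: "disjoint_family_on ?B {..N}"
      unfolding disjoint_family_on_def using no by (metis atMost_iff inf_commute nat_neq_iff)
    have m: "ennreal (c0 * (\<rho> / (2 * D)) ^ (DIM('a) - 1)) \<le> emeasure \<mu> (?B i)" if i: "i \<in> {..N}" for i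
    proof -
      let ?D = "dist (?x i) (x + D *\<^sub>R e)"
      have "?x i - (x + D *\<^sub>R e) = (real i * S) *\<^sub>R f - D *\<^sub>R e" by simp
      then have "?D \<le> real i * S + D" "?D \<ge> D - real i * S"
        using norm_triangle_ineq4[of "(real i * S) *\<^sub>R f" "D *\<^sub>R e"]
          norm_triangle_ineq3[of "(real i * S) *\<^sub>R f" "D *\<^sub>R e"] h S D0 by (auto simp: dist_norm)
      then have "?D \<le> 2 * D" "\<rho> \<le> ?D" using iS[of i] i D h by auto
      then have "\<rho> / (2 * D) \<le> \<rho> / ?D" using h D0 by (intro divide_left_mono mult_pos_pos) linarith+
      then have "c0 * (\<rho> / (2 * D)) ^ (DIM('a) - 1) \<le> c0 * (\<rho> / ?D) ^ (DIM('a) - 1)"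
        using h c0 D0 by (intro mult_left_mono power_mono) auto
      then have "ennreal (c0 * (\<rho> / (2 * D)) ^ (DIM('a) - 1)) \<le> ennreal (c0 * (\<rho> / ?D) ^ (DIM('a) - 1))"
        by (rule ennreal_leI)
      also have "\<dots> \<le> emeasure \<mu> (?B i)" using h \<open>\<rho> \<le> ?D\<close> by (intro c0(2)) auto
      finally show ?thesis .
    qed
    have "c * \<rho> * (\<rho> / D) ^ (DIM('a) - 1) = (\<rho> / S) * (c0 * (\<rho> / (2 * D)) ^ (DIM('a) - 1))"
      by (simp add: c_def power_divide power_mult_distrib mult_ac)
    also have "\<dots> \<le> real (card {..N}) * (c0 * (\<rho> / (2 * D)) ^ (DIM('a) - 1))"
      using N(2) c0 h D0 by (intro mult_right_mono) auto
    finally have "ennreal (c * \<rho> * (\<rho> / D) ^ (DIM('a) - 1)) \<le> ennreal (real (card {..N}) * (c0 * (\<rho> / (2 * D)) ^ (DIM('a) - 1)))"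
      by (rule ennreal_leI)
    also have "\<dots> \<le> emeasure \<mu> (\<Union>i\<in>{..N}. ?B i)"
      using disj m c0 h D0 by (intro sum_emeasure_le_Union) auto
    finally have "ennreal (c * \<rho> * (\<rho> / D) ^ (DIM('a) - 1)) \<le> emeasure \<mu> (\<Union>i\<in>{..N}. ?B i)" .
    moreover have "openin line_topology (\<Union>i\<in>{..N}. ?B i)"
      by (intro openin_Union openin_Int openin_hit) (auto intro: openin_Int openin_hit)
    moreover have "\<exists>t\<in>{0..\<rho>}. l \<in> hit (x + t *\<^sub>R f) (1 / 10) \<and> l \<in> hit (x + D *\<^sub>R e) \<rho>"
      if "l \<in> (\<Union>i\<in>{..N}. ?B i)" for l
    proof -
      obtain i where i: "i \<le> N" "l \<in> ?B i" using \<open>l \<in> _\<close> by auto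
      then show ?thesis using iS[of i] S by (intro bexI[of _ "real i * S"]) auto
    qed
    ultimately show ?thesis by blast
  qed
  then show ?thesis using c that by blast
qed

end


section \<open>Void events of the Poisson line process\<close>

text \<open>A line is closed, so its distance from \<open>x\<close> is attained. The closed-ball
  condition in the definition of the cylinders thereby becomes a countable intersection of open
  ones.\<close>

lemma meets_cball_eq:
  "{l \<in> lines. l \<inter> cball (x::'a::euclidean_space) r \<noteq> {}} = (\<Inter>k::nat. hit x (r + 1 / (real k + 1)))"
proof (intro set_eqI iffI)
  fix l assume "l \<in> {l \<in> lines. l \<inter> cball x r \<noteq> {}}"
  then obtain a where a: "l \<in> lines" "a \<in> l" "dist x a \<le> r" by auto
  have "dist x a < r + 1 / (real k + 1)" for k :: nat
    using a(3) by (smt (verit) divide_pos_pos of_nat_0_le_iff)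
  then show "l \<in> (\<Inter>k::nat. hit x (r + 1 / (real k + 1)))" using a by (auto intro: hitI)
next
  fix l assume l: "l \<in> (\<Inter>k::nat. hit x (r + 1 / (real k + 1)))"
  then have lin: "l \<in> lines" "l \<noteq> {}" by (auto simp: hit_def)
  then obtain a where a: "a \<in> l" "infdist x l = dist x a"
    using infdist_attains_inf[of l x] closed_affine_hull[of l] affine_hull_eq[of l] lines_affine[OF lin(1)] by metis
  have "dist x a \<le> r"
  proof (rule field_le_epsilon)
    fix e :: real assume "e > 0"
    then obtain k :: nat where k: "1 / (real k + 1) < e"
      using reals_Archimedean[of e] by (auto simp: inverse_eq_divide add.commute)
    have "l \<in> hit x (r + 1 / (real k + 1))" using l by blast
    then obtain b where "b \<in> l" "dist x b < r + 1 / (real k + 1)" by (auto elim: hitE)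
    then show "dist x a \<le> r + e" using k a infdist_le[of b l x] by linarith
  qed
  then show "l \<in> {l \<in> lines. l \<inter> cball x r \<noteq> {}}" using lin a by auto
qed

lemma line_point_measure_sets: "line_point_measure N \<Longrightarrow> sets N = sets line_borel"
  by (auto simp: line_point_measure_def)

text \<open>A set of positive mass contains some atom \<open>f i\<close>, and every measurable set
  containing an atom has mass at least 1; so the atom lies in the support.\<close>

lemma line_point_measure_atom:
  assumes N: "line_point_measure N" and B: "B \<in> sets line_borel" "emeasure N B \<noteq> 0"
  shows "\<exists>l\<in>line_support N. l \<in> B" and "emeasure N B \<ge> 1"
proof -
  obtain I :: "nat set" and f where I: "f \<in> I \<rightarrow> lines" "N = distr (count_space I) line_borel f"
    using N by (auto simp: line_point_measure_def)
  have f: "f \<in> measurable (count_space I) line_borel" using I by (simp add: space_line_borel)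
  have e: "emeasure N U = emeasure (count_space I) (f -` U \<inter> I)" if "U \<in> sets line_borel" for U
    using emeasure_distr[OF f that] I by simp
  have pos: "emeasure N U \<ge> 1" if "U \<in> sets line_borel" "i \<in> I" "f i \<in> U" for U i
  proof -
    have "1 = emeasure (count_space I) {i}" using that by simp
    also have "\<dots> \<le> emeasure (count_space I) (f -` U \<inter> I)" using that by (intro emeasure_mono) auto
    finally show ?thesis using e that by simp
  qed
  have "f -` B \<inter> I \<noteq> {}" using B e by auto
  then obtain i where i: "i \<in> I" "f i \<in> B" by auto
  show "emeasure N B \<ge> 1" using pos B i by blast
  have "f i \<in> line_support N"
    unfolding line_support_def
  proof (safe)
    show "f i \<in> lines" using i I by auto
    fix U assume U: "openin line_topology U" "f i \<in> U"
    have "emeasure N U \<ge> 1" using pos[OF openin_line_borel[OF U(1)] i(1) U(2)] .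
    then show "emeasure N U > 0" using order_less_le_trans zero_less_one by blast
  qed
  then show "\<exists>l\<in>line_support N. l \<in> B" using i by blast
qed

lemma line_support_lines: "l \<in> line_support N \<Longrightarrow> l \<in> lines"
  by (simp add: line_support_def)

lemma cyl_mem_iff: "x \<in> cyl l \<longleftrightarrow> l \<inter> cball x 1 \<noteq> {}"
proof
  assume "x \<in> cyl l"
  then obtain a y where "x = a + y" "a \<in> l" "norm y \<le> 1" by (auto simp: cyl_def)
  then have "a \<in> l \<inter> cball x 1" by (simp add: dist_norm)
  then show "l \<inter> cball x 1 \<noteq> {}" by blast
next
  assume "l \<inter> cball x 1 \<noteq> {}"
  then obtain a where "a \<in> l" "dist x a \<le> 1" by auto
  then show "x \<in> cyl l"
    unfolding cyl_def mem_Collect_eq by (intro exI[of _ a] exI[of _ "x - a"]) (auto simp: dist_norm norm_minus_commute)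
qed

lemma cylinder_set_mem_iff:
  "x \<in> cylinder_set N \<longleftrightarrow> (\<exists>l\<in>line_support N. l \<inter> cball x 1 \<noteq> {})"
  by (simp add: cylinder_set_def cyl_mem_iff)

locale poisson_lines = line_haar \<mu>
  for \<mu> :: "'a::euclidean_space set measure" +
  fixes P :: "'w measure" and \<omega> :: "'w \<Rightarrow> 'a set measure" and u :: real
  assumes u: "u > 0"
    and poisson: "poisson_line_process P (scale_measure (ennreal u) \<mu>) \<omega>"

sublocale poisson_lines \<subseteq> prob_space P
  using poisson by (simp add: poisson_line_process_def)

context poisson_lines
begin

lemma point_measure: "w \<in> space P \<Longrightarrow> line_point_measure (\<omega> w)"
  using poisson by (simp add: poisson_line_process_def)

abbreviation random_cylinders :: "'w \<Rightarrow> 'a set" ("\<C>") where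
  "\<C> w \<equiv> cylinder_set (\<omega> w)"

definition vac :: "'a set set \<Rightarrow> 'w set" where
  "vac B = {w \<in> space P. emeasure (\<omega> w) B = 0}"

definition occ :: "'a set set \<Rightarrow> 'w set" where
  "occ B = space P - vac B"

text \<open>Void events form an intersection-stable system, so the independence of the counts of disjoint sets
  carries over to the generated \<open>\<sigma>\<close>-algebras. The set \<open>X\<close> need not be measurable.\<close>

definition evs :: "'a set set \<Rightarrow> 'w set set" where
  "evs X = sigma_sets (space P) {vac B | B. B \<in> sets line_borel \<and> B \<subseteq> X}"

lemma vac_event: "B \<in> sets line_borel \<Longrightarrow> vac B \<in> events"
proof -
  assume "B \<in> sets line_borel"
  then have "(\<lambda>w. emeasure (\<omega> w) B) \<in> borel_measurable P"
    using poisson by (simp add: poisson_line_process_def)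
  then show ?thesis unfolding vac_def by measurable
qed

lemma occ_event: "B \<in> sets line_borel \<Longrightarrow> occ B \<in> events"
  by (simp add: occ_def vac_event sets.compl_sets)

lemma evs_events: "evs X \<subseteq> events"
  unfolding evs_def by (rule sets.sigma_sets_subset) (auto simp: vac_event)

lemma evs_mono: "X \<subseteq> Y \<Longrightarrow> evs X \<subseteq> evs Y"
  unfolding evs_def by (rule sigma_sets_mono') auto

lemma sigma_algebra_evs: "sigma_algebra (space P) (evs X)"
  unfolding evs_def by (rule sigma_algebra_sigma_sets) (auto simp: vac_def)

lemma occ_evs: "B \<in> sets line_borel \<Longrightarrow> B \<subseteq> X \<Longrightarrow> occ B \<in> evs X"
  unfolding occ_def evs_def by (rule sigma_sets.Compl) (auto intro: sigma_sets.Basic)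

lemma evs_Int: "A \<in> evs X \<Longrightarrow> B \<in> evs X \<Longrightarrow> A \<inter> B \<in> evs X"
  using sigma_algebra_evs[of X] by (meson sigma_algebra.axioms(1) algebra.axioms(1) ring_of_sets.axioms(1) semiring_of_sets.Int)

lemma evs_UN: "countable I \<Longrightarrow> (\<And>i. i \<in> I \<Longrightarrow> A i \<in> evs X) \<Longrightarrow> (\<Union>i\<in>I. A i) \<in> evs X"
  using sigma_algebra.countable_UN'[OF sigma_algebra_evs[of X], of I A] by auto

lemma evs_Diff: "A \<in> evs X \<Longrightarrow> B \<in> evs X \<Longrightarrow> A - B \<in> evs X"
  using sigma_algebra_evs[of X] by (meson sigma_algebra.axioms(1) algebra.axioms(1) ring_of_sets.Diff)

lemma evs_compl: "A \<in> evs X \<Longrightarrow> space P - A \<in> evs X"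
  unfolding evs_def by (rule sigma_sets.Compl)

lemma vac_mono: "A \<subseteq> B \<Longrightarrow> B \<in> sets line_borel \<Longrightarrow> vac B \<subseteq> vac A"
proof
  fix w assume h: "A \<subseteq> B" "B \<in> sets line_borel" "w \<in> vac B"
  then have "emeasure (\<omega> w) A \<le> emeasure (\<omega> w) B"
    using line_point_measure_sets[OF point_measure, of w] by (intro emeasure_mono) (auto simp: vac_def)
  then show "w \<in> vac A" using h by (simp add: vac_def)
qed

lemma vac_Un: "A \<in> sets line_borel \<Longrightarrow> B \<in> sets line_borel \<Longrightarrow> vac (A \<union> B) = vac A \<inter> vac B"
proof -
  assume AB: "A \<in> sets line_borel" "B \<in> sets line_borel"
  have "w \<in> vac (A \<union> B)" if w: "w \<in> vac A \<inter> vac B" for w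
  proof -
    have ws: "w \<in> space P" using w by (simp add: vac_def)
    have "emeasure (\<omega> w) (A \<union> B) \<le> emeasure (\<omega> w) A + emeasure (\<omega> w) B"
      using AB line_point_measure_sets[OF point_measure[OF ws]] by (intro emeasure_subadditive) auto
    then show ?thesis using w by (simp add: vac_def)
  qed
  moreover have "vac (A \<union> B) \<subseteq> vac A \<inter> vac B" using vac_mono[of A "A \<union> B"] vac_mono[of B "A \<union> B"] AB by auto
  ultimately show ?thesis by blast
qed

lemma occ_line:
  assumes "w \<in> occ B" "B \<in> sets line_borel"
  obtains l where "l \<in> line_support (\<omega> w)" "l \<in> B"
  using line_point_measure_atom(1)[OF point_measure assms(2)] assms by (auto simp: occ_def vac_def)

text \<open>For finite intensity this is the Poisson formula at \<open>k = 0\<close>. Only lower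
  bounds on the measure are available, so infinite intensity has to be covered as well; there the
  count is infinite almost surely and the void event is null.\<close>

lemma prob_vac_le:
  assumes A: "A \<in> sets line_borel" and l: "ennreal l \<le> emeasure \<mu> A" "l \<ge> 0"
  shows "prob (vac A) \<le> exp (- (u * l))"
proof -
  let ?L = "scale_measure (ennreal u) \<mu>"
  have E: "emeasure ?L A = ennreal u * emeasure \<mu> A" by simp
  show ?thesis
  proof (cases "emeasure ?L A < \<infinity>")
    case True
    then have "\<forall>k::nat. measure P {w \<in> space P. emeasure (\<omega> w) A = of_nat k} =
           measure ?L A ^ k / fact k * exp (- measure ?L A)"
      using poisson A by (simp add: poisson_line_process_def)
    from this[rule_format, of 0] have "prob (vac A) = exp (- measure ?L A)" by (simp add: vac_def)
    moreover have "u * l \<le> measure ?L A"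
    proof -
      have "ennreal (u * l) \<le> emeasure ?L A"
        unfolding E using l u by (simp add: ennreal_mult' mult_left_mono)
      then have "u * l \<le> enn2real (emeasure ?L A)"
        using True l u by (metis enn2real_ennreal enn2real_mono infinity_ennreal_def mult_nonneg_nonneg less_imp_le)
      then show ?thesis by (simp add: measure_def)
    qed
    ultimately show ?thesis by simp
  next
    case False
    then have "emeasure ?L A = \<infinity>" unfolding infinity_ennreal_def by (metis top.not_eq_extremum)
    then have "AE w in P. emeasure (\<omega> w) A = \<infinity>"
      using poisson A unfolding poisson_line_process_def by meson
    then have "AE w in P. w \<notin> vac A" by (rule AE_mp) (simp add: vac_def)
    then have "prob (vac A) = 0" using vac_event[OF A] by (intro prob_eq_0[THEN iffD2])
    then show ?thesis by simp
  qed
qed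

lemma indep_evs:
  fixes X :: "nat \<Rightarrow> 'a set set"
  assumes "disjoint_family_on X I"
  shows "indep_sets (\<lambda>i. evs (X i)) I"
  unfolding evs_def
proof (rule indep_sets_sigma)
  show "Int_stable {vac B |B. B \<in> sets line_borel \<and> B \<subseteq> X i}" for i
  proof (rule Int_stableI)
    fix a b assume "a \<in> {vac B |B. B \<in> sets line_borel \<and> B \<subseteq> X i}" "b \<in> {vac B |B. B \<in> sets line_borel \<and> B \<subseteq> X i}"
    then obtain A B where "a = vac A" "b = vac B" "A \<in> sets line_borel" "B \<in> sets line_borel" "A \<subseteq> X i" "B \<subseteq> X i" by auto
    then show "a \<inter> b \<in> {vac B |B. B \<in> sets line_borel \<and> B \<subseteq> X i}"
      using vac_Un[of A B] by (auto intro!: exI[of _ "A \<union> B"])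
  qed
  show "indep_sets (\<lambda>i. {vac B |B. B \<in> sets line_borel \<and> B \<subseteq> X i}) I"
  proof (rule indep_setsI)
    show "{vac B |B. B \<in> sets line_borel \<and> B \<subseteq> X i} \<subseteq> events" for i by (auto simp: vac_event)
    fix A J assume J: "J \<noteq> {}" "J \<subseteq> I" "finite J" and A: "\<forall>j\<in>J. A j \<in> {vac B |B. B \<in> sets line_borel \<and> B \<subseteq> X j}"
    then obtain B where B: "\<And>j. j \<in> J \<Longrightarrow> A j = vac (B j) \<and> B j \<in> sets line_borel \<and> B j \<subseteq> X j"
      by simp metis
    have "disjoint_family_on B J"
      using assms J B unfolding disjoint_family_on_def by blast
    then have iv: "indep_vars (\<lambda>_. borel) (\<lambda>i w. emeasure (\<omega> w) (B i)) J"
      using poisson B by (auto simp: poisson_line_process_def)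
    have "prob (\<Inter>j\<in>J. (\<lambda>w. emeasure (\<omega> w) (B j)) -` {0} \<inter> space P) =
        (\<Prod>j\<in>J. prob ((\<lambda>w. emeasure (\<omega> w) (B j)) -` {0} \<inter> space P))"
      using J by (intro indep_varsD[OF iv]) auto
    moreover have "(\<lambda>w. emeasure (\<omega> w) (B j)) -` {0} \<inter> space P = A j" if "j \<in> J" for j
      using B[OF that] by (auto simp: vac_def)
    ultimately show "prob (\<Inter>j\<in>J. A j) = (\<Prod>j\<in>J. prob (A j))" by simp
  qed
qed

lemma prob_Int_evs:
  assumes "X \<inter> Y = {}" "A \<in> evs X" "B \<in> evs Y"
  shows "prob (A \<inter> B) = prob A * prob B"
proof -
  let ?X = "\<lambda>i::nat. if i = 0 then X else Y"
  have "indep_sets (\<lambda>i. evs (?X i)) {0, 1}"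
    using assms by (intro indep_evs) (auto simp: disjoint_family_on_def)
  then have "prob (\<Inter>j\<in>{0, 1::nat}. (if j = 0 then A else B)) = (\<Prod>j\<in>{0, 1::nat}. prob (if j = 0 then A else B))"
    using assms by (intro indep_setsD[of "\<lambda>i. evs (?X i)" "{0, 1}"]) auto
  then show ?thesis by (simp add: Int_commute)
qed

text \<open>Decompose according to the first index \<open>i\<close> for which \<open>Ev i\<close> occurs.\<close>

lemma prob_selection_ge:
  assumes "finite I" "X \<inter> Y = {}" and Ev: "\<And>i. i \<in> I \<Longrightarrow> Ev i \<in> evs X"
    and S: "\<And>i. i \<in> I \<Longrightarrow> S i \<in> evs Y" "\<And>i. i \<in> I \<Longrightarrow> prob (S i) \<ge> p"
  shows "prob (\<Union>i\<in>I. Ev i \<inter> S i) \<ge> p * prob (\<Union>i\<in>I. Ev i)"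
  using assms(1) Ev S
proof (induction I rule: finite_induct)
  case empty
  then show ?case by simp
next
  case (insert j I)
  define U where "U = (\<Union>i\<in>I. Ev i)"
  define V where "V = (\<Union>i\<in>I. Ev i \<inter> S i)"
  have IH: "prob V \<ge> p * prob U" unfolding U_def V_def using insert by auto
  have U: "U \<in> evs X" unfolding U_def using insert by (intro evs_UN) (auto intro: countable_finite)
  have Oj: "Ev j \<in> evs X" "S j \<in> evs Y" using insert by auto
  have ev: "F \<in> events" if "F \<in> evs Z" for F Z using that evs_events by blast
  have V: "V \<in> events" unfolding V_def using insert(1) insert.prems
    by (intro sets.finite_UN sets.Int) (auto intro: ev)
  have D: "Ev j - U \<in> evs X" using Oj U evs_Diff by blast
  have "p * prob (Ev j - U) \<le> prob (Ev j - U) * prob (S j)"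
    using mult_right_mono[OF insert.prems(3)[of j], of "prob (Ev j - U)"] by (simp add: mult.commute)
  also have "\<dots> = prob ((Ev j - U) \<inter> S j)" using prob_Int_evs[OF assms(2) D Oj(2)] by simp
  finally have 1: "p * prob (Ev j - U) \<le> prob ((Ev j - U) \<inter> S j)" .
  have "V \<subseteq> U" by (auto simp: U_def V_def)
  then have "prob (V \<union> ((Ev j - U) \<inter> S j)) = prob V + prob ((Ev j - U) \<inter> S j)"
    using V ev[OF D] ev[OF Oj(2)] by (intro finite_measure_Union) auto
  moreover have "prob (V \<union> ((Ev j - U) \<inter> S j)) \<le> prob (\<Union>i\<in>insert j I. Ev i \<inter> S i)"
    using V ev[OF Oj(1)] ev[OF Oj(2)] by (intro finite_measure_mono) (auto simp: V_def)
  moreover have "prob (\<Union>i\<in>insert j I. Ev i) = prob U + prob (Ev j - U)"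
  proof -
    have "(\<Union>i\<in>insert j I. Ev i) = U \<union> (Ev j - U)" by (auto simp: U_def)
    then have "prob (\<Union>i\<in>insert j I. Ev i) = prob (U \<union> (Ev j - U))" by simp
    also have "\<dots> = prob U + prob (Ev j - U)"
      using ev[OF U] ev[OF D] by (intro finite_measure_Union) auto
    finally show ?thesis .
  qed
  ultimately show ?case using IH 1 by (simp add: distrib_left)
qed

lemma prob_all_fail_le:
  fixes X :: "nat \<Rightarrow> 'a set set"
  assumes "disjoint_family_on X {..<n}" "\<And>i. i < n \<Longrightarrow> S i \<in> evs (X i)"
    and p: "\<And>i. i < n \<Longrightarrow> prob (S i) \<ge> p"
  shows "prob (space P - (\<Union>i<n. S i)) \<le> exp (- (real n * p))"
proof (cases "n = 0")
  case False
  have "prob (\<Inter>j\<in>{..<n}. space P - S j) = (\<Prod>j\<in>{..<n}. prob (space P - S j))"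
    using False assms evs_compl by (intro indep_setsD[OF indep_evs[OF assms(1)]]) auto
  also have "\<dots> \<le> (\<Prod>j\<in>{..<n}. exp (- p))"
  proof (rule prod_mono)
    fix j assume j: "j \<in> {..<n}"
    have "S j \<in> events" using assms(2) evs_events j by blast
    then have "prob (space P - S j) = 1 - prob (S j)" by (rule prob_compl)
    also have "\<dots> \<le> 1 - p" using p j by auto
    also have "\<dots> \<le> exp (- p)" using exp_ge_add_one_self[of "- p"] by simp
    finally show "0 \<le> prob (space P - S j) \<and> prob (space P - S j) \<le> exp (- p)" by simp
  qed
  also have "\<dots> = exp (- (real n * p))" by (simp add: exp_of_nat_mult[symmetric])
  finally have "prob (\<Inter>j\<in>{..<n}. space P - S j) \<le> exp (- (real n * p))" .
  moreover have "(\<Inter>j\<in>{..<n}. space P - S j) = space P - (\<Union>i<n. S i)" using False by auto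
  ultimately show ?thesis by simp
qed simp

text \<open>Makes conditioning on a point being covered meaningful. If every open neighbourhood
  \<open>?H k\<close> contains a line, each has mass at least 1; local finiteness permits continuity
  from above, so mass at least 1 survives in the intersection, which consists of the lines meeting
  the closed ball.\<close>

lemma cylinder_set_event: "{w \<in> space P. x \<in> \<C> w} \<in> events"
proof -
  let ?H = "\<lambda>k::nat. hit x (1 + 1 / (real k + 1))"
  have "{w \<in> space P. x \<in> \<C> w} = (\<Inter>k. occ (?H k))"
  proof (intro set_eqI iffI)
    fix w assume "w \<in> {w \<in> space P. x \<in> \<C> w}"
    then obtain l where w: "w \<in> space P" and l: "l \<in> line_support (\<omega> w)" "l \<inter> cball x 1 \<noteq> {}"
      by (auto simp: cylinder_set_mem_iff)
    have "l \<in> (\<Inter>k. ?H k)" using l line_support_lines meets_cball_eq[of x 1] by blast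
    then have "emeasure (\<omega> w) (?H k) > 0" for k
      using l(1) openin_hit unfolding line_support_def by blast
    then have "w \<in> occ (?H k)" for k using w by (simp add: occ_def vac_def less_le)
    then show "w \<in> (\<Inter>k. occ (?H k))" by blast
  next
    fix w assume w: "w \<in> (\<Inter>k. occ (?H k))"
    then have ws: "w \<in> space P" by (auto simp: occ_def)
    note N = point_measure[OF ws]
    note [simp] = line_point_measure_sets[OF N]
    have ge1: "emeasure (\<omega> w) (?H k) \<ge> 1" for k
      using w by (intro line_point_measure_atom(2)[OF N]) (auto simp: occ_def vac_def hit_in_line_borel)
    let ?K = "{l \<in> lines. l \<inter> cball x 2 \<noteq> {}}"
    have K: "?K \<in> sets line_borel"
      unfolding meets_cball_eq by (intro sets.countable_INT) (auto simp: hit_in_line_borel)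
    have fin: "emeasure (\<omega> w) (?H k) \<noteq> \<infinity>" for k
    proof -
      have "1 / (real k + 1) \<le> 1" by simp
      then have "ball x (1 + 1 / (real k + 1)) \<subseteq> cball x 2" unfolding subset_iff mem_ball mem_cball by linarith
      then have "?H k \<subseteq> ?K" unfolding hit_def by blast
      then have "emeasure (\<omega> w) (?H k) \<le> emeasure (\<omega> w) ?K" using K by (intro emeasure_mono) auto
      also have "\<dots> < \<infinity>" using N compactin_meets_cball[of x 2] by (simp add: line_point_measure_def)
      finally show ?thesis by simp
    qed
    have "decseq ?H"
    proof (rule decseq_SucI)
      show "?H (Suc k) \<subseteq> ?H k" for k by (rule hit_mono) (simp add: frac_le)
    qed
    then have "(INF k. emeasure (\<omega> w) (?H k)) = emeasure (\<omega> w) (\<Inter>k. ?H k)"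
      using fin by (intro INF_emeasure_decseq) (auto simp: hit_in_line_borel)
    moreover have "(INF k. emeasure (\<omega> w) (?H k)) \<ge> 1" using ge1 by (intro INF_greatest)
    ultimately have "emeasure (\<omega> w) (\<Inter>k. ?H k) \<noteq> 0" by auto
    moreover have "(\<Inter>k. ?H k) \<in> sets line_borel" by (intro sets.countable_INT) (auto simp: hit_in_line_borel)
    ultimately obtain l where l: "l \<in> line_support (\<omega> w)" "l \<in> (\<Inter>k. ?H k)"
      using line_point_measure_atom(1)[OF N] by blast
    then have "l \<inter> cball x 1 \<noteq> {}" using meets_cball_eq[of x 1] by blast
    then show "w \<in> {w \<in> space P. x \<in> \<C> w}"
      using ws l(1) by (auto simp: cylinder_set_mem_iff)
  qed
  moreover have "(\<Inter>k. occ (?H k)) \<in> events"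
    by (intro sets.countable_INT) (auto simp: occ_event hit_in_line_borel)
  ultimately show ?thesis by simp
qed

end


section \<open>Paths inside the cylinder set\<close>

text \<open>An explicit path witnessing \<open>internal_dist C x y \<le> L\<close>. Paths can be
  concatenated without dealing with an infimum.\<close>

definition path_le :: "'a::euclidean_space set \<Rightarrow> 'a \<Rightarrow> 'a \<Rightarrow> real \<Rightarrow> bool" where
  "path_le C x y L \<longleftrightarrow> (\<exists>(n::nat) z. n \<ge> 1 \<and> z 0 = x \<and> z n = y \<and>
     (\<forall>k\<in>{1..n}. closed_segment (z (k - 1)) (z k) \<subseteq> C) \<and> (\<Sum>j=1..n. norm (z j - z (j - 1))) \<le> L)"

lemma path_le_mono: "path_le C x y L \<Longrightarrow> L \<le> L' \<Longrightarrow> path_le C x y L'"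
  unfolding path_le_def
  by (elim exE conjE, intro exI conjI) (assumption | simp)+

lemma path_le_segment: "closed_segment x y \<subseteq> C \<Longrightarrow> dist x y \<le> L \<Longrightarrow> path_le C x y L"
  unfolding path_le_def
  by (intro exI[of _ "1::nat"] exI[of _ "\<lambda>k::nat. if k = 0 then x else y"])
     (auto simp: dist_norm norm_minus_commute)

lemma path_le_trans:
  fixes x :: "'a::euclidean_space"
  assumes "path_le C x y L" "path_le C y v M"
  shows "path_le C x v (L + M)"
proof -
  obtain n :: nat and z :: "nat \<Rightarrow> 'a" where z: "n \<ge> 1" "z 0 = x" "z n = y" "\<forall>k\<in>{1..n}. closed_segment (z (k - 1)) (z k) \<subseteq> C"
    "(\<Sum>j=1..n. norm (z j - z (j - 1))) \<le> L" using assms(1) unfolding path_le_def by blast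
  obtain m :: nat and s :: "nat \<Rightarrow> 'a" where s: "m \<ge> 1" "s 0 = y" "s m = v" "\<forall>k\<in>{1..m}. closed_segment (s (k - 1)) (s k) \<subseteq> C"
    "(\<Sum>j=1..m. norm (s j - s (j - 1))) \<le> M" using assms(2) unfolding path_le_def by blast
  define q where "q k = (if k \<le> n then z k else s (k - n))" for k
  have q1: "q k = z k" if "k \<le> n" for k using that by (simp add: q_def)
  have q2: "q (n + k) = s k" for k using z s by (cases k) (auto simp: q_def)
  have st: "q (j + n - 1) = s (j - 1)" "q (j + n) = s j" if "1 \<le> j" for j
    using q2[of "j - 1"] q2[of j] that by (simp_all add: add.commute)
  have "(\<Sum>j=1..n + m. norm (q j - q (j - 1))) =
      (\<Sum>j=1..n. norm (q j - q (j - 1))) + (\<Sum>j=n + 1..n + m. norm (q j - q (j - 1)))"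
    by (rule sum.ub_add_nat) simp
  also have "(\<Sum>j=1..n. norm (q j - q (j - 1))) = (\<Sum>j=1..n. norm (z j - z (j - 1)))"
    by (intro sum.cong) (auto simp: q1)
  also have "(\<Sum>j=n + 1..n + m. norm (q j - q (j - 1))) = (\<Sum>j=1..m. norm (q (j + n) - q (j + n - 1)))"
    using sum.shift_bounds_cl_nat_ivl[of "\<lambda>j. norm (q j - q (j - 1))" 1 n m] by (simp add: add.commute)
  also have "\<dots> = (\<Sum>j=1..m. norm (s j - s (j - 1)))"
    by (intro sum.cong refl) (simp only: st atLeastAtMost_iff)
  finally have "(\<Sum>j=1..n + m. norm (q j - q (j - 1))) \<le> L + M" using z s by linarith
  moreover have "closed_segment (q (k - 1)) (q k) \<subseteq> C" if k: "k \<in> {1..n + m}" for k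
  proof (cases "k \<le> n")
    case True
    then have "q (k - 1) = z (k - 1)" "q k = z k" using k by (auto simp: q1)
    then show ?thesis using z(4) k True by auto
  next
    case False
    define j where "j = k - n"
    have j: "k = j + n" "1 \<le> j" "j \<in> {1..m}" using False k by (auto simp: j_def)
    show ?thesis using bspec[OF s(4) j(3)] st[OF j(2)] by (simp add: j(1))
  qed
  ultimately show ?thesis
    unfolding path_le_def using z s q1[of 0] q2[of m]
    by (intro exI[of _ "n + m"] exI[of _ q]) auto
qed

lemma path_le_internal_dist:
  fixes x :: "'a::euclidean_space"
  assumes "path_le C x y L"
  shows "internal_dist C x y \<le> ereal L"
proof -
  obtain n :: nat and z :: "nat \<Rightarrow> 'a" where z: "n \<ge> 1" "z 0 = x" "z n = y" "\<forall>k\<in>{1..n}. closed_segment (z (k - 1)) (z k) \<subseteq> C"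
    "(\<Sum>j=1..n. norm (z j - z (j - 1))) \<le> L" using assms unfolding path_le_def by blast
  have "internal_dist C x y \<le> ereal (\<Sum>j=1..n. norm (z j - z (j - 1)))"
    unfolding internal_dist_def using z by (intro Inf_lower) blast
  also have "\<dots> \<le> ereal L" using z by simp
  finally show ?thesis .
qed

lemma path_le_line:
  assumes "l \<in> lines" "cyl l \<subseteq> C" "a \<in> l" "b \<in> l" "dist a b \<le> L"
  shows "path_le C a b L"
proof (rule path_le_segment)
  have "closed_segment a b \<subseteq> l" using assms lines_convex closed_segment_subset by blast
  moreover have "l \<subseteq> cyl l"
  proof
    fix x assume "x \<in> l"
    then have "x \<in> l \<inter> cball x 1" by simp
    then show "x \<in> cyl l" unfolding cyl_mem_iff by blast
  qed
  ultimately show "closed_segment a b \<subseteq> C" using assms by blast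
qed fact

lemma path_le_radius:
  assumes "cyl l \<subseteq> C" "a \<in> l" "dist a b \<le> 1"
  shows "path_le C a b 1" "path_le C b a 1"
proof -
  have "cball a 1 \<subseteq> cyl l"
  proof
    fix x assume "x \<in> cball a 1"
    then have "a \<in> l \<inter> cball x 1" using assms by (simp add: dist_commute)
    then show "x \<in> cyl l" unfolding cyl_mem_iff by blast
  qed
  moreover have "closed_segment a b \<subseteq> cball a 1" using assms by (intro closed_segment_subset) auto
  ultimately have *: "closed_segment a b \<subseteq> C" using assms by blast
  then show "path_le C a b 1" using assms by (intro path_le_segment) auto
  show "path_le C b a 1" using assms * by (intro path_le_segment) (auto simp: closed_segment_commute dist_commute)
qed

text \<open>The condition concerns all lines near the two segments, whether or not they belong to the process:
  for fixed segments it is a property of the process alone, so union bounds over finitely many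
  segments suffice and no conditioning on the presence of a line is needed.\<close>

definition linked :: "'a::euclidean_space set \<Rightarrow> 'a \<Rightarrow> 'a \<Rightarrow> 'a \<Rightarrow> 'a \<Rightarrow> 'a \<Rightarrow> real \<Rightarrow> bool" where
  "linked C x y x' y' z L \<longleftrightarrow> (\<forall>p q. p \<in> hit x (1 / 10) \<inter> hit y (1 / 10) \<longrightarrow>
     q \<in> hit x' (1 / 10) \<inter> hit y' (1 / 10) \<longrightarrow> cyl p \<subseteq> C \<longrightarrow> cyl q \<subseteq> C \<longrightarrow>
     (\<exists>a\<in>p. \<exists>b\<in>q. dist a z \<le> L \<and> dist b z \<le> L \<and> path_le C a b L))"

lemma linked_mono: "linked C x y x' y' z L \<Longrightarrow> dist z w + L \<le> M \<Longrightarrow> linked C x y x' y' w M"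
proof -
  assume l: "linked C x y x' y' z L" and d: "dist z w + L \<le> M"
  show ?thesis
    unfolding linked_def
  proof (intro allI impI)
    fix p q assume pq: "p \<in> hit x (1 / 10) \<inter> hit y (1 / 10)" "q \<in> hit x' (1 / 10) \<inter> hit y' (1 / 10)"
      "cyl p \<subseteq> C" "cyl q \<subseteq> C"
    then obtain a b where ab: "a \<in> p" "b \<in> q" "dist a z \<le> L" "dist b z \<le> L" "path_le C a b L"
      using l unfolding linked_def by blast
    have "dist a w \<le> M" "dist b w \<le> M"
      using ab d dist_triangle[of a w z] dist_triangle[of b w z] by linarith+
    moreover have "L \<le> M" using d by (smt (verit) zero_le_dist)
    ultimately show "\<exists>a\<in>p. \<exists>b\<in>q. dist a w \<le> M \<and> dist b w \<le> M \<and> path_le C a b M"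
      using ab path_le_mono by blast
  qed
qed

text \<open>Lines near a long segment are near all its parts by \<open>hit_convex\<close>, so
  linking two short pieces links the long segments that contain them.\<close>

lemma linked_segments:
  assumes "linked C x y x' y' z L" "x \<in> closed_segment g h" "y \<in> closed_segment g h"
    "x' \<in> closed_segment g' h'" "y' \<in> closed_segment g' h'"
  shows "linked C g h g' h' z L"
  unfolding linked_def
proof (intro allI impI)
  fix p q assume p: "p \<in> hit g (1 / 10) \<inter> hit h (1 / 10)" and q: "q \<in> hit g' (1 / 10) \<inter> hit h' (1 / 10)"
    and C: "cyl p \<subseteq> C" "cyl q \<subseteq> C"
  have "p \<in> hit x (1 / 10) \<inter> hit y (1 / 10)" "q \<in> hit x' (1 / 10) \<inter> hit y' (1 / 10)"
    using p q hit_convex[OF _ _ assms(2)] hit_convex[OF _ _ assms(3)]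
      hit_convex[OF _ _ assms(4)] hit_convex[OF _ _ assms(5)] by auto
  then show "\<exists>a\<in>p. \<exists>b\<in>q. dist a z \<le> L \<and> dist b z \<le> L \<and> path_le C a b L"
    using assms(1) C unfolding linked_def by blast
qed

text \<open>This fixes the tolerance 1/10 used throughout: two lines through a common ball of that
  radius come within distance 1 of each other, so one can change lines inside a single
  cylinder.\<close>

lemma lines_meet_near:
  assumes "p \<in> hit x (1 / 10)" "m \<in> hit x (1 / 10)"
  obtains a b where "a \<in> p" "b \<in> m" "dist a b \<le> 1" "dist a x < 1 / 10" "dist b x < 1 / 10"
proof -
  obtain a where a: "a \<in> p" "dist x a < 1 / 10" using assms(1) by (rule hitE)
  obtain b where b: "b \<in> m" "dist x b < 1 / 10" using assms(2) by (rule hitE)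
  have "dist a b \<le> 1" using a b dist_triangle[of a b x] by (simp add: dist_commute)
  then show ?thesis using a b that by (simp add: dist_commute)
qed

text \<open>The path leaves \<open>p\<close> for \<open>m\<close> near \<open>v\<close>, follows
  \<open>m\<close> to the given link, crosses to \<open>m'\<close>, follows it to \<open>v'\<close>
  and changes to \<open>q\<close>. Both auxiliary lines must belong to the process; \<open>p\<close>
  and \<open>q\<close> are arbitrary lines with cylinders in \<open>C\<close>.\<close>

lemma linked_glue:
  assumes l: "linked C g h g' h' z L"
    and m: "m \<in> hit g (1 / 10) \<inter> hit h (1 / 10)" "m \<in> hit v (1 / 10)" "cyl m \<subseteq> C"
    and m': "m' \<in> hit g' (1 / 10) \<inter> hit h' (1 / 10)" "m' \<in> hit v' (1 / 10)" "cyl m' \<subseteq> C"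
    and v: "v \<in> closed_segment x y" "v' \<in> closed_segment x' y'"
    and d: "dist v z + L + 1 \<le> M" "dist v' z + L + 1 \<le> M"
  shows "linked C x y x' y' z (3 * M)"
  unfolding linked_def
proof (intro allI impI)
  fix p q assume p: "p \<in> hit x (1 / 10) \<inter> hit y (1 / 10)" "cyl p \<subseteq> C"
    and q: "q \<in> hit x' (1 / 10) \<inter> hit y' (1 / 10)" "cyl q \<subseteq> C"
  have pv: "p \<in> hit v (1 / 10)" using p hit_convex[OF _ _ v(1)] by blast
  have qv: "q \<in> hit v' (1 / 10)" using q hit_convex[OF _ _ v(2)] by blast
  obtain a b where ab: "a \<in> m" "b \<in> m'" "dist a z \<le> L" "dist b z \<le> L" "path_le C a b L"
    using l m m' unfolding linked_def by blast
  obtain a1 a2 where a: "a1 \<in> p" "a2 \<in> m" "dist a1 a2 \<le> 1" "dist a1 v < 1 / 10" "dist a2 v < 1 / 10"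
    using lines_meet_near[OF pv m(2)] by blast
  obtain b1 b2 where b: "b1 \<in> q" "b2 \<in> m'" "dist b1 b2 \<le> 1" "dist b1 v' < 1 / 10" "dist b2 v' < 1 / 10"
    using lines_meet_near[OF qv m'(2)] by blast
  have ml: "m \<in> lines" "m' \<in> lines" using m m' by (auto simp: hit_def)
  have L: "L \<ge> 0" using ab(3) zero_le_dist order_trans by blast
  have "dist a2 a \<le> M - 1 / 2" "dist b b2 \<le> M - 1 / 2" "dist a1 z \<le> M" "dist b1 z \<le> M"
    using a b ab d L dist_triangle[of a2 a v] dist_triangle[of v a z] dist_triangle[of b b2 v'] dist_triangle[of b v' z]
      dist_triangle[of a1 z v] dist_triangle[of b1 z v'] by (auto simp: dist_commute)
  note dd = this
  have "path_le C a1 a2 1" using path_le_radius[OF p(2) a(1,3)] by blast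
  moreover have "path_le C a2 a (M - 1 / 2)" using path_le_line[OF ml(1) m(3) a(2) ab(1)] dd by blast
  moreover have "path_le C b b2 (M - 1 / 2)" using path_le_line[OF ml(2) m'(3) ab(2) b(2)] dd by blast
  moreover have "path_le C b2 b1 1" using path_le_radius[OF q(2) b(1,3)] by blast
  ultimately have "path_le C a1 b1 (1 + (M - 1 / 2) + L + (M - 1 / 2) + 1)"
    using ab(5) by (intro path_le_trans)
  then have "path_le C a1 b1 (3 * M)"
  proof (rule path_le_mono)
    have "dist v z \<ge> 0" by simp
    then show "1 + (M - 1 / 2) + L + (M - 1 / 2) + 1 \<le> 3 * M" using d by linarith
  qed
  moreover have "M \<ge> 0" using L d(1) zero_le_dist[of v z] by linarith
  ultimately show "\<exists>a\<in>p. \<exists>b\<in>q. dist a z \<le> 3 * M \<and> dist b z \<le> 3 * M \<and> path_le C a b (3 * M)"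
    using a(1) b(1) dd by (intro bexI[of _ a1] bexI[of _ b1]) auto
qed

lemma linked_glue_left:
  assumes l: "linked C g h x' y' z L"
    and m: "m \<in> hit g (1 / 10) \<inter> hit h (1 / 10)" "m \<in> hit v (1 / 10)" "cyl m \<subseteq> C"
    and v: "v \<in> closed_segment x y"
    and d: "dist v z + L + 1 \<le> M"
  shows "linked C x y x' y' z (3 * M)"
  unfolding linked_def
proof (intro allI impI)
  fix p q assume p: "p \<in> hit x (1 / 10) \<inter> hit y (1 / 10)" "cyl p \<subseteq> C"
    and q: "q \<in> hit x' (1 / 10) \<inter> hit y' (1 / 10)" "cyl q \<subseteq> C"
  have pv: "p \<in> hit v (1 / 10)" using p hit_convex[OF _ _ v] by blast
  obtain a b where ab: "a \<in> m" "b \<in> q" "dist a z \<le> L" "dist b z \<le> L" "path_le C a b L"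
    using l m q unfolding linked_def by blast
  obtain a1 a2 where a: "a1 \<in> p" "a2 \<in> m" "dist a1 a2 \<le> 1" "dist a1 v < 1 / 10" "dist a2 v < 1 / 10"
    using lines_meet_near[OF pv m(2)] by blast
  have ml: "m \<in> lines" using m by (auto simp: hit_def)
  have L: "L \<ge> 0" using ab(3) zero_le_dist order_trans by blast
  have "dist a2 a \<le> M - 1 / 2" "dist a1 z \<le> M"
    using a ab d L dist_triangle[of a2 a v] dist_triangle[of v a z] dist_triangle[of a1 z v]
    by (auto simp: dist_commute)
  moreover have "dist b z \<le> M" using ab(4) d zero_le_dist[of v z] by linarith
  ultimately have dd: "dist a2 a \<le> M - 1 / 2" "dist a1 z \<le> M" "dist b z \<le> M" by auto
  have "path_le C a1 a2 1" using path_le_radius[OF p(2) a(1,3)] by blast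
  moreover have "path_le C a2 a (M - 1 / 2)" using path_le_line[OF ml m(3) a(2) ab(1)] dd by blast
  ultimately have "path_le C a1 b (1 + (M - 1 / 2) + L)"
    using ab(5) by (intro path_le_trans)
  moreover have M: "M \<ge> 1" "L \<le> M" using L d zero_le_dist[of v z] by linarith+
  ultimately have "path_le C a1 b (3 * M)" by - (rule path_le_mono, assumption, linarith)
  then show "\<exists>a\<in>p. \<exists>b\<in>q. dist a z \<le> 3 * M \<and> dist b z \<le> 3 * M \<and> path_le C a b (3 * M)"
    using a(1) ab(2) dd M by (intro bexI[of _ a1] bexI[of _ b]) auto
qed

lemma linked_one_line:
  assumes m: "m \<in> hit v (1 / 10)" "m \<in> hit v' (1 / 10)" "cyl m \<subseteq> C"
    and v: "v \<in> closed_segment x y" "v' \<in> closed_segment x' y'"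
    and d: "dist v z + 1 \<le> M" "dist v' z + 1 \<le> M"
  shows "linked C x y x' y' z (3 * M)"
  unfolding linked_def
proof (intro allI impI)
  fix p q assume p: "p \<in> hit x (1 / 10) \<inter> hit y (1 / 10)" "cyl p \<subseteq> C"
    and q: "q \<in> hit x' (1 / 10) \<inter> hit y' (1 / 10)" "cyl q \<subseteq> C"
  have pv: "p \<in> hit v (1 / 10)" using p hit_convex[OF _ _ v(1)] by blast
  have qv: "q \<in> hit v' (1 / 10)" using q hit_convex[OF _ _ v(2)] by blast
  obtain a1 a2 where a: "a1 \<in> p" "a2 \<in> m" "dist a1 a2 \<le> 1" "dist a1 v < 1 / 10" "dist a2 v < 1 / 10"
    using lines_meet_near[OF pv m(1)] by blast
  obtain b1 b2 where b: "b1 \<in> q" "b2 \<in> m" "dist b1 b2 \<le> 1" "dist b1 v' < 1 / 10" "dist b2 v' < 1 / 10"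
    using lines_meet_near[OF qv m(2)] by blast
  have ml: "m \<in> lines" using m by (auto simp: hit_def)
  have dd: "dist a2 b2 \<le> 2 * M - 1" "dist a1 z \<le> M" "dist b1 z \<le> M"
    using a b d dist_triangle[of a2 b2 v] dist_triangle[of v b2 v'] dist_triangle[of v v' z]
      dist_triangle[of a1 z v] dist_triangle[of b1 z v'] by (auto simp: dist_commute)
  have M: "M \<ge> 1" using d(1) zero_le_dist[of v z] by linarith
  have "path_le C a1 a2 1" using path_le_radius[OF p(2) a(1,3)] by blast
  moreover have "path_le C a2 b2 (2 * M - 1)" using path_le_line[OF ml m(3) a(2) b(2)] dd by blast
  moreover have "path_le C b2 b1 1" using path_le_radius[OF q(2) b(1,3)] by blast
  ultimately have "path_le C a1 b1 (1 + (2 * M - 1) + 1)" by (intro path_le_trans)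
  then have "path_le C a1 b1 (3 * M)" by (rule path_le_mono) (use M in linarith)
  then show "\<exists>a\<in>p. \<exists>b\<in>q. dist a z \<le> 3 * M \<and> dist b z \<le> 3 * M \<and> path_le C a b (3 * M)"
    using a(1) b(1) dd M by (intro bexI[of _ a1] bexI[of _ b1]) auto
qed


section \<open>Configurations of nearly parallel segments\<close>

text \<open>Both \<open>e\<close> and \<open>- e\<close> are kept away from the direction of the
  segment because lines determine their direction only up to sign. The point \<open>p\<close> has
  distance at least \<open>R\<close> from the ends, which leaves room for sliding the starting
  points of \<open>transversal_family\<close>.\<close>

definition crossing :: "real \<Rightarrow> 'a::euclidean_space \<Rightarrow> 'a \<Rightarrow> 'a \<Rightarrow> 'a \<Rightarrow> real \<Rightarrow> bool" where
  "crossing \<gamma> e x y p R \<longleftrightarrow> (\<exists>f. norm f = 1 \<and> \<gamma> \<le> norm (f - e) \<and> \<gamma> \<le> norm (f + e) \<and>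
     (\<forall>t. \<bar>t\<bar> \<le> R \<longrightarrow> p + t *\<^sub>R f \<in> closed_segment x y))"

text \<open>Two segments in direction \<open>v\<close> at offset \<open>s n\<close>. They are long enough to be joined by a segment whose
  direction deviates from \<open>v\<close> by about \<open>\<Gamma>/4\<close>.\<close>

definition conf :: "real \<Rightarrow> real \<Rightarrow> real \<Rightarrow> 'a::euclidean_space \<Rightarrow> 'a \<Rightarrow> 'a \<Rightarrow> 'a \<Rightarrow> 'a \<Rightarrow> 'a \<Rightarrow> 'a \<Rightarrow> bool" where
  "conf \<eta> \<Gamma> s z v n x y x' y' \<longleftrightarrow> norm v = 1 \<and> norm n = 1 \<and> v \<bullet> n = 0 \<and>
     norm (x - (z - (6 * s / \<Gamma>) *\<^sub>R v)) \<le> \<eta> * s \<and> norm (y - (z + (6 * s / \<Gamma>) *\<^sub>R v)) \<le> \<eta> * s \<and>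
     norm (x' - (z + s *\<^sub>R n - (6 * s / \<Gamma>) *\<^sub>R v)) \<le> \<eta> * s \<and>
     norm (y' - (z + s *\<^sub>R n + (6 * s / \<Gamma>) *\<^sub>R v)) \<le> \<eta> * s"

lemma segment_interior:
  fixes x y :: "'a::euclidean_space"
  assumes "x \<noteq> y" "\<bar>t\<bar> \<le> \<tau> * norm (y - x)" "\<bar>t\<bar> \<le> (1 - \<tau>) * norm (y - x)"
  shows "((1 - \<tau>) *\<^sub>R x + \<tau> *\<^sub>R y) + t *\<^sub>R ((y - x) /\<^sub>R norm (y - x)) \<in> closed_segment x y"
proof -
  define \<sigma> where "\<sigma> = \<tau> + t / norm (y - x)"
  have n: "norm (y - x) > 0" using assms by simp
  have "\<bar>t / norm (y - x)\<bar> \<le> \<tau>" "\<bar>t / norm (y - x)\<bar> \<le> 1 - \<tau>"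
    using assms(2,3) n by (simp_all add: field_simps)
  then have "0 \<le> \<sigma>" "\<sigma> \<le> 1" unfolding \<sigma>_def abs_le_iff by linarith+
  moreover have "((1 - \<tau>) *\<^sub>R x + \<tau> *\<^sub>R y) + t *\<^sub>R ((y - x) /\<^sub>R norm (y - x)) = (1 - \<sigma>) *\<^sub>R x + \<sigma> *\<^sub>R y"
    by (simp add: \<sigma>_def algebra_simps divide_inverse)
  ultimately show ?thesis unfolding closed_segment_def by blast
qed

text \<open>By \<open>norm_normalize_diff\<close> the direction of \<open>y - x\<close> differs from
  \<open>v\<close> by at most \<open>2 * r / E\<close>; the hypotheses on \<open>e\<close> reserve
  exactly this loss.\<close>

lemma crossing_near:
  fixes x y v e :: "'a::euclidean_space"
  assumes v: "norm v = 1" and E: "E > 0" and xy: "norm (y - x - E *\<^sub>R v) \<le> r"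
    and g: "\<gamma> + 2 * r / E \<le> norm (e - v)" "\<gamma> + 2 * r / E \<le> norm (e + v)"
    and \<tau>: "R \<le> \<tau> * (E - r)" "R \<le> (1 - \<tau>) * (E - r)" "0 \<le> \<tau>" "\<tau> \<le> 1" and "r < E"
  shows "crossing \<gamma> e x y ((1 - \<tau>) *\<^sub>R x + \<tau> *\<^sub>R y) R"
proof -
  let ?f = "(y - x) /\<^sub>R norm (y - x)"
  have "norm (E *\<^sub>R v) \<le> norm (y - x) + norm (y - x - E *\<^sub>R v)"
    using norm_triangle_ineq4[of "y - x" "y - x - E *\<^sub>R v"] by simp
  then have n: "norm (y - x) \<ge> E - r" using v E xy by simp
  then have ne: "x \<noteq> y" using \<open>r < E\<close> by auto
  have fv: "norm (?f - v) \<le> 2 * r / E"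
    using norm_normalize_diff[OF v E, of "y - x"] xy E by (smt (verit) divide_right_mono)
  have "norm (e - v) \<le> norm (?f - e) + norm (?f - v)"
    using norm_triangle_ineq4[of "?f - v" "?f - e"] by (simp add: add.commute)
  then have 1: "\<gamma> \<le> norm (?f - e)" using fv g by linarith
  have "norm (e + v) \<le> norm (?f + e) + norm (?f - v)"
    using norm_triangle_ineq4[of "?f + e" "?f - v"] by (simp add: add.commute)
  then have 2: "\<gamma> \<le> norm (?f + e)" using fv g by linarith
  have "((1 - \<tau>) *\<^sub>R x + \<tau> *\<^sub>R y) + t *\<^sub>R ?f \<in> closed_segment x y" if "\<bar>t\<bar> \<le> R" for t
  proof (rule segment_interior[OF ne])
    show "\<bar>t\<bar> \<le> \<tau> * norm (y - x)" using that \<tau> mult_left_mono[OF n \<tau>(3)] by linarith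
    show "\<bar>t\<bar> \<le> (1 - \<tau>) * norm (y - x)" using that \<tau> mult_left_mono[OF n, of "1 - \<tau>"] by linarith
  qed
  moreover have "norm ?f = 1" using ne by simp
  ultimately show ?thesis unfolding crossing_def using 1 2 by blast
qed

lemma norm_combine:
  fixes a b :: "'a::real_normed_vector"
  assumes "norm a \<le> r" "norm b \<le> r" "0 \<le> \<tau>" "\<tau> \<le> 1"
  shows "norm ((1 - \<tau>) *\<^sub>R a + \<tau> *\<^sub>R b) \<le> r"
proof -
  have "norm ((1 - \<tau>) *\<^sub>R a + \<tau> *\<^sub>R b) \<le> (1 - \<tau>) * norm a + \<tau> * norm b"
    using norm_triangle_ineq[of "(1 - \<tau>) *\<^sub>R a" "\<tau> *\<^sub>R b"] assms by simp
  also have "\<dots> \<le> (1 - \<tau>) * r + \<tau> * r" using assms by (intro add_mono mult_left_mono) auto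
  finally show ?thesis by (simp add: algebra_simps)
qed

lemma interpolate_symmetric:
  fixes x y z v :: "'a::real_vector"
  shows "((1 - \<tau>) *\<^sub>R x + \<tau> *\<^sub>R y) - (z + ((2 * \<tau> - 1) * a) *\<^sub>R v) =
    (1 - \<tau>) *\<^sub>R (x - (z - a *\<^sub>R v)) + \<tau> *\<^sub>R (y - (z + a *\<^sub>R v))"
proof -
  have "(2 * \<tau> - 1) * a = \<tau> * a + \<tau> * a - a" by (simp add: algebra_simps)
  then have "((2 * \<tau> - 1) * a) *\<^sub>R v = (\<tau> * a) *\<^sub>R v + (\<tau> * a) *\<^sub>R v - a *\<^sub>R v"
    by (simp only: scaleR_add_left scaleR_left_diff_distrib)
  moreover have "(1 - \<tau>) *\<^sub>R (x - (z - a *\<^sub>R v)) + \<tau> *\<^sub>R (y - (z + a *\<^sub>R v)) =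
    ((1 - \<tau>) *\<^sub>R x + \<tau> *\<^sub>R y) - z - ((\<tau> * a) *\<^sub>R v + (\<tau> * a) *\<^sub>R v - a *\<^sub>R v)"
    by (simp add: scaleR_left_diff_distrib scaleR_right_diff_distrib scaleR_add_right left_diff_distrib)
  ultimately show ?thesis by simp
qed

lemma conf_crossing:
  fixes z v n x y x' y' :: "'a::euclidean_space"
  assumes \<Gamma>: "0 < \<Gamma>" "\<Gamma> \<le> 1 / 4" and s: "s > 0" and \<eta>: "\<eta> \<le> 1 / 100"
    and conf: "conf \<eta> \<Gamma> s z v n x y x' y'"
  obtains D e xs ys where "norm e = 1" "ys = xs + D *\<^sub>R e" "3 * s / \<Gamma> \<le> D" "D \<le> 5 * s / \<Gamma>" "dist xs z \<le> s"
    "23 / 100 * \<Gamma> \<le> norm (e - v)" "norm (e - v) \<le> 51 / 100 * \<Gamma>"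
    "crossing (\<Gamma> / 5) e x y xs s" "crossing (\<Gamma> / 5) e x' y' ys s"
    "xs \<in> closed_segment x y" "ys \<in> closed_segment x' y'"
proof -
  define a where "a = s / \<Gamma>"
  have a: "a \<ge> 4 * s" "a > 0" "a * \<Gamma> = s" using \<Gamma> s by (simp_all add: a_def field_simps)
  have v: "norm v = 1" "norm n = 1" "v \<bullet> n = 0" using conf by (auto simp: conf_def)
  have \<eta>s: "\<eta> * s \<le> s / 100" using \<eta> s by simp
  have c: "norm (x - (z - (6 * a) *\<^sub>R v)) \<le> s / 100" "norm (y - (z + (6 * a) *\<^sub>R v)) \<le> s / 100"
     "norm (x' - (z + s *\<^sub>R n - (6 * a) *\<^sub>R v)) \<le> s / 100" "norm (y' - (z + s *\<^sub>R n + (6 * a) *\<^sub>R v)) \<le> s / 100"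
    using conf \<eta>s by (auto simp: conf_def a_def)
  define xs where "xs = (1 - 1 / 2) *\<^sub>R x + (1 / 2) *\<^sub>R y"
  \<comment> \<open>The parameter 5/6 places \<open>ys\<close> near \<open>z + s n + 4 a v\<close>,
    while the midpoint \<open>xs\<close> is near \<open>z\<close>. The connecting vector is close to
    \<open>4 a v + s n\<close>, so it is tilted against \<open>v\<close> by about
    \<open>s / (4 * a) = \<Gamma> / 4\<close>.\<close>
  define ys where "ys = (1 - 5 / 6) *\<^sub>R x' + (5 / 6) *\<^sub>R y'"
  have xsz: "norm (xs - z) \<le> s / 100"
  proof -
    have "xs - z = (1 - 1 / 2) *\<^sub>R (x - (z - (6 * a) *\<^sub>R v)) + (1 / 2) *\<^sub>R (y - (z + (6 * a) *\<^sub>R v))"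
      using interpolate_symmetric[of "1 / 2" x y z "6 * a" v] unfolding xs_def by simp
    then show ?thesis using norm_combine[OF c(1,2), of "1 / 2"] by simp
  qed
  have ysz: "norm (ys - (z + s *\<^sub>R n + (4 * a) *\<^sub>R v)) \<le> s / 100"
  proof -
    have "ys - (z + s *\<^sub>R n + (4 * a) *\<^sub>R v) = (1 - 5 / 6) *\<^sub>R (x' - (z + s *\<^sub>R n - (6 * a) *\<^sub>R v)) + (5 / 6) *\<^sub>R (y' - (z + s *\<^sub>R n + (6 * a) *\<^sub>R v))"
      using interpolate_symmetric[of "5 / 6" x' y' "z + s *\<^sub>R n" "6 * a" v] unfolding ys_def by simp
    then show ?thesis using norm_combine[OF c(3,4), of "5 / 6"] by simp
  qed
  define D where "D = norm (ys - xs)"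
  define e where "e = (ys - xs) /\<^sub>R D"
  have d: "norm (ys - xs - ((4 * a) *\<^sub>R v + s *\<^sub>R n)) \<le> s / 50"
  proof -
    have eq: "ys - xs - ((4 * a) *\<^sub>R v + s *\<^sub>R n) = (ys - (z + s *\<^sub>R n + (4 * a) *\<^sub>R v)) - (xs - z)" by simp
    show ?thesis
      unfolding eq using norm_triangle_ineq4[of "ys - (z + s *\<^sub>R n + (4 * a) *\<^sub>R v)" "xs - z"] xsz ysz by linarith
  qed
  have dv: "norm (ys - xs - (4 * a) *\<^sub>R v) \<le> 51 / 50 * s"
  proof -
    have "ys - xs - (4 * a) *\<^sub>R v = (ys - xs - ((4 * a) *\<^sub>R v + s *\<^sub>R n)) + s *\<^sub>R n" by simp
    then have "norm (ys - xs - (4 * a) *\<^sub>R v) \<le> norm (ys - xs - ((4 * a) *\<^sub>R v + s *\<^sub>R n)) + norm (s *\<^sub>R n)"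
      by (metis norm_triangle_ineq)
    then show ?thesis using d v s by simp
  qed
  have "\<bar>D - norm ((4 * a) *\<^sub>R v)\<bar> \<le> norm (ys - xs - (4 * a) *\<^sub>R v)"
    unfolding D_def by (rule norm_triangle_ineq3)
  then have D: "D \<le> 4 * a + 51 / 50 * s" "D \<ge> 4 * a - 51 / 50 * s" using dv v a by auto
  have D': "3 * a \<le> D" "D \<le> 5 * a" "D > 0" using D a s by linarith+
  have e: "norm e = 1" using D'(3) unfolding e_def D_def by simp
  have ysD: "ys = xs + D *\<^sub>R e" using D'(3) by (simp add: e_def)
  have up: "norm (e - v) \<le> 51 / 100 * \<Gamma>"
  proof -
    have "norm (e - v) \<le> 2 * norm (ys - xs - (4 * a) *\<^sub>R v) / (4 * a)"
      unfolding e_def D_def using a by (intro norm_normalize_diff v) auto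
    also have "\<dots> \<le> 2 * (51 / 50 * s) / (4 * a)" using dv a by (intro divide_right_mono) auto
    also have "\<dots> = 51 / 100 * \<Gamma>" using a s by (simp add: a_def)
    finally show ?thesis .
  qed
  have lo: "23 / 100 * \<Gamma> \<le> norm (e - v)"
  proof -
    \<comment> \<open>The inner product with \<open>n\<close> isolates the offset \<open>s\<close>,
      because \<open>v\<close> is orthogonal to \<open>n\<close>; this bounds the tilt from
      below.\<close>
    have "\<bar>(ys - xs - ((4 * a) *\<^sub>R v + s *\<^sub>R n)) \<bullet> n\<bar> \<le> s / 50"
      using Cauchy_Schwarz_ineq2[of "ys - xs - ((4 * a) *\<^sub>R v + s *\<^sub>R n)" n] d v by simp
    moreover have "(ys - xs - ((4 * a) *\<^sub>R v + s *\<^sub>R n)) \<bullet> n = (ys - xs) \<bullet> n - s"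
      using v by (simp add: inner_diff_left inner_add_left norm_eq_1)
    ultimately have "(ys - xs) \<bullet> n \<ge> 49 / 50 * s" by linarith
    also have "(ys - xs) \<bullet> n = D * ((e - v) \<bullet> n)" using D'(3) v by (simp add: e_def inner_diff_left)
    finally have "49 / 50 * s \<le> D * ((e - v) \<bullet> n)" .
    also have "\<dots> \<le> D * norm (e - v)"
      using norm_cauchy_schwarz[of "e - v" n] v D' by (intro mult_left_mono) auto
    also have "\<dots> \<le> (4 * a + 51 / 50 * s) * norm (e - v)" using D by (intro mult_right_mono) auto
    also have "\<dots> \<le> (4 * a + 51 / 200 * a) * norm (e - v)" using a by (intro mult_right_mono) auto
    finally have "49 / 50 * (a * \<Gamma>) \<le> (851 / 200 * a) * norm (e - v)" using a by simp
    then have "a * (49 / 50 * \<Gamma>) \<le> a * (851 / 200 * norm (e - v))" by (simp add: mult_ac)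
    then have "49 / 50 * \<Gamma> \<le> 851 / 200 * norm (e - v)" using a(2) by (simp only: mult_le_cancel_left_pos)
    then show ?thesis using \<Gamma> by linarith
  qed
  have r: "2 * (s / 50) / (12 * a) \<le> \<Gamma> / 300" using a s by (simp add: a_def)
  have "norm (2 *\<^sub>R v) \<le> norm (e + v) + norm (e - v)"
    using norm_triangle_ineq4[of "e + v" "e - v"] by (simp add: scaleR_2)
  then have sm: "norm (e + v) \<ge> 1" using v up \<Gamma> by simp
  have dx: "norm (y - x - (12 * a) *\<^sub>R v) \<le> s / 50"
  proof -
    have "(12 * a) *\<^sub>R v = (6 * a) *\<^sub>R v + (6 * a) *\<^sub>R v" by (simp flip: scaleR_add_left)
    then have eq: "y - x - (12 * a) *\<^sub>R v = (y - (z + (6 * a) *\<^sub>R v)) - (x - (z - (6 * a) *\<^sub>R v))" by simp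
    show ?thesis
      unfolding eq using norm_triangle_ineq4[of "(y - (z + (6 * a) *\<^sub>R v))" "(x - (z - (6 * a) *\<^sub>R v))"] c by linarith
  qed
  have dx': "norm (y' - x' - (12 * a) *\<^sub>R v) \<le> s / 50"
  proof -
    have "(12 * a) *\<^sub>R v = (6 * a) *\<^sub>R v + (6 * a) *\<^sub>R v" by (simp flip: scaleR_add_left)
    then have eq: "y' - x' - (12 * a) *\<^sub>R v = (y' - (z + s *\<^sub>R n + (6 * a) *\<^sub>R v)) - (x' - (z + s *\<^sub>R n - (6 * a) *\<^sub>R v))" by simp
    show ?thesis
      unfolding eq using norm_triangle_ineq4[of "(y' - (z + s *\<^sub>R n + (6 * a) *\<^sub>R v))" "(x' - (z + s *\<^sub>R n - (6 * a) *\<^sub>R v))"] c by linarith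
  qed
  have "crossing (\<Gamma> / 5) e x y xs s"
    unfolding xs_def by (rule crossing_near[OF v(1) _ dx]) (use a s r lo sm \<Gamma> in auto)
  moreover have "crossing (\<Gamma> / 5) e x' y' ys s"
    unfolding ys_def by (rule crossing_near[OF v(1) _ dx']) (use a s r lo sm \<Gamma> in auto)
  moreover have "xs \<in> closed_segment x y" "ys \<in> closed_segment x' y'"
    unfolding xs_def ys_def closed_segment_def mem_Collect_eq
    by (rule exI[of _ "1 / 2"], simp, rule exI[of _ "5 / 6"], simp)
  moreover have "dist xs z \<le> s" using xsz s by (simp add: dist_norm)
  ultimately show ?thesis
    using that[of e ys xs D] e ysD D' up lo by (simp add: a_def)
qed

text \<open>Interpolation does not increase the error \<open>r\<close> known at the ends of the two
  long segments, so they contain a configuration of scale \<open>w\<close> at every position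
  \<open>t\<close> that is not too close to the ends. The longitudinal offset \<open>l\<close> of
  the second tube is undone by shifting its parameter by \<open>- l\<close>.\<close>

lemma conf_interpolate:
  fixes xs e n :: "'a::euclidean_space"
  assumes e: "norm e = 1" and n: "norm n = 1" "n \<bullet> e = 0" and D: "D > 0" and \<Gamma>: "\<Gamma> > 0" "w > 0"
    and g: "dist g1 xs \<le> r" "dist g2 (xs + D *\<^sub>R e) \<le> r"
      "dist g3 (xs + w *\<^sub>R n + l *\<^sub>R e) \<le> r" "dist g4 (xs + D *\<^sub>R e + w *\<^sub>R n + l *\<^sub>R e) \<le> r"
    and r: "r \<le> \<eta> * w" and t: "6 * w / \<Gamma> + \<bar>l\<bar> \<le> t" "t + 6 * w / \<Gamma> + \<bar>l\<bar> \<le> D"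
  obtains x y x' y' where "conf \<eta> \<Gamma> w (xs + t *\<^sub>R e) e n x y x' y'"
    "x \<in> closed_segment g1 g2" "y \<in> closed_segment g1 g2"
    "x' \<in> closed_segment g3 g4" "y' \<in> closed_segment g3 g4"
proof -
  define a where "a = 6 * w / \<Gamma>"
  have a: "a > 0" using \<Gamma> by (simp add: a_def)
  have ip: "\<exists>p\<in>closed_segment h1 h2. norm (p - (q + \<sigma> *\<^sub>R e)) \<le> \<eta> * w"
    if h: "dist h1 q \<le> r" "dist h2 (q + D *\<^sub>R e) \<le> r" and \<sigma>: "0 \<le> \<sigma>" "\<sigma> \<le> D" for h1 h2 q :: 'a and \<sigma>
  proof -
    let ?p = "(1 - \<sigma> / D) *\<^sub>R h1 + (\<sigma> / D) *\<^sub>R h2"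
    have "?p \<in> closed_segment h1 h2"
      unfolding closed_segment_def using \<sigma> D by (auto intro!: exI[of _ "\<sigma> / D"])
    moreover have "?p - (q + \<sigma> *\<^sub>R e) = (1 - \<sigma> / D) *\<^sub>R (h1 - q) + (\<sigma> / D) *\<^sub>R (h2 - (q + D *\<^sub>R e))"
      using D by (simp add: algebra_simps)
    then have "norm (?p - (q + \<sigma> *\<^sub>R e)) \<le> r"
      using norm_combine[of "h1 - q" r "h2 - (q + D *\<^sub>R e)" "\<sigma> / D"] h \<sigma> D by (simp add: dist_norm)
    ultimately show ?thesis using r by (intro bexI[of _ ?p]) auto
  qed
  have t1: "0 \<le> t - a" "t - a \<le> D" "0 \<le> t + a" "t + a \<le> D"
    "0 \<le> t - a - l" "t - a - l \<le> D" "0 \<le> t + a - l" "t + a - l \<le> D"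
    using t a unfolding a_def[symmetric] by (auto simp: abs_le_iff)
  obtain x where x: "x \<in> closed_segment g1 g2" "norm (x - (xs + (t - a) *\<^sub>R e)) \<le> \<eta> * w"
    using ip[OF g(1,2) t1(1,2)] by auto
  obtain y where y: "y \<in> closed_segment g1 g2" "norm (y - (xs + (t + a) *\<^sub>R e)) \<le> \<eta> * w"
    using ip[OF g(1,2) t1(3,4)] by auto
  let ?q = "xs + w *\<^sub>R n + l *\<^sub>R e"
  have g4: "dist g4 (?q + D *\<^sub>R e) \<le> r" using g(4) by (simp add: add_ac)
  obtain x' where x': "x' \<in> closed_segment g3 g4" "norm (x' - (?q + (t - a - l) *\<^sub>R e)) \<le> \<eta> * w"
    using ip[OF g(3) g4 t1(5,6)] by auto
  obtain y' where y': "y' \<in> closed_segment g3 g4" "norm (y' - (?q + (t + a - l) *\<^sub>R e)) \<le> \<eta> * w"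
    using ip[OF g(3) g4 t1(7,8)] by auto
  have "xs + (t - a) *\<^sub>R e = xs + t *\<^sub>R e - a *\<^sub>R e" "xs + (t + a) *\<^sub>R e = xs + t *\<^sub>R e + a *\<^sub>R e"
    "?q + (t - a - l) *\<^sub>R e = xs + t *\<^sub>R e + w *\<^sub>R n - a *\<^sub>R e"
    "?q + (t + a - l) *\<^sub>R e = xs + t *\<^sub>R e + w *\<^sub>R n + a *\<^sub>R e"
    by (simp_all add: algebra_simps)
  note eqs = this
  have "conf \<eta> \<Gamma> w (xs + t *\<^sub>R e) e n x y x' y'"
    unfolding conf_def a_def[symmetric]
    using x(2) y(2) x'(2) y'(2) e n unfolding eqs by (simp only: inner_commute)
  then show ?thesis using that x y x' y' by blast
qed

text \<open>Discretises a random line: through one small ball at either end it is assigned to one of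
  polynomially many pairs of fixed points, and statements about \<open>linked\<close> refer to
  these.\<close>

lemma hit_cells:
  obtains C :: real where "C > 0"
    "\<And>(q::'a::euclidean_space) R. R \<ge> 1 \<Longrightarrow> \<exists>G. finite G \<and> real (card G) \<le> C * R ^ DIM('a) \<and>
      (\<forall>g\<in>G. dist g q \<le> R + 1) \<and> (\<forall>l\<in>hit q R. \<exists>g\<in>G. l \<in> hit g (1 / 10))"
proof -
  obtain C :: real where C: "C > 0"
    "\<And>(x::'a) R. R \<ge> 1 \<Longrightarrow> \<exists>G. finite G \<and> real (card G) \<le> C * R ^ DIM('a) \<and>
      (\<forall>y\<in>cball x R. \<exists>g\<in>G. dist g y < 1 / 10)"
    using ball_cover[where 'a = 'a] by metis
  have "\<exists>G. finite G \<and> real (card G) \<le> C * R ^ DIM('a) \<and>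
      (\<forall>g\<in>G. dist g q \<le> R + 1) \<and> (\<forall>l\<in>hit q R. \<exists>g\<in>G. l \<in> hit g (1 / 10))"
    if R: "R \<ge> 1" for q :: 'a and R
  proof -
    obtain G where G: "finite G" "real (card G) \<le> C * R ^ DIM('a)" "\<And>y. y \<in> cball q R \<Longrightarrow> \<exists>g\<in>G. dist g y < 1 / 10"
      using C(2)[OF R, of q] by auto
    let ?G = "{g \<in> G. dist g q \<le> R + 1}"
    have "card ?G \<le> card G" using G(1) by (intro card_mono) auto
    then have "real (card ?G) \<le> C * R ^ DIM('a)" using G(2) by linarith
    moreover have "\<exists>g\<in>?G. l \<in> hit g (1 / 10)" if l: "l \<in> hit q R" for l
    proof -
      obtain a where a: "l \<in> lines" "a \<in> l" "dist q a < R" using l by (rule hitE)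
      then obtain g where g: "g \<in> G" "dist g a < 1 / 10" using G(3)[of a] by auto
      have "dist g q \<le> R + 1" using a g dist_triangle[of g q a] by (simp add: dist_commute)
      then show ?thesis using g a hitI by blast
    qed
    ultimately show ?thesis using G(1) by (intro exI[of _ ?G]) auto
  qed
  then show ?thesis using that C(1) by blast
qed

lemma dirn_of_hits:
  assumes "l \<in> hit p r" "l \<in> hit q r" "q = p + D *\<^sub>R e" "norm e = 1" "0 < r" "2 * r < D"
  obtains v where "dirn l v" "norm (v - e) \<le> 4 * r / D"
proof -
  obtain a where a: "l \<in> lines" "a \<in> l" "dist p a < r" using assms(1) by (rule hitE)
  obtain b where b: "b \<in> l" "dist q b < r" using assms(2) by (rule hitE)
  have eq: "b - a - D *\<^sub>R e = (p - a) - (q - b)" using assms(3) by simp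
  have "norm (b - a - D *\<^sub>R e) \<le> dist p a + dist q b"
    unfolding eq dist_norm by (rule norm_triangle_ineq4)
  then have "norm (b - a - D *\<^sub>R e) \<le> 2 * r" using a b by linarith
  then show ?thesis using dirn_near[OF a(1,2) b(1) assms(4), of D "2 * r"] that assms(5,6) by force
qed

text \<open>The lower bound on the deviation from \<open>v\<close> is what prevents a line from being used in two distant
  windows along a line of direction \<open>v\<close>.\<close>

definition dcone :: "'a::euclidean_space \<Rightarrow> real \<Rightarrow> 'a \<Rightarrow> real \<Rightarrow> 'a set set" where
  "dcone v \<Gamma> z L = {l \<in> hit z L. \<exists>d. dirn l d \<and> \<Gamma> / 8 \<le> norm (d - v) \<and> norm (d - v) \<le> \<Gamma>}"

text \<open>Two unit directions of one line agree up to sign. Equality contradicts the annulus, and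
  the bound on \<Gamma> rules out opposite signs, since both directions are close to
  \<open>v\<close>.\<close>

lemma dcone_disjoint:
  assumes v: "norm v = 1" and \<Gamma>: "\<Gamma> \<le> 1 / 4" and l: "dirn l d" "norm (d - v) < \<Gamma> / 8"
  shows "l \<notin> dcone v \<Gamma> z L"
proof
  assume "l \<in> dcone v \<Gamma> z L"
  then obtain d' where d': "dirn l d'" "\<Gamma> / 8 \<le> norm (d' - v)" "norm (d' - v) \<le> \<Gamma>" by (auto simp: dcone_def)
  from dirn_unique[OF l(1) d'(1)] show False
  proof
    assume "d' = d" then show False using d' l by simp
  next
    assume "d' = - d"
    then have "2 *\<^sub>R v = - ((d - v) + (d' - v))" by (simp add: scaleR_2)
    then have "norm (2 *\<^sub>R v) \<le> norm (d - v) + norm (d' - v)" by (metis norm_minus_cancel norm_triangle_ineq)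
    then show False using v \<Gamma> l d' by simp
  qed
qed

text \<open>Carries the annulus condition from one scale to the next: if \<open>e\<close> lies well
  inside the annulus around \<open>v\<close>, so do all directions within \<Gamma>' of
  \<open>e\<close>.\<close>

lemma dcone_subset:
  assumes "norm (e - v) + \<Gamma>' \<le> \<Gamma>" "\<Gamma> / 8 + \<Gamma>' \<le> norm (e - v)" "dist z' z + L' \<le> L"
  shows "dcone e \<Gamma>' z' L' \<subseteq> dcone v \<Gamma> z L"
proof
  fix l assume "l \<in> dcone e \<Gamma>' z' L'"
  then obtain d where d: "l \<in> hit z' L'" "dirn l d" "norm (d - e) \<le> \<Gamma>'" by (auto simp: dcone_def)
  have "norm (d - v) \<le> norm (d - e) + norm (e - v)"
    using norm_triangle_ineq[of "d - e" "e - v"] by simp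
  moreover have "norm (e - v) \<le> norm (d - v) + norm (d - e)"
    using norm_triangle_ineq4[of "d - v" "d - e"] by simp
  moreover have "l \<in> hit z L" using d hit_mono[OF assms(3)] by blast
  ultimately show "l \<in> dcone v \<Gamma> z L" unfolding dcone_def using d assms by (auto intro!: exI[of _ d])
qed


section \<open>Bridging two nearly parallel lines\<close>

lemma powr_le_linear:
  fixes r \<delta> D :: real
  assumes "0 < r" "r < 1" "\<delta> > 0" "D > 0" "D \<ge> \<delta> powr (- 1 / (1 - r))"
  shows "D powr r \<le> \<delta> * D"
proof -
  have "1 / \<delta> = (\<delta> powr (- 1 / (1 - r))) powr (1 - r)"
  proof -
    have "- 1 / (1 - r) * (1 - r) = - 1" using assms by simp
    then show ?thesis using assms by (simp only: powr_powr powr_minus_divide) simp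
  qed
  also have "\<dots> \<le> D powr (1 - r)" using assms by (intro powr_mono2) auto
  finally have "1 \<le> \<delta> * D powr (1 - r)" using assms by (simp add: field_simps)
  then have "D powr r * 1 \<le> D powr r * (\<delta> * D powr (1 - r))" by (intro mult_left_mono) auto
  also have "\<dots> = \<delta> * D powr 1" by (simp add: powr_add[symmetric])
  finally show ?thesis using assms by simp
qed

lemma powr_ge_const:
  fixes r a D :: real
  assumes "0 < r" "a > 0" "D \<ge> a powr (1 / r)"
  shows "D powr r \<ge> a"
proof -
  have "a = (a powr (1 / r)) powr r" using assms by (simp add: powr_powr)
  also have "\<dots> \<le> D powr r" using assms by (intro powr_mono2) auto
  finally show ?thesis .
qed

lemma scale_exponent_bounds:
  assumes "r = 1 - 1 / (2 * real DIM('a::euclidean_space))"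
  shows "0 < r" "r < 1"
proof -
  have "real DIM('a) \<ge> 1" by (simp add: Suc_leI)
  then have "1 / (2 * real DIM('a)) \<le> 1 / 2" "1 / (2 * real DIM('a)) > 0" by (auto simp: field_simps)
  then show "0 < r" "r < 1" unfolding assms by linarith+
qed

lemma crossing_mono: "crossing \<gamma> e x y p R \<Longrightarrow> R' \<le> R \<Longrightarrow> crossing \<gamma> e x y p R'"
  unfolding crossing_def by (meson order_trans)

text \<open>The squared norm of the orthogonal part is
  \<open>(1 - g \<bullet> e) * (1 + g \<bullet> e)\<close>, and the factors are half the squares of
  \<open>norm (g - e)\<close> and \<open>norm (g + e)\<close>.\<close>

lemma perp_part_ge:
  fixes g e :: "'a::euclidean_space"
  assumes "norm g = 1" "norm e = 1" "\<gamma> \<le> norm (g - e)" "\<gamma> \<le> norm (g + e)" "\<gamma> > 0"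
  shows "\<gamma>\<^sup>2 / 2 \<le> norm (g - (g \<bullet> e) *\<^sub>R e)"
proof -
  have ge: "g \<bullet> g = 1" "e \<bullet> e = 1" using assms by (simp_all add: norm_eq_1)
  have "\<gamma>\<^sup>2 \<le> (norm (g - e))\<^sup>2" "\<gamma>\<^sup>2 \<le> (norm (g + e))\<^sup>2" using assms by (auto intro!: power_mono)
  then have h: "\<gamma>\<^sup>2 / 2 \<le> 1 - g \<bullet> e" "\<gamma>\<^sup>2 / 2 \<le> 1 + g \<bullet> e"
    using ge by (simp_all add: power2_norm_eq_inner inner_diff_left inner_diff_right inner_add_left inner_add_right inner_commute)
  have "0 \<le> \<gamma>\<^sup>2 / 2" by simp
  then have "(\<gamma>\<^sup>2 / 2)\<^sup>2 \<le> (1 - g \<bullet> e) * (1 + g \<bullet> e)"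
    unfolding power2_eq_square[of "\<gamma>\<^sup>2 / 2"] using h by (intro mult_mono) linarith+
  also have "\<dots> = (norm (g - (g \<bullet> e) *\<^sub>R e))\<^sup>2"
    using ge by (simp add: power2_norm_eq_inner inner_diff_left inner_diff_right inner_commute algebra_simps)
  finally show ?thesis by (rule power2_le_imp_le) simp
qed

section \<open>Pairs of nearly parallel lines, and bridges consisting of one line\<close>

context poisson_lines
begin

lemma occI:
  assumes "w \<in> space P" "l \<in> line_support (\<omega> w)" "openin line_topology U" "l \<in> U"
  shows "w \<in> occ U"
proof -
  have "emeasure (\<omega> w) U > 0" using assms unfolding line_support_def by blast
  then show ?thesis using assms by (auto simp: occ_def vac_def)
qed

lemma cyl_subset: "l \<in> line_support N \<Longrightarrow> cyl l \<subseteq> cylinder_set N"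
  by (auto simp: cylinder_set_def)

lemma prob_occ: "B \<in> sets line_borel \<Longrightarrow> prob (occ B) = 1 - prob (vac B)"
  unfolding occ_def by (rule prob_compl) (rule vac_event)

text \<open>A line of \<open>A\<close> and a line of \<open>A'\<close> start from the segments \<open>[x, y]\<close> and \<open>[x', y']\<close> and run in two
  parallel tubes of radius \<open>R\<close> around \<open>[xs, ys]\<close> and its translate by \<open>w n + l e\<close>.\<close>

definition parallel_families ::
    "'a \<Rightarrow> 'a \<Rightarrow> 'a \<Rightarrow> 'a \<Rightarrow> 'a \<Rightarrow> 'a \<Rightarrow> 'a \<Rightarrow> real \<Rightarrow> real \<Rightarrow> real \<Rightarrow> real \<Rightarrow>
     'a \<Rightarrow> real \<Rightarrow> 'a set set \<Rightarrow> 'a set set \<Rightarrow> bool" where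
  "parallel_families x y x' y' xs ys e w R M q n l A A' \<longleftrightarrow>
     norm n = 1 \<and> n \<bullet> e = 0 \<and> \<bar>l\<bar> \<le> M \<and> openin line_topology A \<and> openin line_topology A' \<and>
     prob (vac A) \<le> q \<and> prob (vac A') \<le> q \<and>
     (\<forall>m\<in>A. m \<in> hit xs R \<and> m \<in> hit ys R \<and>
       (\<exists>p\<in>closed_segment x y. dist p xs \<le> M \<and> m \<in> hit p (1 / 10))) \<and>
     (\<forall>m\<in>A'. m \<in> hit (xs + w *\<^sub>R n + l *\<^sub>R e) R \<and> m \<in> hit (ys + w *\<^sub>R n + l *\<^sub>R e) R \<and>
       (\<exists>p\<in>closed_segment x' y'. dist p ys \<le> M \<and> m \<in> hit p (1 / 10)))"

text \<open>Both families come from \<open>transversal_family\<close> with \<rho> a small multiple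
  of \<open>w = D powr r\<close>; the real point is to place the second tube parallel to the first
  at orthogonal distance exactly \<open>w\<close> although it must start on a prescribed
  segment.\<close>

lemma parallel_pair:
  assumes \<gamma>: "0 < \<gamma>" "\<gamma> \<le> 1" and \<eta>: "0 < \<eta>" "\<eta> \<le> 1" and \<epsilon>: "0 < \<epsilon>" "\<epsilon> \<le> 1"
    and r: "r = 1 - 1 / (2 * real DIM('a))"
  obtains c D0 :: real where "c > 0" "D0 \<ge> 1"
    "\<And>D. D \<ge> D0 \<Longrightarrow> 1 \<le> \<eta> * D powr r \<and> D powr r \<le> \<epsilon> * D"
    "\<And>D e x y x' y' xs ys. D \<ge> D0 \<Longrightarrow> norm e = 1 \<Longrightarrow> ys = xs + D *\<^sub>R e \<Longrightarrow>
      crossing \<gamma> e x y xs (\<epsilon> * D) \<Longrightarrow> crossing \<gamma> e x' y' ys (\<epsilon> * D) \<Longrightarrow>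
      \<exists>n l A A'. parallel_families x y x' y' xs ys e (D powr r) (2 * \<eta> * D powr r) (\<epsilon> * D)
        (exp (- (c * D powr (1 / 2)))) n l A A'"
proof -
  let ?d = "real DIM('a)"
  have d: "?d \<ge> 1" by (simp add: Suc_leI)
  note r01 = scale_exponent_bounds[OF r]
  obtain c0 where c0: "c0 > 0"
    "\<And>f e x \<rho> D. norm f = 1 \<Longrightarrow> norm e = 1 \<Longrightarrow> norm (f - e) \<ge> \<gamma> \<Longrightarrow> norm (f + e) \<ge> \<gamma> \<Longrightarrow>
      1 \<le> \<rho> \<Longrightarrow> \<rho> \<le> \<gamma> / 60 * D \<Longrightarrow> \<exists>A. openin line_topology A \<and>
      ennreal (c0 * \<rho> * (\<rho> / D) ^ (DIM('a) - 1)) \<le> emeasure \<mu> A \<and>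
      (\<forall>l\<in>A. \<exists>t\<in>{0..\<rho>}. l \<in> hit (x + t *\<^sub>R f) (1 / 10) \<and> l \<in> hit (x + D *\<^sub>R e) \<rho>)"
    using transversal_family[OF \<gamma>] by metis
  \<comment> \<open>Two requirements on \<open>w \<le> \<delta> * D\<close>: the tube has to be thin
    enough for \<open>transversal_family\<close>, and the shift of length
    \<open>2 * w / \<gamma>\<^sup>2\<close> along the second segment must stay within
    \<open>\<epsilon> * D\<close>.\<close>
  define \<delta> where "\<delta> = \<epsilon> * \<gamma>\<^sup>2 / 60"
  have \<delta>: "\<delta> > 0" using \<epsilon> \<gamma> by (simp add: \<delta>_def)
  have g2: "\<gamma>\<^sup>2 \<le> \<gamma>" using \<gamma> by (simp add: power2_eq_square mult_left_le)
  have "\<epsilon> * \<gamma>\<^sup>2 \<le> 1 * \<gamma>" using \<epsilon> g2 \<gamma> by (intro mult_mono) auto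
  then have \<delta>\<gamma>: "\<delta> \<le> \<gamma> / 60" by (simp add: \<delta>_def)
  have "\<epsilon> * \<gamma>\<^sup>2 \<le> \<epsilon> * 1" using \<epsilon> g2 \<gamma> by (intro mult_left_mono) auto
  then have \<delta>\<epsilon>: "\<delta> \<le> \<epsilon>" using \<epsilon> by (simp add: \<delta>_def)
  define D0 where "D0 = max 1 (max (\<delta> powr (- 1 / (1 - r))) ((1 / \<eta>) powr (1 / r)))"
  define c where "c = u * (c0 * \<eta> ^ DIM('a))"
  have c: "c > 0" using u c0 \<eta> by (simp add: c_def)
  have D0: "D0 \<ge> 1" by (simp add: D0_def)
  have big: "D > 0" "1 \<le> \<eta> * D powr r" "D powr r \<le> \<delta> * D" if "D \<ge> D0" for D
  proof -
    show D: "D > 0" using that D0 by linarith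
    show "D powr r \<le> \<delta> * D" using that r01 \<delta> D by (intro powr_le_linear) (auto simp: D0_def)
    have "D powr r \<ge> 1 / \<eta>" using that r01 \<eta> by (intro powr_ge_const) (auto simp: D0_def)
    then show "1 \<le> \<eta> * D powr r" using \<eta> by (simp add: field_simps)
  qed
  have meas: "c0 * (\<eta> * D powr r) * (\<eta> * D powr r / D) ^ (DIM('a) - 1) = c0 * \<eta> ^ DIM('a) * D powr (1 / 2)"
    if "D > 0" for D
  proof -
    have e: "DIM('a) = Suc (DIM('a) - 1)" by simp
    have "D powr r / D = D powr (r - 1)" using that by (simp add: powr_diff)
    then have "D powr r * (D powr r / D) ^ (DIM('a) - 1) = D powr r * D powr ((r - 1) * real (DIM('a) - 1))"
      using that powr_realpow[of "D powr (r - 1)" "DIM('a) - 1", symmetric] by (simp only: powr_powr) simp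
    also have "\<dots> = D powr (r + (r - 1) * real (DIM('a) - 1))" by (simp add: powr_add)
    \<comment> \<open>This identity dictates the choice of \<open>r\<close>.\<close>
    also have "r + (r - 1) * real (DIM('a) - 1) = 1 / 2"
      using d by (simp add: r of_nat_diff field_simps)
    finally have "D powr r * (D powr r / D) ^ (DIM('a) - 1) = D powr (1 / 2)" .
    moreover have "(\<eta> * D powr r / D) ^ (DIM('a) - 1) = \<eta> ^ (DIM('a) - 1) * (D powr r / D) ^ (DIM('a) - 1)"
      by (simp add: power_mult_distrib[symmetric])
    moreover have "\<eta> ^ DIM('a) = \<eta> * \<eta> ^ (DIM('a) - 1)" by (subst e) (simp only: power_Suc)
    ultimately show ?thesis by simp
  qed
  have vacb: "prob (vac A) \<le> exp (- (c * D powr (1 / 2)))"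
    if "D > 0" "openin line_topology A" "ennreal (c0 * (\<eta> * D powr r) * (\<eta> * D powr r / D) ^ (DIM('a) - 1)) \<le> emeasure \<mu> A" for A D
  proof -
    have "ennreal (c0 * \<eta> ^ DIM('a) * D powr (1 / 2)) \<le> emeasure \<mu> A"
      using that(3) unfolding meas[OF that(1)] .
    then have "prob (vac A) \<le> exp (- (u * (c0 * \<eta> ^ DIM('a) * D powr (1 / 2))))"
      using c0(1) \<eta> by (intro prob_vac_le openin_line_borel that(2)) auto
    then show ?thesis by (simp add: c_def mult_ac)
  qed
  show ?thesis
  proof (rule that[OF c D0])
    show "1 \<le> \<eta> * D powr r \<and> D powr r \<le> \<epsilon> * D" if "D \<ge> D0" for D
    proof -
      have "\<delta> * D \<le> \<epsilon> * D" using \<delta>\<epsilon> big(1)[OF that] by (intro mult_right_mono) auto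
      then show ?thesis using big[OF that] by linarith
    qed
  next
    fix D and e x y x' y' xs ys :: 'a
    assume D: "D \<ge> D0" and e: "norm e = 1" and ys: "ys = xs + D *\<^sub>R e"
      and cr: "crossing \<gamma> e x y xs (\<epsilon> * D)" "crossing \<gamma> e x' y' ys (\<epsilon> * D)"
    define w where "w = D powr r"
    define \<rho> where "\<rho> = \<eta> * w"
    have Dp: "D > 0" and \<rho>1: "1 \<le> \<rho>" and w\<delta>: "w \<le> \<delta> * D" using big[OF D] by (auto simp: w_def \<rho>_def)
    have w: "w > 0" using Dp by (simp add: w_def)
    have \<rho>w: "\<rho> \<le> w" using \<eta> w by (simp add: \<rho>_def mult_left_le_one_le)
    have "\<delta> * D \<le> \<gamma> / 60 * D" using \<delta>\<gamma> Dp by (intro mult_right_mono) auto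
    then have \<rho>\<gamma>: "\<rho> \<le> \<gamma> / 60 * D" using \<rho>w w\<delta> by linarith
    have bnd: "\<rho> + 2 * w / \<gamma>\<^sup>2 \<le> \<epsilon> * D"
    proof -
      have "w \<le> \<epsilon> * D * \<gamma>\<^sup>2 / 60" using w\<delta> by (simp add: \<delta>_def mult_ac)
      then have "w / \<gamma>\<^sup>2 \<le> \<epsilon> * D / 60" using \<gamma> by (simp add: field_simps)
      moreover have "w \<le> w / \<gamma>\<^sup>2" using g2 \<gamma> w by (simp add: field_simps mult_left_le)
      moreover have "0 \<le> \<epsilon> * D" using \<epsilon> Dp by simp
      moreover have "2 * w / \<gamma>\<^sup>2 = 2 * (w / \<gamma>\<^sup>2)" by simp
      ultimately show ?thesis using \<rho>w by linarith
    qed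
    obtain f where f: "norm f = 1" "\<gamma> \<le> norm (f - e)" "\<gamma> \<le> norm (f + e)"
      "\<And>t. \<bar>t\<bar> \<le> \<epsilon> * D \<Longrightarrow> xs + t *\<^sub>R f \<in> closed_segment x y" using cr(1) unfolding crossing_def by blast
    obtain g where g: "norm g = 1" "\<gamma> \<le> norm (g - e)" "\<gamma> \<le> norm (g + e)"
      "\<And>t. \<bar>t\<bar> \<le> \<epsilon> * D \<Longrightarrow> ys + t *\<^sub>R g \<in> closed_segment x' y'" using cr(2) unfolding crossing_def by blast
    \<comment> \<open>The part of \<open>g\<close> orthogonal to \<open>e\<close>. Moving by
      \<open>w / norm q\<close> along \<open>g\<close> from \<open>ys\<close> shifts sideways by
      exactly \<open>w\<close>, in the unit direction \<open>n\<close>, at the price of a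
      longitudinal shift \<open>l\<close>; so the second tube begins on the second segment
      itself.\<close>
    define q where "q = g - (g \<bullet> e) *\<^sub>R e"
    have q: "\<gamma>\<^sup>2 / 2 \<le> norm q" unfolding q_def using g e \<gamma> by (intro perp_part_ge) auto
    have q0: "norm q > 0" using q \<gamma> by (smt (verit) half_gt_zero zero_less_power)
    have wq: "w / norm q \<le> 2 * w / \<gamma>\<^sup>2"
    proof -
      have "w / norm q \<le> w / (\<gamma>\<^sup>2 / 2)" using q q0 w \<gamma> by (intro divide_left_mono) auto
      then show ?thesis by (simp add: mult.commute)
    qed
    define n where "n = q /\<^sub>R norm q"
    define l where "l = w * (g \<bullet> e) / norm q"
    have b: "(w / norm q) *\<^sub>R g = w *\<^sub>R n + l *\<^sub>R e"
    proof -
      have "g = q + (g \<bullet> e) *\<^sub>R e" by (simp add: q_def)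
      then have "(w / norm q) *\<^sub>R g = (w / norm q) *\<^sub>R q + (w / norm q) *\<^sub>R ((g \<bullet> e) *\<^sub>R e)"
        by (metis scaleR_add_right)
      then show ?thesis by (simp add: n_def l_def divide_inverse mult_ac)
    qed
    have n: "norm n = 1" "n \<bullet> e = 0"
      using q0 e by (auto simp: n_def q_def inner_diff_left norm_eq_1)
    have "\<bar>g \<bullet> e\<bar> \<le> 1" using Cauchy_Schwarz_ineq2[of g e] g e by simp
    then have "\<bar>l\<bar> \<le> w / norm q" using w q0 by (simp add: l_def abs_mult divide_right_mono mult_left_le)
    then have l: "\<bar>l\<bar> \<le> \<epsilon> * D" using wq bnd \<rho>1 by linarith
    obtain A where A: "openin line_topology A"
      "ennreal (c0 * \<rho> * (\<rho> / D) ^ (DIM('a) - 1)) \<le> emeasure \<mu> A"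
      "\<And>m. m \<in> A \<Longrightarrow> \<exists>t\<in>{0..\<rho>}. m \<in> hit (xs + t *\<^sub>R f) (1 / 10) \<and> m \<in> hit (xs + D *\<^sub>R e) \<rho>"
      using c0(2)[of f e \<rho> D xs] f e \<rho>1 \<rho>\<gamma> by auto
    let ?b = "w *\<^sub>R n + l *\<^sub>R e"
    \<comment> \<open>The second family starts near \<open>ys\<close> and runs backwards, in
      direction \<open>- e\<close>, to the end of its tube near \<open>xs\<close>.\<close>
    obtain A' where A': "openin line_topology A'"
      "ennreal (c0 * \<rho> * (\<rho> / D) ^ (DIM('a) - 1)) \<le> emeasure \<mu> A'"
      "\<And>m. m \<in> A' \<Longrightarrow> \<exists>t\<in>{0..\<rho>}. m \<in> hit ((ys + ?b) + t *\<^sub>R g) (1 / 10) \<and> m \<in> hit ((ys + ?b) + D *\<^sub>R (- e)) \<rho>"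
      using c0(2)[of g "- e" \<rho> D "ys + ?b"] g e \<rho>1 \<rho>\<gamma> by auto
    have near: "m \<in> hit p (2 * \<rho>)" if "m \<in> hit (p + t *\<^sub>R h) (1 / 10)" "t \<in> {0..\<rho>}" "norm h = 1" for m p t and h :: 'a
      using that \<rho>1 hit_mono[of "p + t *\<^sub>R h" p "1 / 10" "2 * \<rho>"] by (auto simp: dist_norm)
    have wide: "m \<in> hit p (2 * \<rho>)" if "m \<in> hit p \<rho>" for m p
      using that \<rho>1 hit_mono[of p p \<rho> "2 * \<rho>"] by auto
    have PA: "m \<in> hit xs (2 * \<rho>) \<and> m \<in> hit ys (2 * \<rho>) \<and>
           (\<exists>p\<in>closed_segment x y. dist p xs \<le> \<epsilon> * D \<and> m \<in> hit p (1 / 10))" if mA: "m \<in> A" for m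
    proof -
      obtain t where t: "t \<in> {0..\<rho>}" "m \<in> hit (xs + t *\<^sub>R f) (1 / 10)" "m \<in> hit (xs + D *\<^sub>R e) \<rho>"
        using A(3)[OF mA] by auto
      have "0 \<le> 2 * w / \<gamma>\<^sup>2" using w \<gamma> by simp
      then have te: "\<bar>t\<bar> \<le> \<epsilon> * D" using t(1) bnd by auto
      have "dist (xs + t *\<^sub>R f) xs \<le> \<epsilon> * D" using te f by (simp add: dist_norm)
      then show ?thesis using near[OF t(2,1) f(1)] wide[OF t(3)] f(4)[OF te] t(2) ys by blast
    qed
    have PA': "m \<in> hit (xs + w *\<^sub>R n + l *\<^sub>R e) (2 * \<rho>) \<and> m \<in> hit (ys + w *\<^sub>R n + l *\<^sub>R e) (2 * \<rho>) \<and>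
           (\<exists>p\<in>closed_segment x' y'. dist p ys \<le> \<epsilon> * D \<and> m \<in> hit p (1 / 10))" if mA: "m \<in> A'" for m
    proof -
      obtain t where t: "t \<in> {0..\<rho>}" "m \<in> hit ((ys + ?b) + t *\<^sub>R g) (1 / 10)" "m \<in> hit ((ys + ?b) + D *\<^sub>R (- e)) \<rho>"
        using A'(3)[OF mA] by auto
      have eq: "(ys + ?b) + t *\<^sub>R g = ys + (w / norm q + t) *\<^sub>R g"
        by (simp only: b[symmetric] scaleR_add_left add.assoc)
      have eq2: "(ys + ?b) + D *\<^sub>R (- e) = xs + w *\<^sub>R n + l *\<^sub>R e" by (simp add: ys)
      have eq3: "ys + ?b = ys + w *\<^sub>R n + l *\<^sub>R e" by simp
      have "0 \<le> w / norm q" using w by simp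
      then have te: "\<bar>w / norm q + t\<bar> \<le> \<epsilon> * D" using t(1) bnd wq by auto
      have "dist (ys + (w / norm q + t) *\<^sub>R g) ys \<le> \<epsilon> * D" using te g by (simp add: dist_norm)
      moreover have "m \<in> hit (ys + w *\<^sub>R n + l *\<^sub>R e) (2 * \<rho>)" using near[OF t(2,1) g(1)] unfolding eq3 .
      moreover have "m \<in> hit (xs + w *\<^sub>R n + l *\<^sub>R e) (2 * \<rho>)" using wide[OF t(3)] unfolding eq2 .
      moreover have "m \<in> hit (ys + (w / norm q + t) *\<^sub>R g) (1 / 10)" using t(2) unfolding eq .
      ultimately show ?thesis using g(4)[OF te] by blast
    qed
    have 2: "2 * \<eta> * D powr r = 2 * \<rho>" by (simp add: \<rho>_def w_def)
    show "\<exists>n l A A'. parallel_families x y x' y' xs ys e (D powr r) (2 * \<eta> * D powr r) (\<epsilon> * D)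
        (exp (- (c * D powr (1 / 2)))) n l A A'"
      unfolding 2 unfolding w_def[symmetric] parallel_families_def
    proof (rule exI[of _ n], rule exI[of _ l], rule exI[of _ A], rule exI[of _ A'], intro conjI)
      show "prob (vac A) \<le> exp (- (c * D powr (1 / 2)))"
        using vacb[OF Dp A(1)] A(2) by (simp add: \<rho>_def w_def)
      show "prob (vac A') \<le> exp (- (c * D powr (1 / 2)))"
        using vacb[OF Dp A'(1)] A'(2) by (simp add: \<rho>_def w_def)
      show "\<forall>m\<in>A. m \<in> hit xs (2 * \<rho>) \<and> m \<in> hit ys (2 * \<rho>) \<and>
           (\<exists>p\<in>closed_segment x y. dist p xs \<le> \<epsilon> * D \<and> m \<in> hit p (1 / 10))" using PA by blast
      show "\<forall>m\<in>A'. m \<in> hit (xs + w *\<^sub>R n + l *\<^sub>R e) (2 * \<rho>) \<and> m \<in> hit (ys + w *\<^sub>R n + l *\<^sub>R e) (2 * \<rho>) \<and>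
           (\<exists>p\<in>closed_segment x' y'. dist p ys \<le> \<epsilon> * D \<and> m \<in> hit p (1 / 10))" using PA' by blast
    qed (use n l A(1) A'(1) in auto)
  qed
qed

text \<open>Success at scale \<open>s\<close> costs a factor \<open>s powr (- \<kappa>)\<close> in
  probability. The event must be determined by lines in the directional annulus near
  \<open>z\<close>: this is what makes it independent of the pair of lines and of attempts made
  elsewhere along the pair.\<close>

definition bridge :: "real \<Rightarrow> real \<Rightarrow> real \<Rightarrow> real \<Rightarrow> real \<Rightarrow> real \<Rightarrow> bool" where
  "bridge \<kappa> \<Gamma> \<eta> K c s0 \<longleftrightarrow> 0 < \<eta> \<and> \<eta> \<le> 1 / 100 \<and> K \<ge> 1 \<and> c > 0 \<and> s0 \<ge> 1 \<and>
     (\<forall>s z v n x y x' y'. s \<ge> s0 \<longrightarrow> conf \<eta> \<Gamma> s z v n x y x' y' \<longrightarrow>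
        (\<exists>S\<in>evs (dcone v \<Gamma> z (K * s)). prob S \<ge> c * s powr (- \<kappa>) \<and>
           (\<forall>w\<in>S. linked (\<C> w) x y x' y' z (K * s))))"

text \<open>All \<Gamma> at once, because the induction step applies the hypothesis with a smaller
  angle than the one it proves.\<close>

definition bridge_exponent :: "real \<Rightarrow> bool" where
  "bridge_exponent \<kappa> \<longleftrightarrow> (\<forall>\<Gamma>. 0 < \<Gamma> \<longrightarrow> \<Gamma> \<le> 1 / 4 \<longrightarrow> (\<exists>\<eta> K c s0. bridge \<kappa> \<Gamma> \<eta> K c s0))"

text \<open>One line through the balls around \<open>xs\<close> and \<open>ys\<close> suffices. Such
  lines have measure of order at least \<open>s powr (- (d - 1))\<close>, and their direction is
  close to \<open>e\<close>, well inside the annulus around \<open>v\<close>.\<close>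

lemma bridge_exponent_base: "bridge_exponent (real (DIM('a) - 1))"
  unfolding bridge_exponent_def
proof (intro allI impI)
  fix \<Gamma> :: real assume \<Gamma>: "0 < \<Gamma>" "\<Gamma> \<le> 1 / 4"
  obtain c0 where c0: "c0 > 0" "\<And>\<rho> D x y. 1 / 10 \<le> \<rho> \<Longrightarrow> \<rho> \<le> D \<Longrightarrow> dist x y = D \<Longrightarrow>
      ennreal (c0 * (\<rho> / D) ^ (DIM('a) - 1)) \<le> emeasure \<mu> (hit x (1 / 10) \<inter> hit y \<rho>)"
    using thin_hit_bound by metis
  define c1 where "c1 = u * (c0 * (\<Gamma> / 50) ^ (DIM('a) - 1))"
  have c1: "c1 > 0" using u c0 \<Gamma> by (simp add: c1_def)
  \<comment> \<open>The path costs at most \<open>3 * (s + D + 1)\<close>, where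
    \<open>D \<le> 5 * s / \<Gamma>\<close> and \<open>s \<le> s / (4 * \<Gamma>)\<close>.\<close>
  define K where "K = 20 / \<Gamma>"
  have K: "K \<ge> 80" using \<Gamma> by (simp add: K_def field_simps)
  have "bridge (real (DIM('a) - 1)) \<Gamma> (1 / 100) K (c1 / (1 + c1)) 10"
    unfolding bridge_def
  proof (intro conjI allI impI)
    fix s :: real and z v n x y x' y' :: 'a assume s: "s \<ge> 10" and conf: "conf (1 / 100) \<Gamma> s z v n x y x' y'"
    have s0: "0 < s" using s by simp
    obtain D e xs ys where e: "norm e = 1" "ys = xs + D *\<^sub>R e" and D: "3 * s / \<Gamma> \<le> D" "D \<le> 5 * s / \<Gamma>"
      and xsz: "dist xs z \<le> s" and ev: "23 / 100 * \<Gamma> \<le> norm (e - v)" "norm (e - v) \<le> 51 / 100 * \<Gamma>"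
      and seg: "xs \<in> closed_segment x y" "ys \<in> closed_segment x' y'"
      by (rule conf_crossing[OF \<Gamma> s0 order_refl conf]) (rule that; assumption)
    have "3 * s / \<Gamma> \<ge> 12 * s" using \<Gamma> s by (simp add: field_simps)
    then have D12: "D \<ge> 12 * s" using D by linarith
    let ?A = "hit xs (1 / 10) \<inter> hit ys (1 / 10)"
    have Am: "?A \<in> sets line_borel" by (intro sets.Int hit_in_line_borel)
    have A: "?A \<subseteq> dcone v \<Gamma> z (K * s)"
    proof
      fix m assume m: "m \<in> ?A"
      obtain d where d: "dirn m d" "norm (d - e) \<le> 4 * (1 / 10) / D"
        using dirn_of_hits[of m xs "1 / 10" ys D e] m e D12 s by auto
      have "4 * (1 / 10) / D \<le> \<Gamma> / 10"
      proof -
        have "D * \<Gamma> \<ge> 3 * s" using D(1) \<Gamma> by (simp add: field_simps)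
        then have "D * \<Gamma> \<ge> 4" using s by linarith
        then show ?thesis using D12 s by (simp add: field_simps)
      qed
      then have d2: "norm (d - e) \<le> \<Gamma> / 10" using d by linarith
      have "norm (d - v) \<le> norm (d - e) + norm (e - v)" using norm_triangle_ineq[of "d - e" "e - v"] by simp
      moreover have "norm (e - v) \<le> norm (d - v) + norm (d - e)" using norm_triangle_ineq4[of "d - v" "d - e"] by simp
      ultimately have "\<Gamma> / 8 \<le> norm (d - v)" "norm (d - v) \<le> \<Gamma>" using d2 ev \<Gamma> by auto
      moreover have "m \<in> hit z (K * s)"
      proof -
        have "2 * s \<le> K * s" using K s by (intro mult_right_mono) auto
        then have "dist xs z + 1 / 10 \<le> K * s" using xsz s by linarith
        then show ?thesis using m hit_mono[of xs z "1 / 10" "K * s"] by blast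
      qed
      ultimately show "m \<in> dcone v \<Gamma> z (K * s)" using d(1) by (auto simp: dcone_def)
    qed
    have "prob (occ ?A) \<ge> c1 / (1 + c1) * s powr (- real (DIM('a) - 1))"
    proof -
      have "(1 / 10) / D \<ge> (\<Gamma> / 50) / s" using D D12 \<Gamma> s by (simp add: field_simps)
      then have "c0 * ((\<Gamma> / 50) / s) ^ (DIM('a) - 1) \<le> c0 * ((1 / 10) / D) ^ (DIM('a) - 1)"
        using c0 \<Gamma> s by (intro mult_left_mono power_mono) auto
      then have "ennreal (c0 * ((\<Gamma> / 50) / s) ^ (DIM('a) - 1)) \<le> ennreal (c0 * ((1 / 10) / D) ^ (DIM('a) - 1))"
        by (rule ennreal_leI)
      also have "\<dots> \<le> emeasure \<mu> ?A" using e D12 s by (intro c0(2)) (auto simp: dist_norm)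
      finally have "prob (vac ?A) \<le> exp (- (u * (c0 * ((\<Gamma> / 50) / s) ^ (DIM('a) - 1))))"
        using c0 \<Gamma> s by (intro prob_vac_le Am) auto
      also have "u * (c0 * ((\<Gamma> / 50) / s) ^ (DIM('a) - 1)) = c1 / s ^ (DIM('a) - 1)"
        by (simp add: c1_def power_divide)
      finally have v: "prob (vac ?A) \<le> exp (- (c1 / s ^ (DIM('a) - 1)))" .
      \<comment> \<open>Since \<open>1 - exp (- X) \<ge> X / (1 + X)\<close> and
        \<open>X \<le> c1\<close>, the occupation probability has a lower bound linear in
        \<open>X\<close>.\<close>
      define X where "X = c1 / s ^ (DIM('a) - 1)"
      have "1 \<le> s ^ (DIM('a) - 1)" using s by (intro one_le_power) auto
      then have X: "0 < X" "X \<le> c1" using c1 s by (auto simp: X_def field_simps)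
      have "exp (- X) \<le> 1 / (1 + X)"
        using exp_ge_add_one_self[of X] X by (simp add: exp_minus field_simps)
      moreover have "1 - 1 / (1 + X) = X / (1 + X)" using X by (simp add: field_simps)
      moreover have "X / (1 + c1) \<le> X / (1 + X)" using X by (intro divide_left_mono) auto
      ultimately have "X / (1 + c1) \<le> 1 - prob (vac ?A)" using v by (simp add: X_def)
      moreover have "X / (1 + c1) = c1 / (1 + c1) * s powr (- real (DIM('a) - 1))"
      proof -
        have "s powr (- real (DIM('a) - 1)) = inverse (s ^ (DIM('a) - 1))"
          using powr_realpow[OF s0, of "DIM('a) - 1"] by (simp only: powr_minus)
        then show ?thesis unfolding X_def by (simp only: divide_inverse mult_ac)
      qed
      ultimately show ?thesis using prob_occ[OF Am] by simp
    qed
    moreover have "linked (\<C> w) x y x' y' z (K * s)" if w: "w \<in> occ ?A" for w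
    proof -
      obtain m where m: "m \<in> line_support (\<omega> w)" "m \<in> ?A" using occ_line[OF w Am] by blast
      have "dist ys z \<le> s + D" using xsz e D12 s dist_triangle[of ys z xs] by (simp add: dist_norm)
      then have "linked (\<C> w) x y x' y' z (3 * (s + D + 1))"
        using m cyl_subset[OF m(1)] seg xsz D12 s by (intro linked_one_line[of m xs ys]) auto
      moreover have "3 * (s + D + 1) \<le> K * s"
      proof -
        define X where "X = s / \<Gamma>"
        have KX: "K * s = 20 * X" by (simp add: K_def X_def)
        have "D \<le> 5 * X" using D by (simp add: X_def)
        moreover have "X \<ge> 4 * s" using \<Gamma> s by (simp add: X_def field_simps)
        ultimately have "3 * (s + D + 1) \<le> 20 * X" using s by argo
        then show ?thesis by (simp only: KX)
      qed
      ultimately show ?thesis using linked_mono[of _ x y x' y' z _ z] by force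
    qed
    ultimately show "\<exists>S\<in>evs (dcone v \<Gamma> z (K * s)). prob S \<ge> c1 / (1 + c1) * s powr (- real (DIM('a) - 1)) \<and>
           (\<forall>w\<in>S. linked (\<C> w) x y x' y' z (K * s))"
      using occ_evs[OF Am A] by blast
  qed (use K c1 in auto)
  then show "\<exists>\<eta> K c s0. bridge (real (DIM('a) - 1)) \<Gamma> \<eta> K c s0" by blast
qed

end


section \<open>Lowering the bridging exponent by a change of scale\<close>

context poisson_lines
begin

text \<open>Sorts the random line of \<open>A\<close> into one of the cells given by a small ball at
  either end of the tube, so that the later choice of a bridge refers to fixed segments.\<close>

lemma occ_cells:
  assumes A: "openin line_topology A" "\<And>m. m \<in> A \<Longrightarrow> m \<in> hit p R \<and> m \<in> hit q R"
    and G1: "\<And>l. l \<in> hit p R \<Longrightarrow> \<exists>g\<in>G1. l \<in> hit g (1 / 10)"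
    and G2: "\<And>l. l \<in> hit q R \<Longrightarrow> \<exists>g\<in>G2. l \<in> hit g (1 / 10)"
    and w: "w \<in> occ A"
  shows "\<exists>g\<in>G1. \<exists>h\<in>G2. w \<in> occ (A \<inter> (hit g (1 / 10) \<inter> hit h (1 / 10)))"
proof -
  obtain m where m: "m \<in> line_support (\<omega> w)" "m \<in> A" using occ_line[OF w openin_line_borel[OF A(1)]] by blast
  obtain g where g: "g \<in> G1" "m \<in> hit g (1 / 10)" using A(2)[OF m(2)] G1 by blast
  obtain h where h: "h \<in> G2" "m \<in> hit h (1 / 10)" using A(2)[OF m(2)] G2 by blast
  have "w \<in> space P" using w by (simp add: occ_def)
  moreover have "openin line_topology (A \<inter> (hit g (1 / 10) \<inter> hit h (1 / 10)))"
    by (intro openin_Int openin_hit A(1))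
  moreover have "m \<in> A \<inter> (hit g (1 / 10) \<inter> hit h (1 / 10))" using m g h by simp
  ultimately have "w \<in> occ (A \<inter> (hit g (1 / 10) \<inter> hit h (1 / 10)))" using occI m(1) by simp
  then show ?thesis using g h by blast
qed

lemma pair_linked:
  assumes m: "m \<in> line_support N" "m \<in> hit g (1 / 10) \<inter> hit h (1 / 10)"
      "\<exists>p\<in>closed_segment x y. dist p xs \<le> D \<and> m \<in> hit p (1 / 10)"
    and m': "m' \<in> line_support N" "m' \<in> hit g' (1 / 10) \<inter> hit h' (1 / 10)"
      "\<exists>p\<in>closed_segment x' y'. dist p ys \<le> D \<and> m' \<in> hit p (1 / 10)"
    and l: "linked (cylinder_set N) g h g' h' z L" and d: "dist z xs \<le> D" "dist z ys \<le> D" "L \<le> D" "D \<ge> 1"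
  shows "linked (cylinder_set N) x y x' y' xs (13 * D)"
proof -
  obtain p where p: "p \<in> closed_segment x y" "dist p xs \<le> D" "m \<in> hit p (1 / 10)" using m(3) by blast
  obtain p' where p': "p' \<in> closed_segment x' y'" "dist p' ys \<le> D" "m' \<in> hit p' (1 / 10)" using m'(3) by blast
  have "dist p z \<le> 2 * D" "dist p' z \<le> 2 * D"
    using p p' d dist_triangle[of p z xs] dist_triangle[of p' z ys] by (auto simp: dist_commute)
  \<comment> \<open>Here \<open>4 * D\<close> pays for the distance \<open>2 * D\<close> to the
    centre, for \<open>L \<le> D\<close> and for the 1; recentring from \<open>z\<close> to
    \<open>xs\<close> adds a last \<open>D\<close>.\<close>
  then have "linked (cylinder_set N) x y x' y' z (3 * (4 * D))"
    using d by (intro linked_glue[OF l m(2) p(3) _ m'(2) p'(3) _ p(1) p'(1)] cyl_subset m m') auto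
  then show ?thesis by (rule linked_mono) (use d in simp)
qed

text \<open>A parallel pair of width \<open>w\<close> and length \<open>D\<close> of order
  \<open>s\<close> is present with probability at least 1/4, and one bridge between its lines then
  succeeds with probability of order \<open>w powr (- \<kappa>)\<close>, that is
  \<open>s powr (- (r * \<kappa>))\<close>. This success probability may be small, so no union bound
  over the cells is possible; the cell is selected by \<open>prob_selection_ge\<close>
  instead.\<close>

lemma bridge_exponent_step:
  assumes br: "bridge_exponent \<kappa>" "\<kappa> > 0" and r: "r = 1 - 1 / (2 * real DIM('a))"
  shows "bridge_exponent (r * \<kappa>)"
  unfolding bridge_exponent_def
proof (intro allI impI)
  fix \<Gamma> :: real assume \<Gamma>: "0 < \<Gamma>" "\<Gamma> \<le> 1 / 4"
  note r01 = scale_exponent_bounds[OF r]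
  \<comment> \<open>The tilt of \<open>e\<close> against \<open>v\<close> lies between
    \<open>23 / 100 * \<Gamma>\<close> and \<open>51 / 100 * \<Gamma>\<close>; a further deviation
    of \<Gamma>/32 fits between \<Gamma>/8 and \<Gamma>.\<close>
  define \<Gamma>' where "\<Gamma>' = \<Gamma> / 32"
  have \<Gamma>': "0 < \<Gamma>'" "\<Gamma>' \<le> 1 / 4" using \<Gamma> by (auto simp: \<Gamma>'_def)
  obtain \<eta>' K' c' s0' where br0: "bridge \<kappa> \<Gamma>' \<eta>' K' c' s0'"
    using br(1) \<Gamma>' unfolding bridge_exponent_def by blast
  have br': "0 < \<eta>'" "\<eta>' \<le> 1 / 100" "K' \<ge> 1" "c' > 0" "s0' \<ge> 1"
    using br0 unfolding bridge_def by blast+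
  have br6: "\<exists>S\<in>evs (dcone v \<Gamma>' z (K' * s)). prob S \<ge> c' * s powr (- \<kappa>) \<and>
           (\<forall>w\<in>S. linked (\<C> w) x y x' y' z (K' * s))"
    if "s \<ge> s0'" "conf \<eta>' \<Gamma>' s z v n x y x' y'" for s z v n x y x' y'
    using br0 that unfolding bridge_def by simp
  \<comment> \<open>From \<open>1 \<le> \<eta> * w\<close> follow both \<open>w \<ge> s0'\<close>
    and \<open>2 * \<eta> * w + 1 \<le> \<eta>' * w\<close>, so that cell centres, and not only the
    lines, satisfy the tolerance of the smaller scale.\<close>
  define \<eta> where "\<eta> = \<eta>' / (3 * s0')"
  have \<eta>: "0 < \<eta>" "\<eta> \<le> 1" "\<eta> * s0' \<le> 1" "3 * \<eta> \<le> \<eta>'" using br' by (auto simp: \<eta>_def field_simps)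
  \<comment> \<open>The first bound makes the tubes so thin that their lines deviate from
    \<open>e\<close> by at most \<Gamma>/500, below \<Gamma>'/8; it also makes the window short
    compared with \<open>D\<close>. The second gives \<open>K' * w \<le> D\<close>.\<close>
  define \<epsilon> where "\<epsilon> = min (\<Gamma> / 4000) (1 / K')"
  have \<epsilon>: "0 < \<epsilon>" "\<epsilon> \<le> 1" "\<epsilon> \<le> \<Gamma> / 4000" "\<epsilon> * K' \<le> 1" using \<Gamma> br' by (auto simp: \<epsilon>_def min_def field_simps)
  have \<gamma>: "0 < \<Gamma> / 5" "\<Gamma> / 5 \<le> 1" using \<Gamma> by auto
  obtain c D0 where cD: "c > 0" "D0 \<ge> 1"
    "\<And>D. D \<ge> D0 \<Longrightarrow> 1 \<le> \<eta> * D powr r \<and> D powr r \<le> \<epsilon> * D"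
    "\<And>D e x y x' y' xs ys. D \<ge> D0 \<Longrightarrow> norm e = 1 \<Longrightarrow> ys = xs + D *\<^sub>R e \<Longrightarrow>
      crossing (\<Gamma> / 5) e x y xs (\<epsilon> * D) \<Longrightarrow> crossing (\<Gamma> / 5) e x' y' ys (\<epsilon> * D) \<Longrightarrow>
      \<exists>n l A A'. parallel_families x y x' y' xs ys e (D powr r) (2 * \<eta> * D powr r) (\<epsilon> * D)
        (exp (- (c * D powr (1 / 2)))) n l A A'"
    by (rule parallel_pair[OF \<gamma> \<eta>(1,2) \<epsilon>(1,2) r]) (rule that; assumption)
  \<comment> \<open>From this size on each family is void with probability at most 1/3.\<close>
  define s0 where "s0 = max D0 ((2 / c) powr (1 / (1 / 2)))"
  define K where "K = 70 / \<Gamma>"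
  have K: "K \<ge> 1" using \<Gamma> by (simp add: K_def field_simps)
  define c1 where "c1 = c' * (5 / \<Gamma>) powr (- (r * \<kappa>)) * (1 / 4)"
  have c1: "c1 > 0" using br' \<Gamma> by (simp add: c1_def)
  have "bridge (r * \<kappa>) \<Gamma> (1 / 100) K c1 s0"
    unfolding bridge_def
  proof (intro conjI allI impI)
    show "s0 \<ge> 1" using cD by (simp add: s0_def)
  next
    fix s :: real and z v n0 x y x' y' :: 'a
    assume s: "s \<ge> s0" and conf: "conf (1 / 100) \<Gamma> s z v n0 x y x' y'"
    have s1: "s \<ge> D0" "s \<ge> 1" "0 < s" using s cD by (auto simp: s0_def)
    obtain D e xs ys where e: "norm e = 1" "ys = xs + D *\<^sub>R e" and D: "3 * s / \<Gamma> \<le> D" "D \<le> 5 * s / \<Gamma>"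
      and xsz: "dist xs z \<le> s" and ev: "23 / 100 * \<Gamma> \<le> norm (e - v)" "norm (e - v) \<le> 51 / 100 * \<Gamma>"
      and cr: "crossing (\<Gamma> / 5) e x y xs s" "crossing (\<Gamma> / 5) e x' y' ys s"
      by (rule conf_crossing[OF \<Gamma> s1(3) order_refl conf]) (rule that; assumption)
    have "3 * s / \<Gamma> \<ge> 12 * s" using \<Gamma> s1 by (simp add: field_simps)
    then have Ds: "D \<ge> s" "D \<ge> D0" "D \<ge> 1" using D s1 by linarith+
    have "\<epsilon> * D \<le> \<Gamma> / 4000 * (5 * s / \<Gamma>)" using \<epsilon> D Ds by (intro mult_mono) auto
    also have "\<dots> \<le> s" using \<Gamma> s1 by simp
    finally have \<epsilon>s: "\<epsilon> * D \<le> s" .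
    have \<epsilon>D: "\<epsilon> * D \<le> \<Gamma> / 4000 * D" "\<Gamma> / 4000 * D \<le> D / 16000" using \<epsilon> \<Gamma> Ds by (auto intro!: mult_right_mono)
    define w where "w = D powr r"
    have w: "1 \<le> \<eta> * w" "w \<le> \<epsilon> * D" using cD(3)[OF Ds(2)] by (auto simp: w_def)
    have "s0' \<le> w"
    proof -
      have "\<eta> * s0' \<le> \<eta> * w" using w \<eta> by linarith
      then show ?thesis using \<eta>(1) by simp
    qed
    then have ws: "w \<ge> s0'" "w > 0" using br' by auto
    obtain n l A A' where n: "norm n = 1" "n \<bullet> e = 0" "\<bar>l\<bar> \<le> \<epsilon> * D"
      and A: "openin line_topology A" "prob (vac A) \<le> exp (- (c * D powr (1 / 2)))"
        "\<And>m. m \<in> A \<Longrightarrow> m \<in> hit xs (2 * \<eta> * w) \<and> m \<in> hit ys (2 * \<eta> * w)"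
        "\<And>m. m \<in> A \<Longrightarrow> \<exists>p\<in>closed_segment x y. dist p xs \<le> \<epsilon> * D \<and> m \<in> hit p (1 / 10)"
      and A': "openin line_topology A'" "prob (vac A') \<le> exp (- (c * D powr (1 / 2)))"
        "\<And>m. m \<in> A' \<Longrightarrow> m \<in> hit (xs + w *\<^sub>R n + l *\<^sub>R e) (2 * \<eta> * w) \<and> m \<in> hit (ys + w *\<^sub>R n + l *\<^sub>R e) (2 * \<eta> * w)"
        "\<And>m. m \<in> A' \<Longrightarrow> \<exists>p\<in>closed_segment x' y'. dist p ys \<le> \<epsilon> * D \<and> m \<in> hit p (1 / 10)"
      using cD(4)[OF Ds(2) e crossing_mono[OF cr(1) \<epsilon>s] crossing_mono[OF cr(2) \<epsilon>s]] unfolding w_def[symmetric] parallel_families_def by blast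
    have R1: "1 \<le> 2 * \<eta> * w" using w by linarith
    have R3: "2 * \<eta> * w + 1 \<le> \<eta>' * w"
    proof -
      have "3 * \<eta> * w \<le> \<eta>' * w" using \<eta> ws by (intro mult_right_mono) auto
      then show ?thesis using w by linarith
    qed
    have "\<exists>G. finite G \<and> (\<forall>g\<in>G. dist g q \<le> 2 * \<eta> * w + 1) \<and> (\<forall>l\<in>hit q (2 * \<eta> * w). \<exists>g\<in>G. l \<in> hit g (1 / 10))" for q :: 'a
      using hit_cells[where 'a = 'a] R1 by metis
    then obtain G where G: "\<And>q::'a. finite (G q)" "\<And>q g. g \<in> G q \<Longrightarrow> dist g q \<le> 2 * \<eta> * w + 1"
      "\<And>q l. l \<in> hit q (2 * \<eta> * w) \<Longrightarrow> \<exists>g\<in>G q. l \<in> hit g (1 / 10)" by metis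
    let ?q3 = "xs + w *\<^sub>R n + l *\<^sub>R e" and ?q4 = "ys + w *\<^sub>R n + l *\<^sub>R e"
    define I where "I = G xs \<times> G ys \<times> G ?q3 \<times> G ?q4"
    have I: "finite I" using G(1) by (simp add: I_def)
    define z' where "z' = xs + (D / 2) *\<^sub>R e"
    have W: "\<exists>S\<in>evs (dcone e \<Gamma>' z' (K' * w)). prob S \<ge> c' * w powr (- \<kappa>) \<and>
           (\<forall>\<omega>'\<in>S. linked (\<C> \<omega>') g1 g2 g3 g4 z' (K' * w))"
      if g: "(g1, g2, g3, g4) \<in> I" for g1 g2 g3 g4
    proof -
      have gd: "dist g1 xs \<le> 2 * \<eta> * w + 1" "dist g2 (xs + D *\<^sub>R e) \<le> 2 * \<eta> * w + 1"
        "dist g3 ?q3 \<le> 2 * \<eta> * w + 1" "dist g4 (xs + D *\<^sub>R e + w *\<^sub>R n + l *\<^sub>R e) \<le> 2 * \<eta> * w + 1"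
        using g G(2) e(2) by (auto simp: I_def)
      have "6 * w / \<Gamma>' \<le> D / 4"
      proof -
        have "w \<le> \<Gamma> / 4000 * D" using w \<epsilon>D by linarith
        then have "6 * w / \<Gamma>' \<le> 6 * (\<Gamma> / 4000 * D) / \<Gamma>'" using \<Gamma>' by (intro divide_right_mono mult_left_mono) auto
        also have "\<dots> \<le> D / 4" using \<Gamma> Ds by (simp add: \<Gamma>'_def)
        finally show ?thesis .
      qed
      then have t: "6 * w / \<Gamma>' + \<bar>l\<bar> \<le> D / 2" "D / 2 + 6 * w / \<Gamma>' + \<bar>l\<bar> \<le> D"
        using n(3) \<epsilon>D Ds by linarith+
      have D0: "0 < D" using Ds by linarith
      obtain p1 p2 p3 p4 where pc: "conf \<eta>' \<Gamma>' w z' e n p1 p2 p3 p4"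
        and p: "p1 \<in> closed_segment g1 g2" "p2 \<in> closed_segment g1 g2" "p3 \<in> closed_segment g3 g4" "p4 \<in> closed_segment g3 g4"
        by (rule conf_interpolate[OF e(1) n(1,2) D0 \<Gamma>'(1) ws(2) gd R3 t, folded z'_def]) (rule that, assumption+)
      show ?thesis using br6[OF ws(1) pc] linked_segments[OF _ p] by blast
    qed
    have "\<forall>q\<in>I. \<exists>S. S \<in> evs (dcone e \<Gamma>' z' (K' * w)) \<and> prob S \<ge> c' * w powr (- \<kappa>) \<and>
        (\<forall>\<omega>'\<in>S. linked (\<C> \<omega>') (fst q) (fst (snd q)) (fst (snd (snd q))) (snd (snd (snd q))) z' (K' * w))"
    proof
      fix q assume "q \<in> I"
      moreover obtain g1 g2 g3 g4 where "q = (g1, g2, g3, g4)" by (rule prod_cases4)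
      ultimately show "\<exists>S. S \<in> evs (dcone e \<Gamma>' z' (K' * w)) \<and> prob S \<ge> c' * w powr (- \<kappa>) \<and>
        (\<forall>\<omega>'\<in>S. linked (\<C> \<omega>') (fst q) (fst (snd q)) (fst (snd (snd q))) (snd (snd (snd q))) z' (K' * w))"
        using W[of g1 g2 g3 g4] by auto
    qed
    from bchoice[OF this] obtain S where S0: "\<forall>q\<in>I. S q \<in> evs (dcone e \<Gamma>' z' (K' * w)) \<and> prob (S q) \<ge> c' * w powr (- \<kappa>) \<and>
        (\<forall>\<omega>'\<in>S q. linked (\<C> \<omega>') (fst q) (fst (snd q)) (fst (snd (snd q))) (snd (snd (snd q))) z' (K' * w))"
      by blast
    have S: "\<And>q. q \<in> I \<Longrightarrow> S q \<in> evs (dcone e \<Gamma>' z' (K' * w))"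
      "\<And>q. q \<in> I \<Longrightarrow> prob (S q) \<ge> c' * w powr (- \<kappa>)"
      "\<And>g1 g2 g3 g4 \<omega>'. (g1, g2, g3, g4) \<in> I \<Longrightarrow> \<omega>' \<in> S (g1, g2, g3, g4) \<Longrightarrow>
         linked (\<C> \<omega>') g1 g2 g3 g4 z' (K' * w)"
      using S0 by fastforce+
    define Ev where "Ev = (\<lambda>(g1, g2, g3, g4). occ (A \<inter> (hit g1 (1 / 10) \<inter> hit g2 (1 / 10))) \<inter>
      occ (A' \<inter> (hit g3 (1 / 10) \<inter> hit g4 (1 / 10))))"
    have Am: "A \<inter> (hit g (1 / 10) \<inter> hit h (1 / 10)) \<in> sets line_borel" "A' \<inter> (hit g (1 / 10) \<inter> hit h (1 / 10)) \<in> sets line_borel" for g h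
      by (rule sets.Int[OF openin_line_borel[OF A(1)] sets.Int[OF hit_in_line_borel hit_in_line_borel]],
        rule sets.Int[OF openin_line_borel[OF A'(1)] sets.Int[OF hit_in_line_borel hit_in_line_borel]])
    have Ev: "Ev q \<in> evs (A \<union> A')" for q
      unfolding Ev_def by (cases q) (auto intro!: evs_Int occ_evs Am)
    have dir: "\<exists>d. dirn m d \<and> norm (d - e) < \<Gamma>' / 8" if m: "m \<in> A \<union> A'" for m
    proof -
      have "2 * \<eta> * w \<le> 2 * w" using \<eta> ws by simp
      also have "\<dots> \<le> 2 * (\<Gamma> / 4000 * D)" using w \<epsilon>D by linarith
      finally have R: "2 * \<eta> * w \<le> \<Gamma> / 2000 * D" by (simp add: mult_ac)
      have "\<Gamma> / 2000 * D \<le> 1 / 8000 * D" using \<Gamma> Ds by (intro mult_right_mono) auto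
      then have R2: "2 * (2 * \<eta> * w) < D" "0 < 2 * \<eta> * w" using R Ds R1 by linarith+
      have "ys + w *\<^sub>R n + l *\<^sub>R e = (xs + w *\<^sub>R n + l *\<^sub>R e) + D *\<^sub>R e" using e(2) by simp
      then obtain d where d: "dirn m d" "norm (d - e) \<le> 4 * (2 * \<eta> * w) / D"
        using m A(3)[of m] A'(3)[of m] dirn_of_hits[OF _ _ e(2,1) R2(2,1)] dirn_of_hits[OF _ _ _ e(1) R2(2,1), of m ?q3 ?q4] by blast
      have "4 * (2 * \<eta> * w) / D \<le> \<Gamma> / 500" using R Ds by (simp add: field_simps)
      then show ?thesis using d \<Gamma> by (intro exI[of _ d]) (auto simp: \<Gamma>'_def)
    qed
    \<comment> \<open>Lines of the pair are closer to \<open>e\<close> than \<Gamma>'/8, lines of a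
      bridge are not; hence the choice of the cell is independent of the bridge events.\<close>
    have disj: "(A \<union> A') \<inter> dcone e \<Gamma>' z' (K' * w) = {}"
      using dir dcone_disjoint[OF e(1) \<Gamma>'(2)] by blast
    define T where "T = (\<Union>q\<in>I. Ev q \<inter> S q)"
    have K'w: "K' * w \<le> D"
    proof -
      have "K' * w \<le> K' * (\<epsilon> * D)" using w br' by (intro mult_left_mono) auto
      also have "\<dots> \<le> 1 * D" using \<epsilon>(4) Ds by (simp only: mult.assoc[symmetric] mult.commute[of K']) (intro mult_right_mono, auto)
      finally show ?thesis by simp
    qed
    have KD: "s + 13 * D \<le> K * s"
    proof -
      define X where "X = s / \<Gamma>"
        have KX: "K * s = 70 * X" by (simp add: K_def X_def)
        have "D \<le> 5 * X" using D by (simp add: X_def)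
      moreover have "X \<ge> 4 * s" using \<Gamma> s1 by (simp add: X_def field_simps)
      ultimately have "s + 13 * D \<le> 70 * X" using s1 by linarith
      then show ?thesis by (simp only: KX)
    qed
    have z'd: "dist z' xs = D / 2" "dist z' ys = D / 2"
    proof -
      show "dist z' xs = D / 2" using e Ds by (simp add: z'_def dist_norm)
      have "z' - ys = - ((D / 2) *\<^sub>R e)" by (simp add: z'_def e(2) scaleR_left_diff_distrib[symmetric] flip: scaleR_minus_left)
      then show "dist z' ys = D / 2" using e Ds by (simp add: dist_norm)
    qed
    have sub1: "dcone e \<Gamma>' z' (K' * w) \<subseteq> dcone v \<Gamma> z (K * s)"
    proof (rule dcone_subset)
      show "norm (e - v) + \<Gamma>' \<le> \<Gamma>" "\<Gamma> / 8 + \<Gamma>' \<le> norm (e - v)" using ev \<Gamma> by (auto simp: \<Gamma>'_def)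
      show "dist z' z + K' * w \<le> K * s" using dist_triangle[of z' z xs] z'd xsz K'w KD Ds by linarith
    qed
    have sub2: "A \<union> A' \<subseteq> dcone v \<Gamma> z (K * s)"
    proof
      fix m assume m: "m \<in> A \<union> A'"
      then obtain d where d: "dirn m d" "norm (d - e) < \<Gamma>' / 8" using dir by blast
      have "norm (d - v) \<le> norm (d - e) + norm (e - v)" using norm_triangle_ineq[of "d - e" "e - v"] by simp
      moreover have "norm (e - v) \<le> norm (d - v) + norm (d - e)" using norm_triangle_ineq4[of "d - v" "d - e"] by simp
      ultimately have "\<Gamma> / 8 \<le> norm (d - v)" "norm (d - v) \<le> \<Gamma>" using d ev \<Gamma> by (auto simp: \<Gamma>'_def)
      moreover have "m \<in> hit z (K * s)"
      proof -
        obtain p where p: "m \<in> hit p (1 / 10)" "dist p xs \<le> \<epsilon> * D \<or> dist p ys \<le> \<epsilon> * D"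
          using m A(4) A'(4) by blast
        have "dist ys xs = D" using e Ds by (simp add: dist_norm)
        then have "dist p xs \<le> \<epsilon> * D + D" using p(2) dist_triangle[of p xs ys] Ds \<epsilon> by auto
        then have "dist p z + 1 / 10 \<le> K * s" using dist_triangle[of p z xs] xsz KD \<epsilon>D Ds by linarith
        then show ?thesis using hit_mono p(1) by blast
      qed
      ultimately show "m \<in> dcone v \<Gamma> z (K * s)" using d(1) by (auto simp: dcone_def)
    qed
    have "T \<in> evs (dcone v \<Gamma> z (K * s))"
      unfolding T_def using I S(1) Ev evs_mono[OF sub1] evs_mono[OF sub2]
      by (intro evs_UN evs_Int) (auto intro: countable_finite)
    moreover have "prob T \<ge> c1 * s powr (- (r * \<kappa>))"
    proof -
      have "prob T \<ge> c' * w powr (- \<kappa>) * prob (\<Union>q\<in>I. Ev q)"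
        unfolding T_def using I disj Ev S by (intro prob_selection_ge) auto
      moreover have "prob (\<Union>q\<in>I. Ev q) \<ge> 1 / 4"
      proof -
        have "occ A \<inter> occ A' \<subseteq> (\<Union>q\<in>I. Ev q)"
        proof
          fix \<omega>' assume o: "\<omega>' \<in> occ A \<inter> occ A'"
          obtain g1 g2 where "g1 \<in> G xs" "g2 \<in> G ys" "\<omega>' \<in> occ (A \<inter> (hit g1 (1 / 10) \<inter> hit g2 (1 / 10)))"
            using occ_cells[OF A(1) A(3) G(3)[of _ xs] G(3)[of _ ys], of \<omega>'] o by blast
          moreover obtain g3 g4 where "g3 \<in> G ?q3" "g4 \<in> G ?q4" "\<omega>' \<in> occ (A' \<inter> (hit g3 (1 / 10) \<inter> hit g4 (1 / 10)))"
            using occ_cells[OF A'(1) A'(3) G(3)[of _ ?q3] G(3)[of _ ?q4], of \<omega>'] o by blast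
          ultimately have "(g1, g2, g3, g4) \<in> I" "\<omega>' \<in> Ev (g1, g2, g3, g4)" by (auto simp: I_def Ev_def)
          then show "\<omega>' \<in> (\<Union>q\<in>I. Ev q)" by blast
        qed
        moreover have "(\<Union>q\<in>I. Ev q) \<in> events" using I Ev evs_events by (intro sets.finite_UN) blast+
        ultimately have "prob (occ A \<inter> occ A') \<le> prob (\<Union>q\<in>I. Ev q)" by (rule finite_measure_mono)
        moreover have "prob (occ A \<inter> occ A') \<ge> 1 - (prob (vac A) + prob (vac A'))"
        proof -
          have v: "vac A \<in> events" "vac A' \<in> events" using A A' by (auto intro: vac_event openin_line_borel)
          have "occ A \<inter> occ A' = space P - (vac A \<union> vac A')" by (auto simp: occ_def)
          then have "prob (occ A \<inter> occ A') = 1 - prob (vac A \<union> vac A')" using v by (simp add: prob_compl)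
          then show ?thesis using measure_Un_le[OF v] by linarith
        qed
        moreover have "exp (- (c * D powr (1 / 2))) \<le> 1 / 3"
        proof -
          have "D powr (1 / 2) \<ge> 2 / c" using s Ds cD by (intro powr_ge_const) (auto simp: s0_def)
          then have "c * D powr (1 / 2) \<ge> 2" using cD by (simp add: field_simps)
          then have "exp (c * D powr (1 / 2)) \<ge> 3" using exp_ge_add_one_self[of "c * D powr (1 / 2)"] by linarith
          then show ?thesis by (simp add: exp_minus field_simps)
        qed
        ultimately show ?thesis using A(2) A'(2) by linarith
      qed
      ultimately have "prob T \<ge> c' * w powr (- \<kappa>) * (1 / 4)"
        using br'(4) by (smt (verit) mult_left_mono mult_nonneg_nonneg powr_ge_zero)
      \<comment> \<open>This is where \<kappa> turns into \<open>r * \<kappa>\<close>: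
        \<open>w\<close> is \<open>D powr r\<close>, and \<open>D\<close> is at most a multiple of
        \<open>s\<close>.\<close>
      moreover have "w powr (- \<kappa>) \<ge> (5 / \<Gamma>) powr (- (r * \<kappa>)) * s powr (- (r * \<kappa>))"
      proof -
        have "(5 / \<Gamma>) powr (- (r * \<kappa>)) * s powr (- (r * \<kappa>)) = (5 * s / \<Gamma>) powr (- (r * \<kappa>))"
          using \<Gamma> s1 by (simp add: powr_mult[symmetric])
        also have "\<dots> \<le> D powr (- (r * \<kappa>))" using D Ds r01 br(2) by (intro powr_mono2') auto
        also have "\<dots> = w powr (- \<kappa>)" by (simp add: w_def powr_powr)
        finally show ?thesis .
      qed
      then have "c1 * s powr (- (r * \<kappa>)) \<le> c' * w powr (- \<kappa>) * (1 / 4)"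
        using br'(4) by (simp add: c1_def mult.assoc)
      ultimately show ?thesis by linarith
    qed
    moreover have "linked (\<C> \<omega>') x y x' y' z (K * s)" if wT: "\<omega>' \<in> T" for \<omega>'
    proof -
      obtain g1 g2 g3 g4 where q: "(g1, g2, g3, g4) \<in> I" "\<omega>' \<in> Ev (g1, g2, g3, g4)" "\<omega>' \<in> S (g1, g2, g3, g4)"
        using wT by (auto simp: T_def)
      obtain m where m: "m \<in> line_support (\<omega> \<omega>')" "m \<in> A \<inter> (hit g1 (1 / 10) \<inter> hit g2 (1 / 10))"
        using q(2) occ_line[OF _ Am(1)] unfolding Ev_def by blast
      obtain m' where m': "m' \<in> line_support (\<omega> \<omega>')" "m' \<in> A' \<inter> (hit g3 (1 / 10) \<inter> hit g4 (1 / 10))"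
        using q(2) occ_line[OF _ Am(2)] unfolding Ev_def by blast
      have \<epsilon>D': "\<epsilon> * D \<le> D" using \<epsilon>D Ds by linarith
      have "linked (\<C> \<omega>') x y x' y' xs (13 * D)"
      proof (rule pair_linked[OF m(1) _ _ m'(1) _ _ S(3)[OF q(1,3)]])
        show "\<exists>p\<in>closed_segment x y. dist p xs \<le> D \<and> m \<in> hit p (1 / 10)" using A(4)[of m] m(2) \<epsilon>D' by force
        show "\<exists>p\<in>closed_segment x' y'. dist p ys \<le> D \<and> m' \<in> hit p (1 / 10)" using A'(4)[of m'] m'(2) \<epsilon>D' by force
      qed (use m m' z'd K'w Ds in auto)
      then show ?thesis by (rule linked_mono) (use xsz KD in linarith)
    qed
    ultimately show "\<exists>S\<in>evs (dcone v \<Gamma> z (K * s)). prob S \<ge> c1 * s powr (- (r * \<kappa>)) \<and>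
           (\<forall>w\<in>S. linked (\<C> w) x y x' y' z (K * s))" by blast
  qed (use K c1 in auto)
  then show "\<exists>\<eta> K c s0. bridge (r * \<kappa>) \<Gamma> \<eta> K c s0" by blast
qed

lemma bridge_exponent_small:
  assumes "\<kappa> > 0" "DIM('a) \<ge> 2"
  obtains \<kappa>' where "0 < \<kappa>'" "\<kappa>' \<le> \<kappa>" "bridge_exponent \<kappa>'"
proof -
  define r where "r = 1 - 1 / (2 * real DIM('a))"
  note r01 = scale_exponent_bounds[OF r_def]
  have D1: "real (DIM('a) - 1) > 0" using assms by simp
  have b: "bridge_exponent (r ^ k * real (DIM('a) - 1))" for k
  proof (induction k)
    case 0
    then show ?case using bridge_exponent_base by simp
  next
    case (Suc k)
    have "r ^ k * real (DIM('a) - 1) > 0" using r01 D1 by simp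
    from bridge_exponent_step[OF Suc this r_def] show ?case by (simp add: mult.assoc)
  qed
  have "(\<lambda>k. r ^ k * real (DIM('a) - 1)) \<longlonglongrightarrow> 0 * real (DIM('a) - 1)"
    using r01 by (intro tendsto_mult LIMSEQ_power_zero tendsto_const) auto
  then have "eventually (\<lambda>k. r ^ k * real (DIM('a) - 1) < \<kappa>) sequentially"
    using assms by (intro order_tendstoD) auto
  then obtain k where "r ^ k * real (DIM('a) - 1) < \<kappa>" by (auto simp: eventually_sequentially)
  then show ?thesis using that[of "r ^ k * real (DIM('a) - 1)"] b r01 D1 by simp
qed

end


section \<open>Linking lines with overwhelming probability\<close>

text \<open>Absorbs the polynomial number of terms in the union bounds by lowering the exponent from
  \<alpha> to \<beta>. The factor 1/4 leaves room for adding several failure probabilities.\<close>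

lemma exp_powr_dominates:
  fixes C c \<alpha> \<beta> :: real and k :: nat
  assumes "C > 0" "c > 0" "0 < \<beta>" "\<beta> < \<alpha>"
  obtains x0 :: real where "x0 \<ge> 1" "\<And>x. x \<ge> x0 \<Longrightarrow> C * x ^ k * exp (- (c * x powr \<alpha>)) \<le> exp (- (x powr \<beta>)) / 4"
proof -
  define a where "a = (\<bar>ln (4 * C)\<bar> + real k / \<beta> + 1) / c"
  have a: "a > 0" using assms by (auto simp: a_def intro!: divide_pos_pos add_nonneg_pos)
  define x0 where "x0 = max 1 (a powr (1 / (\<alpha> - \<beta>)))"
  have "C * x ^ k * exp (- (c * x powr \<alpha>)) \<le> exp (- (x powr \<beta>)) / 4" if x: "x \<ge> x0" for x
  proof -
    have x1: "x \<ge> 1" "x > 0" using x by (auto simp: x0_def)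
    have "x powr (\<alpha> - \<beta>) \<ge> a" using x assms a by (intro powr_ge_const) (auto simp: x0_def)
    then have "a * x powr \<beta> \<le> x powr (\<alpha> - \<beta>) * x powr \<beta>" by (intro mult_right_mono) auto
    also have "\<dots> = x powr \<alpha>" by (simp add: powr_add[symmetric])
    finally have "c * (a * x powr \<beta>) \<le> c * x powr \<alpha>" using assms by (intro mult_left_mono) auto
    then have 1: "(\<bar>ln (4 * C)\<bar> + real k / \<beta> + 1) * x powr \<beta> \<le> c * x powr \<alpha>"
      using assms by (simp add: a_def)
    have p1: "x powr \<beta> \<ge> 1" using x1 assms by (simp add: ge_one_powr_ge_zero)
    then have 2: "\<bar>ln (4 * C)\<bar> \<le> \<bar>ln (4 * C)\<bar> * x powr \<beta>" by (simp add: mult_left_le mult_le_cancel_left1)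
    have "ln x \<le> x powr \<beta> / \<beta>" using x1 assms by (intro ln_powr_bound) auto
    then have 3: "real k * ln x \<le> real k / \<beta> * x powr \<beta>"
      using mult_left_mono[of "ln x" "x powr \<beta> / \<beta>" "real k"] by simp
    have "ln (4 * C) + real k * ln x - c * x powr \<alpha> \<le> - (x powr \<beta>)"
      using 1 2 3 by (simp add: distrib_right)
    then have "exp (ln (4 * C) + real k * ln x - c * x powr \<alpha>) \<le> exp (- (x powr \<beta>))" by simp
    moreover have "exp (ln (4 * C) + real k * ln x - c * x powr \<alpha>) = 4 * C * x ^ k * exp (- (c * x powr \<alpha>))"
    proof -
      have "exp (real k * ln x) = x ^ k" using x1 by (simp add: exp_of_nat_mult)
      then show ?thesis using assms by (simp add: exp_add exp_diff exp_minus divide_inverse)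
    qed
    ultimately show ?thesis by simp
  qed
  then show ?thesis using that[of x0] by (simp add: x0_def)
qed

lemma norm_diff_ge_of_inner:
  fixes e v :: "'a::euclidean_space"
  assumes "norm e = 1" "norm v = 1" "\<bar>e \<bullet> v\<bar> \<le> 9 / 10"
  shows "2 / 5 \<le> norm (e - v)" "2 / 5 \<le> norm (e + v)"
proof -
  have i: "e \<bullet> e = 1" "v \<bullet> v = 1" using assms by (simp_all add: norm_eq_1)
  have "(norm (e - v))\<^sup>2 = 2 - 2 * (e \<bullet> v)" "(norm (e + v))\<^sup>2 = 2 + 2 * (e \<bullet> v)"
    using i by (simp_all add: power2_norm_eq_inner inner_diff_left inner_diff_right inner_add_left inner_add_right inner_commute)
  moreover have "(2 / 5 :: real)\<^sup>2 \<le> 1 / 5" by (simp add: power2_eq_square)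
  ultimately have "(2 / 5)\<^sup>2 \<le> (norm (e - v))\<^sup>2" "(2 / 5)\<^sup>2 \<le> (norm (e + v))\<^sup>2"
    using assms(3) unfolding abs_le_iff by linarith+
  then show "2 / 5 \<le> norm (e - v)" "2 / 5 \<le> norm (e + v)" by (auto intro: power2_le_imp_le)
qed

text \<open>Bessel's inequality for the orthonormal pair \<open>v\<close>, \<open>v'\<close>:
  components at most 26 along \<open>v\<close> and at least 14 along \<open>v'\<close> give a cosine
  of at most \<open>26 / sqrt (26\<^sup>2 + 14\<^sup>2)\<close>, below 9/10.\<close>

lemma inner_ratio_le:
  fixes V v v' :: "'a::euclidean_space"
  assumes "norm v = 1" "norm v' = 1" "v \<bullet> v' = 0" "\<bar>V \<bullet> v\<bar> \<le> 26 * s" "14 * s \<le> \<bar>V \<bullet> v'\<bar>" "s > 0"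
  shows "\<bar>V \<bullet> v\<bar> \<le> 9 / 10 * norm V" "14 * s \<le> norm V"
proof -
  have i: "v \<bullet> v = 1" "v' \<bullet> v' = 1" using assms by (simp_all add: norm_eq_1)
  have "0 \<le> (V - (V \<bullet> v) *\<^sub>R v - (V \<bullet> v') *\<^sub>R v') \<bullet> (V - (V \<bullet> v) *\<^sub>R v - (V \<bullet> v') *\<^sub>R v')" by simp
  also have "\<dots> = V \<bullet> V - (V \<bullet> v)\<^sup>2 - (V \<bullet> v')\<^sup>2"
    using i assms(3) by (simp add: inner_diff_left inner_diff_right inner_commute power2_eq_square)
  finally have b: "(V \<bullet> v)\<^sup>2 + (V \<bullet> v')\<^sup>2 \<le> (norm V)\<^sup>2" by (simp add: power2_norm_eq_inner)
  have "(V \<bullet> v)\<^sup>2 \<le> (26 * s)\<^sup>2" using assms by (intro abs_le_square_iff[THEN iffD1]) auto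
  moreover have "(14 * s)\<^sup>2 \<le> (V \<bullet> v')\<^sup>2" using assms by (intro abs_le_square_iff[THEN iffD1]) auto
  ultimately have "(V \<bullet> v)\<^sup>2 \<le> (9 / 10 * norm V)\<^sup>2"
    using b by (simp add: power_mult_distrib power_divide) (use zero_le_power2[of s] in linarith)
  then have "\<bar>V \<bullet> v\<bar> \<le> \<bar>9 / 10 * norm V\<bar>" by (simp only: abs_le_square_iff)
  then show "\<bar>V \<bullet> v\<bar> \<le> 9 / 10 * norm V" by simp
  have "\<bar>V \<bullet> v'\<bar> \<le> norm V" using Cauchy_Schwarz_ineq2[of V v'] assms by simp
  then show "14 * s \<le> norm V" using assms by linarith
qed

text \<open>In dimension at least 3 two vectors span a proper subspace. This provides the auxiliary
  direction in \<open>link_lines\<close>.\<close>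

lemma orthogonal_two_exists:
  fixes f g :: "'a::euclidean_space"
  assumes "DIM('a) \<ge> 3"
  obtains e where "norm e = 1" "e \<bullet> f = 0" "e \<bullet> g = 0"
proof -
  have "card {f, g} \<le> 2" by (simp add: card_insert_if)
  then have "dim {f, g} < DIM('a)" using dim_le_card'[of "{f, g}"] assms by simp
  then obtain x where x: "x \<noteq> 0" "\<And>y. y \<in> span {f, g} \<Longrightarrow> orthogonal x y"
    using orthogonal_to_subspace_exists by blast
  have "x \<bullet> f = 0" "x \<bullet> g = 0" using x(2)[of f] x(2)[of g] by (auto simp: orthogonal_def span_base)
  then show ?thesis using that[of "x /\<^sub>R norm x"] x(1) by simp
qed

section \<open>Overwhelming probability for segments transversal to the line joining them\<close>

context poisson_lines
begin

text \<open>The tubes contain of order \<open>D / w\<close> windows, each succeeding with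
  probability at least of order \<open>w powr (- \<kappa>)\<close>. For \<kappa> at most
  \<open>1 / (4 * d)\<close> the expected number of successes is at least of order
  \<open>D powr (1 / (4 * d))\<close>, and by independence the probability of none is exponentially
  small in it.\<close>

lemma transversal_link:
  assumes \<gamma>: "0 < \<gamma>" "\<gamma> \<le> 1" and \<epsilon>: "0 < \<epsilon>" "\<epsilon> \<le> 1" and dim: "DIM('a) \<ge> 2"
  obtains \<beta> D0 :: real where "0 < \<beta>" "\<beta> < 1" "D0 \<ge> 1"
    "\<And>D e x y x' y' xs ys. D \<ge> D0 \<Longrightarrow> norm e = 1 \<Longrightarrow> ys = xs + D *\<^sub>R e \<Longrightarrow>
      crossing \<gamma> e x y xs (\<epsilon> * D) \<Longrightarrow> crossing \<gamma> e x' y' ys (\<epsilon> * D) \<Longrightarrow>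
      \<exists>S\<in>events. prob (space P - S) \<le> exp (- (D powr \<beta>)) \<and>
        (\<forall>w\<in>S. linked (\<C> w) x y x' y' xs (13 * D))"
proof -
  let ?d = "real DIM('a)"
  define r where "r = 1 - 1 / (2 * ?d)"
  have d: "?d \<ge> 1" by (simp add: Suc_leI)
  note r01 = scale_exponent_bounds[OF r_def]
  obtain \<kappa> where \<kappa>: "0 < \<kappa>" "\<kappa> \<le> 1 / (4 * ?d)" "bridge_exponent \<kappa>"
    using bridge_exponent_small[of "1 / (4 * ?d)"] dim d by auto
  define \<Gamma> :: real where "\<Gamma> = 1 / 4"
  have \<Gamma>: "0 < \<Gamma>" "\<Gamma> \<le> 1 / 4" by (simp_all add: \<Gamma>_def)
  obtain \<eta>' K' c' s0' where br0: "bridge \<kappa> \<Gamma> \<eta>' K' c' s0'"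
    using \<kappa>(3) \<Gamma> unfolding bridge_exponent_def by blast
  have br': "0 < \<eta>'" "\<eta>' \<le> 1 / 100" "K' \<ge> 1" "c' > 0" "s0' \<ge> 1"
    using br0 unfolding bridge_def by blast+
  have br6: "\<exists>S\<in>evs (dcone v \<Gamma> z (K' * s)). prob S \<ge> c' * s powr (- \<kappa>) \<and>
           (\<forall>w\<in>S. linked (\<C> w) x y x' y' z (K' * s))"
    if "s \<ge> s0'" "conf \<eta>' \<Gamma> s z v n x y x' y'" for s z v n x y x' y'
    using br0 that unfolding bridge_def by simp
  \<comment> \<open>Window centres are \<open>M * w\<close> apart and a window uses lines within
    \<open>K' * w\<close> of its centre. A line used by two windows would deviate from
    \<open>e\<close> by at most 4/300, below \<Gamma>/8 = 1/32.\<close>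
  define M where "M = 300 * K'"
  have M: "M \<ge> 300" using br' by (simp add: M_def)
  define \<eta> where "\<eta> = \<eta>' / (3 * s0')"
  have \<eta>: "0 < \<eta>" "\<eta> \<le> 1" "\<eta> * s0' \<le> 1" "3 * \<eta> \<le> \<eta>'" using br' by (auto simp: \<eta>_def field_simps)
  define \<delta> where "\<delta> = min \<epsilon> (1 / (4 * M))"
  have \<delta>: "0 < \<delta>" "\<delta> \<le> 1" "\<delta> \<le> \<epsilon>" "\<delta> \<le> 1 / (4 * M)" using \<epsilon> M by (auto simp: \<delta>_def)
  obtain c D0 where cD: "c > 0" "D0 \<ge> 1"
    "\<And>D. D \<ge> D0 \<Longrightarrow> 1 \<le> \<eta> * D powr r \<and> D powr r \<le> \<delta> * D"
    "\<And>D e x y x' y' xs ys. D \<ge> D0 \<Longrightarrow> norm e = 1 \<Longrightarrow> ys = xs + D *\<^sub>R e \<Longrightarrow>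
      crossing \<gamma> e x y xs (\<delta> * D) \<Longrightarrow> crossing \<gamma> e x' y' ys (\<delta> * D) \<Longrightarrow>
      \<exists>n l A A'. parallel_families x y x' y' xs ys e (D powr r) (2 * \<eta> * D powr r) (\<delta> * D)
        (exp (- (c * D powr (1 / 2)))) n l A A'"
    by (rule parallel_pair[OF \<gamma> \<eta>(1,2) \<delta>(1,2) r_def]) (rule that; assumption)
  obtain Cc where Cc: "Cc > 0" "\<And>(q::'a) R. R \<ge> 1 \<Longrightarrow> \<exists>G. finite G \<and> real (card G) \<le> Cc * R ^ DIM('a) \<and>
      (\<forall>g\<in>G. dist g q \<le> R + 1) \<and> (\<forall>l\<in>hit q R. \<exists>g\<in>G. l \<in> hit g (1 / 10))"
    using hit_cells[where 'a = 'a] by metis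
  define c2 where "c2 = c' / (4 * M)"
  have c2: "c2 > 0" using br' M by (simp add: c2_def)
  \<comment> \<open>Strictly below both rates that occur, 1/2 for the existence of the pair and
    \<open>1 / (4 * d)\<close> for the windows.\<close>
  define \<beta> where "\<beta> = 1 / (8 * ?d)"
  have \<beta>: "0 < \<beta>" "\<beta> < 1" "\<beta> < 1 / 2" "\<beta> < 1 / (4 * ?d)" using dim by (auto simp: \<beta>_def field_simps)
  define Cq where "Cq = (Cc * 2 ^ DIM('a)) ^ 4"
  have Cq: "Cq > 0" using Cc by (simp add: Cq_def)
  obtain X1 where X1: "X1 \<ge> 1" "\<And>x. x \<ge> X1 \<Longrightarrow> 2 * x ^ 0 * exp (- (c * x powr (1 / 2))) \<le> exp (- (x powr \<beta>)) / 4"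
    using exp_powr_dominates[of 2 c \<beta> "1 / 2" 0] cD \<beta> by auto
  obtain X2 where X2: "X2 \<ge> 1" "\<And>x. x \<ge> X2 \<Longrightarrow> Cq * x ^ (4 * DIM('a)) * exp (- (c2 * x powr (1 / (4 * ?d)))) \<le> exp (- (x powr \<beta>)) / 4"
    using exp_powr_dominates[OF Cq c2 \<beta>(1,4), of "4 * DIM('a)"] by blast
  show ?thesis
  proof (rule that[OF \<beta>(1,2), of "max D0 (max X1 X2)"])
    show "max D0 (max X1 X2) \<ge> 1" using cD by simp
  next
    fix D and e x y x' y' xs ys :: 'a
    assume DD: "D \<ge> max D0 (max X1 X2)" and e: "norm e = 1" "ys = xs + D *\<^sub>R e"
      and cr: "crossing \<gamma> e x y xs (\<epsilon> * D)" "crossing \<gamma> e x' y' ys (\<epsilon> * D)"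
    have D: "D \<ge> D0" "D \<ge> X1" "D \<ge> X2" "D \<ge> 1" "D > 0" using DD cD by auto
    have \<delta>\<epsilon>: "\<delta> * D \<le> \<epsilon> * D" using \<delta> D by (intro mult_right_mono) auto
    have \<delta>M: "\<delta> * D \<le> D / (4 * M)" using mult_right_mono[OF \<delta>(4), of D] D by simp
    have "D / (4 * M) \<le> D / 1200" using M D by (intro divide_left_mono) auto
    then have \<delta>D: "\<delta> * D \<le> D / 1200" using \<delta>M by linarith
    define w where "w = D powr r"
    have w: "1 \<le> \<eta> * w" "w \<le> \<delta> * D" using cD(3)[OF D(1)] by (auto simp: w_def)
    have "s0' \<le> w"
    proof -
      have "\<eta> * s0' \<le> \<eta> * w" using w \<eta> by linarith
      then show ?thesis using \<eta>(1) by simp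
    qed
    then have ws: "w \<ge> s0'" "w > 0" using br' by auto
    have wM: "w \<le> D / (4 * M)" using w \<delta>M by linarith
    have K'w: "K' * w \<le> D"
    proof -
      have "4 * M * w \<le> D" using wM M by (simp add: field_simps)
      moreover have "K' * w \<le> 4 * M * w" using ws br' by (intro mult_right_mono) (auto simp: M_def)
      ultimately show ?thesis by linarith
    qed
    obtain n l A A' where n: "norm n = 1" "n \<bullet> e = 0" "\<bar>l\<bar> \<le> \<delta> * D"
      and A: "openin line_topology A" "prob (vac A) \<le> exp (- (c * D powr (1 / 2)))"
        "\<And>m. m \<in> A \<Longrightarrow> m \<in> hit xs (2 * \<eta> * w) \<and> m \<in> hit ys (2 * \<eta> * w)"
        "\<And>m. m \<in> A \<Longrightarrow> \<exists>p\<in>closed_segment x y. dist p xs \<le> \<delta> * D \<and> m \<in> hit p (1 / 10)"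
      and A': "openin line_topology A'" "prob (vac A') \<le> exp (- (c * D powr (1 / 2)))"
        "\<And>m. m \<in> A' \<Longrightarrow> m \<in> hit (xs + w *\<^sub>R n + l *\<^sub>R e) (2 * \<eta> * w) \<and> m \<in> hit (ys + w *\<^sub>R n + l *\<^sub>R e) (2 * \<eta> * w)"
        "\<And>m. m \<in> A' \<Longrightarrow> \<exists>p\<in>closed_segment x' y'. dist p ys \<le> \<delta> * D \<and> m \<in> hit p (1 / 10)"
      using cD(4)[OF D(1) e crossing_mono[OF cr(1) \<delta>\<epsilon>] crossing_mono[OF cr(2) \<delta>\<epsilon>]] unfolding w_def[symmetric] parallel_families_def by blast
    have R1: "1 \<le> 2 * \<eta> * w" using w by linarith
    have R2: "2 * \<eta> * w \<le> 2 * D"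
    proof -
      have "\<eta> * w \<le> w" using \<eta> ws by simp
      then show ?thesis using w(2) \<delta>D D by linarith
    qed
    have R3: "2 * \<eta> * w + 1 \<le> \<eta>' * w"
    proof -
      have "3 * \<eta> * w \<le> \<eta>' * w" using \<eta> ws by (intro mult_right_mono) auto
      then show ?thesis using w by linarith
    qed
    have "\<exists>G. finite G \<and> real (card G) \<le> Cc * 2 ^ DIM('a) * D ^ DIM('a) \<and> (\<forall>g\<in>G. dist g q \<le> 2 * \<eta> * w + 1) \<and>
        (\<forall>l\<in>hit q (2 * \<eta> * w). \<exists>g\<in>G. l \<in> hit g (1 / 10))" for q :: 'a
    proof -
      have "Cc * (2 * \<eta> * w) ^ DIM('a) \<le> Cc * (2 * D) ^ DIM('a)"
        using Cc(1) R1 R2 by (intro mult_left_mono power_mono) auto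
      then show ?thesis using Cc(2)[OF R1, of q] by (auto simp: power_mult_distrib mult.assoc intro: order_trans)
    qed
    then obtain G where G: "\<And>q::'a. finite (G q)" "\<And>q. real (card (G q)) \<le> Cc * 2 ^ DIM('a) * D ^ DIM('a)"
      "\<And>q g. g \<in> G q \<Longrightarrow> dist g q \<le> 2 * \<eta> * w + 1"
      "\<And>q l. l \<in> hit q (2 * \<eta> * w) \<Longrightarrow> \<exists>g\<in>G q. l \<in> hit g (1 / 10)" by metis
    let ?q3 = "xs + w *\<^sub>R n + l *\<^sub>R e" and ?q4 = "ys + w *\<^sub>R n + l *\<^sub>R e"
    define I where "I = G xs \<times> G ys \<times> G ?q3 \<times> G ?q4"
    have I: "finite I" using G(1) by (simp add: I_def)
    have cI: "real (card I) \<le> Cq * D ^ (4 * DIM('a))"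
    proof -
      let ?B = "Cc * 2 ^ DIM('a) * D ^ DIM('a)"
      have "real (card I) = real (card (G xs)) * (real (card (G ys)) * (real (card (G ?q3)) * real (card (G ?q4))))"
        by (simp add: I_def card_cartesian_product)
      also have "\<dots> \<le> ?B * (?B * (?B * ?B))"
        using Cc(1) D by (intro mult_mono G(2)) auto
      also have "\<dots> = Cq * D ^ (4 * DIM('a))"
      proof -
        have "D ^ (4 * DIM('a)) = (D ^ DIM('a)) ^ 4" by (simp add: power_mult[symmetric] mult.commute)
        then show ?thesis by (simp add: Cq_def power4_eq_xxxx mult_ac)
      qed
      finally show ?thesis .
    qed
    \<comment> \<open>The centres occupy the middle half of the tubes, so that each window and the
      offset \<open>l\<close> fit inside. Rounding down loses at most 1, which is at most half of
      the quotient.\<close>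
    define N where "N = nat \<lfloor>D / (2 * M * w)\<rfloor>"
    have Mw: "M * w > 0" using M ws by simp
    have N1: "real N * (M * w) \<le> D / 2"
    proof -
      have "real N \<le> D / (2 * M * w)" unfolding N_def using D Mw by (intro of_nat_floor) (auto simp: mult.assoc)
      then have "real N * (M * w) \<le> D / (2 * M * w) * (M * w)" using Mw by (intro mult_right_mono) auto
      then show ?thesis using M ws by simp
    qed
    have N2: "real N \<ge> D / (4 * M * w)"
    proof -
      have "D / (4 * M * w) \<ge> 1" using wM M ws by (simp add: field_simps)
      moreover have "D / (2 * M * w) = 2 * (D / (4 * M * w))" by simp
      moreover have "real N \<ge> D / (2 * M * w) - 1" unfolding N_def by linarith
      ultimately show ?thesis by linarith
    qed
    define t where "t i = D / 4 + real i * (M * w)" for i :: nat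
    define zz where "zz i = xs + t i *\<^sub>R e" for i
    have ti: "D / 4 \<le> t i" "t i \<le> 3 / 4 * D" if "i < N" for i
    proof -
      show "D / 4 \<le> t i" using Mw by (simp add: t_def)
      have "real i * (M * w) \<le> real N * (M * w)" using that Mw by (intro mult_right_mono) auto
      then show "t i \<le> 3 / 4 * D" using N1 unfolding t_def by linarith
    qed
    define X where "X i = dcone e \<Gamma> (zz i) (K' * w)" for i
    have disj: "disjoint_family_on X {..<N}"
    proof -
      have no: "X i \<inter> X j = {}" if ij: "i < j" for i j
      proof (rule ccontr)
        assume "X i \<inter> X j \<noteq> {}"
        then obtain m where m: "m \<in> X i" "m \<in> X j" by blast
        then have h: "m \<in> hit (zz i) (K' * w)" "m \<in> hit (zz j) (K' * w)" by (auto simp: X_def dcone_def)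
        define E where "E = (real j - real i) * (M * w)"
        have "1 * (M * w) \<le> (real j - real i) * (M * w)" using ij Mw by (intro mult_right_mono) auto
        then have E: "E \<ge> 300 * (K' * w)" by (simp add: E_def M_def mult.assoc)
        have Kp: "0 < K' * w" using ws br' by simp
        have "zz j = zz i + E *\<^sub>R e" by (simp add: zz_def t_def E_def algebra_simps)
        then obtain v where v: "dirn m v" "norm (v - e) \<le> 4 * (K' * w) / E"
          using dirn_of_hits[OF h _ e(1) Kp, of E] E Kp by auto
        have "4 * (K' * w) / E \<le> 4 / 300" using E Kp by (simp add: field_simps)
        then have "norm (v - e) < \<Gamma> / 8" using v(2) by (simp add: \<Gamma>_def)
        then have "m \<notin> X i" unfolding X_def using v(1) by (intro dcone_disjoint[OF e(1)]) (auto simp: \<Gamma>_def)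
        then show False using m by simp
      qed
      show ?thesis unfolding disjoint_family_on_def using no by (metis inf_commute nat_neq_iff)
    qed
    have W: "\<exists>S. S \<in> evs (X i) \<and> prob S \<ge> c' * w powr (- \<kappa>) \<and>
           (\<forall>\<omega>'\<in>S. linked (\<C> \<omega>') g1 g2 g3 g4 (zz i) (K' * w))"
      if g: "(g1, g2, g3, g4) \<in> I" and i: "i < N" for g1 g2 g3 g4 i
    proof -
      have gd: "dist g1 xs \<le> 2 * \<eta> * w + 1" "dist g2 (xs + D *\<^sub>R e) \<le> 2 * \<eta> * w + 1"
        "dist g3 ?q3 \<le> 2 * \<eta> * w + 1" "dist g4 (xs + D *\<^sub>R e + w *\<^sub>R n + l *\<^sub>R e) \<le> 2 * \<eta> * w + 1"
        using g G(3) e(2) by (auto simp: I_def)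
      have "6 * w / \<Gamma> = 24 * w" by (simp add: \<Gamma>_def)
      then have tt: "6 * w / \<Gamma> + \<bar>l\<bar> \<le> t i" "t i + 6 * w / \<Gamma> + \<bar>l\<bar> \<le> D"
        using n(3) \<delta>D w(2) ti[OF i] D by linarith+
      have \<Gamma>0: "0 < \<Gamma>" by (simp add: \<Gamma>_def)
      obtain p1 p2 p3 p4 where pc: "conf \<eta>' \<Gamma> w (zz i) e n p1 p2 p3 p4"
        and p: "p1 \<in> closed_segment g1 g2" "p2 \<in> closed_segment g1 g2" "p3 \<in> closed_segment g3 g4" "p4 \<in> closed_segment g3 g4"
        by (rule conf_interpolate[OF e(1) n(1,2) D(5) \<Gamma>0 ws(2) gd R3 tt, folded zz_def]) (rule that, assumption+)
      show ?thesis using br6[OF ws(1) pc] linked_segments[OF _ p] unfolding X_def by blast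
    qed
    have "\<exists>F\<in>events. prob (space P - F) \<le> exp (- (c2 * D powr (1 / (4 * ?d)))) \<and>
        (\<forall>\<omega>'\<in>F. \<exists>i<N. linked (\<C> \<omega>') g1 g2 g3 g4 (zz i) (K' * w))"
      if g: "(g1, g2, g3, g4) \<in> I" for g1 g2 g3 g4
    proof -
      have "\<forall>i\<in>{..<N}. \<exists>S. S \<in> evs (X i) \<and> prob S \<ge> c' * w powr (- \<kappa>) \<and>
           (\<forall>\<omega>'\<in>S. linked (\<C> \<omega>') g1 g2 g3 g4 (zz i) (K' * w))" using W[OF g] by simp
      from bchoice[OF this] obtain S where S: "\<forall>i\<in>{..<N}. S i \<in> evs (X i) \<and> prob (S i) \<ge> c' * w powr (- \<kappa>) \<and>
           (\<forall>\<omega>'\<in>S i. linked (\<C> \<omega>') g1 g2 g3 g4 (zz i) (K' * w))" by blast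
      let ?F = "\<Union>i<N. S i"
      have "?F \<in> events" using S evs_events by (intro sets.finite_UN) auto
      moreover have "prob (space P - ?F) \<le> exp (- (real N * (c' * w powr (- \<kappa>))))"
        using S by (intro prob_all_fail_le[OF disj]) auto
      moreover have "c2 * D powr (1 / (4 * ?d)) \<le> real N * (c' * w powr (- \<kappa>))"
      proof -
        \<comment> \<open>The exponent \<open>1 - r - r * \<kappa>\<close> is at least
          \<open>1 / (2 * d) - 1 / (4 * d)\<close>.\<close>
        have "D powr (1 / (4 * ?d)) \<le> D powr (1 - r - r * \<kappa>)"
        proof (rule powr_mono[OF _ D(4)])
          have "r * \<kappa> \<le> 1 * \<kappa>" using r01 \<kappa> by (intro mult_right_mono) auto
          moreover have "1 / (2 * ?d) = 2 * (1 / (4 * ?d))" by simp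
          ultimately show "1 / (4 * ?d) \<le> 1 - r - r * \<kappa>" using \<kappa>(2) unfolding r_def by linarith
        qed
        also have "\<dots> = D powr 1 * D powr (- r) * D powr (- (r * \<kappa>))" by (simp only: powr_add[symmetric] add_uminus_conv_diff)
        also have "\<dots> = D / w * w powr (- \<kappa>)" using D by (simp add: w_def powr_powr powr_minus divide_inverse)
        finally have "c2 * D powr (1 / (4 * ?d)) \<le> c2 * (D / w * w powr (- \<kappa>))" using c2 by (intro mult_left_mono) auto
        also have "\<dots> = D / (4 * M * w) * (c' * w powr (- \<kappa>))" by (simp add: c2_def)
        also have "\<dots> \<le> real N * (c' * w powr (- \<kappa>))" using N2 br' by (intro mult_right_mono) auto
        finally show ?thesis .
      qed
      ultimately show ?thesis using S by (intro bexI[of _ ?F]) (auto intro: order_trans)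
    qed
    note FX = this
    have "\<forall>q\<in>I. \<exists>F. F \<in> events \<and> prob (space P - F) \<le> exp (- (c2 * D powr (1 / (4 * ?d)))) \<and>
        (\<forall>\<omega>'\<in>F. \<exists>i<N. linked (\<C> \<omega>') (fst q) (fst (snd q)) (fst (snd (snd q))) (snd (snd (snd q))) (zz i) (K' * w))"
    proof
      fix q assume "q \<in> I"
      moreover obtain g1 g2 g3 g4 where "q = (g1, g2, g3, g4)" by (rule prod_cases4)
      ultimately show "\<exists>F. F \<in> events \<and> prob (space P - F) \<le> exp (- (c2 * D powr (1 / (4 * ?d)))) \<and>
        (\<forall>\<omega>'\<in>F. \<exists>i<N. linked (\<C> \<omega>') (fst q) (fst (snd q)) (fst (snd (snd q))) (snd (snd (snd q))) (zz i) (K' * w))"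
        using FX[of g1 g2 g3 g4] by auto
    qed
    from bchoice[OF this] obtain F where F0: "\<forall>q\<in>I. F q \<in> events \<and> prob (space P - F q) \<le> exp (- (c2 * D powr (1 / (4 * ?d)))) \<and>
        (\<forall>\<omega>'\<in>F q. \<exists>i<N. linked (\<C> \<omega>') (fst q) (fst (snd q)) (fst (snd (snd q))) (snd (snd (snd q))) (zz i) (K' * w))"
      by blast
    have v: "vac A \<in> events" "vac A' \<in> events" using A(1) A'(1) by (auto intro: vac_event openin_line_borel)
    \<comment> \<open>In contrast to \<open>bridge_exponent_step\<close>, failure is now so unlikely
      that all cells can be required to succeed at once, which avoids any selection.\<close>
    define B where "B = (\<Union>q\<in>I. space P - F q)"
    have Bm: "B \<in> events" unfolding B_def using I F0 by (intro sets.finite_UN) auto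
    have pB: "prob B \<le> exp (- (D powr \<beta>)) / 4"
    proof -
      have "prob B \<le> (\<Sum>q\<in>I. prob (space P - F q))"
        unfolding B_def using I F0 by (intro measure_UNION_le) auto
      also have "\<dots> \<le> (\<Sum>q\<in>I. exp (- (c2 * D powr (1 / (4 * ?d)))))" using F0 by (intro sum_mono) auto
      also have "\<dots> = real (card I) * exp (- (c2 * D powr (1 / (4 * ?d))))" by simp
      also have "\<dots> \<le> Cq * D ^ (4 * DIM('a)) * exp (- (c2 * D powr (1 / (4 * ?d))))" using cI by (intro mult_right_mono) auto
      also have "\<dots> \<le> exp (- (D powr \<beta>)) / 4" by (rule X2(2)[OF D(3)])
      finally show ?thesis .
    qed
    define T where "T = space P - (vac A \<union> vac A' \<union> B)"
    have "T \<in> events" unfolding T_def using v Bm by auto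
    moreover have "prob (space P - T) \<le> exp (- (D powr \<beta>))"
    proof -
      have "space P - T = vac A \<union> vac A' \<union> B"
        unfolding T_def using v Bm sets.sets_into_space[of _ P] by blast
      then have "prob (space P - T) \<le> prob (vac A) + prob (vac A') + prob B"
        using measure_Un_le[of "vac A \<union> vac A'" P B] measure_Un_le[OF v] v Bm by auto
      also have "\<dots> \<le> 2 * exp (- (c * D powr (1 / 2))) + exp (- (D powr \<beta>)) / 4" using A(2) A'(2) pB by linarith
      also have "\<dots> \<le> exp (- (D powr \<beta>)) / 4 + exp (- (D powr \<beta>)) / 4" using X1(2)[OF D(2)] by simp
      finally show ?thesis using exp_gt_zero[of "- (D powr \<beta>)"] by linarith
    qed
    moreover have "linked (\<C> \<omega>') x y x' y' xs (13 * D)" if wT: "\<omega>' \<in> T" for \<omega>'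
    proof -
      have o: "\<omega>' \<in> occ A" "\<omega>' \<in> occ A'" "\<omega>' \<in> space P" "\<omega>' \<notin> B" using wT by (auto simp: T_def occ_def)
      obtain m where m: "m \<in> line_support (\<omega> \<omega>')" "m \<in> A" using occ_line[OF o(1) openin_line_borel[OF A(1)]] by blast
      obtain m' where m': "m' \<in> line_support (\<omega> \<omega>')" "m' \<in> A'" using occ_line[OF o(2) openin_line_borel[OF A'(1)]] by blast
      obtain g1 where g1: "g1 \<in> G xs" "m \<in> hit g1 (1 / 10)" using A(3)[OF m(2)] G(4)[of m xs] by blast
      obtain g2 where g2: "g2 \<in> G ys" "m \<in> hit g2 (1 / 10)" using A(3)[OF m(2)] G(4)[of m ys] by blast
      obtain g3 where g3: "g3 \<in> G ?q3" "m' \<in> hit g3 (1 / 10)" using A'(3)[OF m'(2)] G(4)[of m' ?q3] by blast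
      obtain g4 where g4: "g4 \<in> G ?q4" "m' \<in> hit g4 (1 / 10)" using A'(3)[OF m'(2)] G(4)[of m' ?q4] by blast
      have q: "(g1, g2, g3, g4) \<in> I" using g1 g2 g3 g4 by (simp add: I_def)
      then have "\<omega>' \<in> F (g1, g2, g3, g4)" using o(3,4) by (auto simp: B_def)
      then obtain i where i: "i < N" "linked (\<C> \<omega>') g1 g2 g3 g4 (zz i) (K' * w)"
        using F0 q by fastforce
      have zd: "dist (zz i) xs \<le> D" "dist (zz i) ys \<le> D"
      proof -
        show "dist (zz i) xs \<le> D" using e ti[OF i(1)] D by (simp add: zz_def dist_norm)
        have "zz i - ys = (t i - D) *\<^sub>R e" by (simp add: zz_def e(2) algebra_simps)
        then show "dist (zz i) ys \<le> D" using e ti[OF i(1)] D by (simp add: dist_norm)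
      qed
      have \<delta>D': "\<delta> * D \<le> D" using \<delta>D D by linarith
      show ?thesis
      proof (rule pair_linked[OF m(1) _ _ m'(1) _ _ i(2)])
        show "\<exists>p\<in>closed_segment x y. dist p xs \<le> D \<and> m \<in> hit p (1 / 10)" using A(4)[OF m(2)] \<delta>D' by force
        show "\<exists>p\<in>closed_segment x' y'. dist p ys \<le> D \<and> m' \<in> hit p (1 / 10)" using A'(4)[OF m'(2)] \<delta>D' by force
      qed (use g1 g2 g3 g4 zd K'w D in auto)
    qed
    ultimately show "\<exists>S\<in>events. prob (space P - S) \<le> exp (- (D powr \<beta>)) \<and>
        (\<forall>w\<in>S. linked (\<C> w) x y x' y' xs (13 * D))" by blast
  qed
qed

end


section \<open>Lines in arbitrary relative position\<close>

lemma norm_diff_ge_1: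
  fixes f e :: "'a::euclidean_space"
  assumes "norm f = 1" "norm e = 1" "e \<bullet> f = 0"
  shows "1 \<le> norm (f - e)" "1 \<le> norm (f + e)"
proof -
  have i: "e \<bullet> e = 1" "f \<bullet> f = 1" "f \<bullet> e = 0" using assms by (simp_all add: norm_eq_1 inner_commute)
  have "1\<^sup>2 \<le> (norm (f - e))\<^sup>2" "1\<^sup>2 \<le> (norm (f + e))\<^sup>2"
    using i by (auto simp: power2_norm_eq_inner inner_diff_left inner_diff_right inner_add_left inner_add_right inner_commute)
  then show "1 \<le> norm (f - e)" "1 \<le> norm (f + e)" by (auto intro: power2_le_imp_le)
qed

context poisson_lines
begin

text \<open>The two lines may be close and nearly parallel. Therefore a third line, orthogonal to both, is first
  attached to one of them.\<close>

lemma link_lines: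
  assumes dim: "DIM('a) \<ge> 3"
  obtains \<beta> s0 :: real where "0 < \<beta>" "\<beta> < 1" "s0 \<ge> 1"
    "\<And>s x y x' y'. s \<ge> s0 \<Longrightarrow> s \<le> dist x y \<Longrightarrow> 40 * s \<le> dist x' y' \<Longrightarrow> dist x' y' \<le> 41 * s \<Longrightarrow> dist x x' \<le> 5 * s \<Longrightarrow>
      \<exists>S\<in>events. prob (space P - S) \<le> exp (- (s powr \<beta>)) \<and>
        (\<forall>w\<in>S. linked (\<C> w) x y x' y' x (2000 * s))"
proof -
  have g4: "0 < (1 / 4 :: real)" "(1 / 4 :: real) \<le> 1" by auto
  have dim2: "DIM('a) \<ge> 2" using dim by simp
  obtain \<beta>1 D0 where \<beta>1: "0 < \<beta>1" "\<beta>1 < 1" "D0 \<ge> 1"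
    and TL: "\<And>D e x y x' y' xs ys. D \<ge> D0 \<Longrightarrow> norm e = 1 \<Longrightarrow> ys = xs + D *\<^sub>R e \<Longrightarrow>
      crossing (1 / 4) e x y xs (1 / 4 * D) \<Longrightarrow> crossing (1 / 4) e x' y' ys (1 / 4 * D) \<Longrightarrow>
      \<exists>S\<in>events. prob (space P - S) \<le> exp (- (D powr \<beta>1)) \<and>
        (\<forall>w\<in>S. linked (\<C> w) x y x' y' xs (13 * D))"
    by (rule transversal_link[OF g4 g4 dim2]) (rule that; assumption)
  have g1: "0 < (1 :: real)" "(1 :: real) \<le> 1" by auto
  obtain c0 where c0: "c0 > 0"
    "\<And>f e x \<rho> D. norm f = 1 \<Longrightarrow> norm e = 1 \<Longrightarrow> norm (f - e) \<ge> 1 \<Longrightarrow> norm (f + e) \<ge> 1 \<Longrightarrow>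
      1 \<le> \<rho> \<Longrightarrow> \<rho> \<le> 1 / 60 * D \<Longrightarrow> \<exists>A. openin line_topology A \<and>
      ennreal (c0 * \<rho> * (\<rho> / D) ^ (DIM('a) - 1)) \<le> emeasure \<mu> A \<and>
      (\<forall>l\<in>A. \<exists>t\<in>{0..\<rho>}. l \<in> hit (x + t *\<^sub>R f) (1 / 10) \<and> l \<in> hit (x + D *\<^sub>R e) \<rho>)"
    using transversal_family[OF g1] by metis
  obtain Cc where Cc: "Cc > 0" "\<And>(q::'a) R. R \<ge> 1 \<Longrightarrow> \<exists>G. finite G \<and> real (card G) \<le> Cc * R ^ DIM('a) \<and>
      (\<forall>g\<in>G. dist g q \<le> R + 1) \<and> (\<forall>l\<in>hit q R. \<exists>g\<in>G. l \<in> hit g (1 / 10))"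
    using hit_cells[where 'a = 'a] by metis
  define c3 where "c3 = c0 / 10 * (1 / 400) ^ (DIM('a) - 1)"
  have c3: "c3 > 0" "u * c3 > 0" using c0 u by (auto simp: c3_def)
  define \<beta> where "\<beta> = \<beta>1 / 2"
  have \<beta>: "0 < \<beta>" "\<beta> < 1" "\<beta> < \<beta>1" using \<beta>1 by (auto simp: \<beta>_def)
  obtain X1 where X1: "X1 \<ge> 1" "\<And>x. x \<ge> X1 \<Longrightarrow> 1 * x ^ 0 * exp (- (u * c3 * x powr 1)) \<le> exp (- (x powr \<beta>)) / 4"
    using exp_powr_dominates[of 1 "u * c3" \<beta> 1 0] c3 \<beta> by auto
  have Cc2: "Cc\<^sup>2 > 0" using Cc by simp
  obtain X2 where X2: "X2 \<ge> 1" "\<And>x. x \<ge> X2 \<Longrightarrow> Cc\<^sup>2 * x ^ (2 * DIM('a)) * exp (- (1 * x powr \<beta>1)) \<le> exp (- (x powr \<beta>)) / 4"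
    using exp_powr_dominates[OF Cc2 g1(1) \<beta>(1,3), of "2 * DIM('a)"] by blast
  show ?thesis
  proof (rule that[OF \<beta>(1,2), of "max (max 10 D0) (max X1 X2)"])
    show "max (max 10 D0) (max X1 X2) \<ge> 1" by simp
  next
    fix s and x y x' y' :: 'a
    assume s0: "s \<ge> max (max 10 D0) (max X1 X2)" and xy: "s \<le> dist x y"
      and E40: "40 * s \<le> dist x' y'" "dist x' y' \<le> 41 * s" and xx: "dist x x' \<le> 5 * s"
    have s: "s \<ge> 10" "s \<ge> D0" "s \<ge> X1" "s \<ge> X2" "s > 0" using s0 by auto
    define E where "E = dist x' y'"
    have E: "40 * s \<le> E" "E \<le> 41 * s" "0 < E" using E40 s by (auto simp: E_def)
    define f where "f = (y - x) /\<^sub>R dist x y"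
    define g where "g = (y' - x') /\<^sub>R E"
    have unit: "norm (v /\<^sub>R L) = 1" "v = L *\<^sub>R (v /\<^sub>R L)" if "L > 0" "norm v = L" for v :: 'a and L
      using that by auto
    have "dist x y > 0" using xy s by linarith
    then have f: "norm f = 1" "y - x = dist x y *\<^sub>R f"
      unfolding f_def by (intro unit; simp add: dist_norm norm_minus_commute)+
    have g: "norm g = 1" "y' - x' = E *\<^sub>R g"
      unfolding g_def using E by (intro unit; simp add: E_def dist_norm norm_minus_commute)+
    \<comment> \<open>The direction of the third line. It is run from the first segment over the
      length \<open>40 * s\<close>, comparable to the length of the second segment.\<close>
    obtain e0 where e0: "norm e0 = 1" "e0 \<bullet> f = 0" "e0 \<bullet> g = 0" using orthogonal_two_exists[OF dim, of f g] by metis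
    define \<rho> where "\<rho> = s / 10"
    have \<rho>: "1 \<le> \<rho>" "\<rho> \<le> 1 / 60 * (40 * s)" using s by (auto simp: \<rho>_def)
    let ?b = "x + (40 * s) *\<^sub>R e0"
    obtain A where A: "openin line_topology A"
      "ennreal (c0 * \<rho> * (\<rho> / (40 * s)) ^ (DIM('a) - 1)) \<le> emeasure \<mu> A"
      "\<And>l. l \<in> A \<Longrightarrow> \<exists>t\<in>{0..\<rho>}. l \<in> hit (x + t *\<^sub>R f) (1 / 10) \<and> l \<in> hit ?b \<rho>"
      using c0(2)[OF f(1) e0(1) norm_diff_ge_1[OF f(1) e0(1,2)] \<rho>, of x] by auto
    have "\<rho> / (40 * s) = 1 / 400" using s by (simp add: \<rho>_def)
    then have "c0 * \<rho> * (\<rho> / (40 * s)) ^ (DIM('a) - 1) = c3 * s" by (simp add: c3_def \<rho>_def)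
    then have "ennreal (c3 * s) \<le> emeasure \<mu> A" using A(2) by simp
    then have "prob (vac A) \<le> exp (- (u * (c3 * s)))"
      using c3 s by (intro prob_vac_le openin_line_borel A(1)) auto
    also have "\<dots> \<le> exp (- (s powr \<beta>)) / 4" using X1(2)[OF s(3)] s by (simp add: mult.assoc)
    finally have pA: "prob (vac A) \<le> exp (- (s powr \<beta>)) / 4" .
    have "1 \<le> 2 * \<rho>" using \<rho> by simp
    have "\<exists>G. finite G \<and> real (card G) \<le> Cc * s ^ DIM('a) \<and> (\<forall>g\<in>G. dist g q \<le> 3 / 10 * s) \<and>
        (\<forall>l\<in>hit q (2 * \<rho>). \<exists>g\<in>G. l \<in> hit g (1 / 10))" for q :: 'a
    proof -
      obtain G where G: "finite G" "real (card G) \<le> Cc * (2 * \<rho>) ^ DIM('a)" "\<forall>g\<in>G. dist g q \<le> 2 * \<rho> + 1"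
        "\<forall>l\<in>hit q (2 * \<rho>). \<exists>g\<in>G. l \<in> hit g (1 / 10)" using Cc(2)[OF \<open>1 \<le> 2 * \<rho>\<close>, of q] by auto
      have "Cc * (2 * \<rho>) ^ DIM('a) \<le> Cc * s ^ DIM('a)"
        using Cc(1) s by (intro mult_left_mono power_mono) (auto simp: \<rho>_def)
      moreover have "2 * \<rho> + 1 \<le> 3 / 10 * s" using s by (simp add: \<rho>_def)
      ultimately show ?thesis using G by (intro exI[of _ G]) force
    qed
    then obtain G where G: "\<And>q::'a. finite (G q)" "\<And>q. real (card (G q)) \<le> Cc * s ^ DIM('a)"
      "\<And>q g. g \<in> G q \<Longrightarrow> dist g q \<le> 3 / 10 * s"
      "\<And>q l. l \<in> hit q (2 * \<rho>) \<Longrightarrow> \<exists>g\<in>G q. l \<in> hit g (1 / 10)" by metis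
    define I where "I = G x \<times> G ?b"
    have I: "finite I" using G(1) by (simp add: I_def)
    have cI: "real (card I) \<le> Cc\<^sup>2 * s ^ (2 * DIM('a))"
    proof -
      have "real (card I) = real (card (G x)) * real (card (G ?b))" by (simp add: I_def card_cartesian_product)
      also have "\<dots> \<le> (Cc * s ^ DIM('a)) * (Cc * s ^ DIM('a))" using Cc(1) s by (intro mult_mono G(2)) auto
      also have "\<dots> = Cc\<^sup>2 * s ^ (2 * DIM('a))"
      proof -
        have "s ^ (2 * DIM('a)) = s ^ DIM('a) * s ^ DIM('a)" by (simp only: mult_2 power_add)
        then show ?thesis by (simp only: power2_eq_square mult_ac)
      qed
      finally show ?thesis .
    qed
    have W: "\<exists>S. S \<in> events \<and> prob (space P - S) \<le> exp (- (s powr \<beta>1)) \<and>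
        (\<forall>w\<in>S. \<exists>xs L. dist xs x \<le> 203 / 10 * s \<and> L \<le> 598 * s \<and> linked (\<C> w) h1 h2 x' y' xs L)"
      if h: "h1 \<in> G x" "h2 \<in> G ?b" for h1 h2
    proof -
      have hd: "norm (h1 - x) \<le> 3 / 10 * s" "norm (h2 - ?b) \<le> 3 / 10 * s" using G(3) h by (auto simp: dist_norm)
      \<comment> \<open>Both segments are entered at their midpoints, about \<open>20 * s\<close>
        away from their starting points.\<close>
      define xs where "xs = (1 - 1 / 2) *\<^sub>R h1 + (1 / 2) *\<^sub>R h2"
      define ys where "ys = (1 - 1 / 2) *\<^sub>R x' + (1 / 2) *\<^sub>R y'"
      define \<delta> where "\<delta> = (1 - 1 / 2) *\<^sub>R (h1 - x) + (1 / 2) *\<^sub>R (h2 - ?b)"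
      have \<delta>: "norm \<delta> \<le> 3 / 10 * s" unfolding \<delta>_def using norm_combine[OF hd, of "1 / 2"] by simp
      have half: "(1 / 2) *\<^sub>R v + (1 / 2) *\<^sub>R v = v" for v :: 'a by (simp flip: scaleR_add_left)
      have xsx: "xs = x + (20 * s) *\<^sub>R e0 + \<delta>"
        using half[of x] by (simp add: xs_def \<delta>_def algebra_simps)
      have ysx: "ys = x' + (E / 2) *\<^sub>R g"
      proof -
        have y': "y' = x' + E *\<^sub>R g" using g(2) by (simp add: algebra_simps)
        show ?thesis using half[of x'] unfolding ys_def y' by (simp add: algebra_simps)
      qed
      define V where "V = ys - xs"
      have V: "V = (x' - x) + (E / 2) *\<^sub>R g - (20 * s) *\<^sub>R e0 - \<delta>" by (simp add: V_def xsx ysx)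
      have xx': "norm (x' - x) \<le> 5 * s" using xx by (simp add: dist_norm norm_minus_commute)
      have ib: "\<bar>(x' - x) \<bullet> v\<bar> \<le> 5 * s" "\<bar>\<delta> \<bullet> v\<bar> \<le> 3 / 10 * s" if "norm v = 1" for v
        using Cauchy_Schwarz_ineq2[of "x' - x" v] Cauchy_Schwarz_ineq2[of \<delta> v] xx' \<delta> that by auto
      have gg: "g \<bullet> g = 1" "e0 \<bullet> e0 = 1" using g e0 by (simp_all add: norm_eq_1)
      have eg: "g \<bullet> e0 = 0" using e0 by (simp add: inner_commute)
      have Ve: "V \<bullet> e0 = (x' - x) \<bullet> e0 - 20 * s - \<delta> \<bullet> e0" using eg gg by (simp add: V inner_diff_left inner_add_left)
      have Vg: "V \<bullet> g = (x' - x) \<bullet> g + E / 2 - \<delta> \<bullet> g" using e0 gg by (simp add: V inner_diff_left inner_add_left)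
      \<comment> \<open>The connecting vector has components of about \<open>20 * s\<close> along
        each of the orthonormal vectors \<open>e0\<close> and \<open>g\<close>, with an error of at
        most \<open>53 / 10 * s\<close> from \<open>x' - x\<close> and \<delta>, and up to
        \<open>s / 2\<close> from \<open>E\<close>. So it is transversal to both segments.\<close>
      have b1: "\<bar>V \<bullet> e0\<bar> \<le> 26 * s" "14 * s \<le> \<bar>V \<bullet> e0\<bar>" using Ve ib[OF e0(1)] s by linarith+
      have b2: "\<bar>V \<bullet> g\<bar> \<le> 26 * s" "14 * s \<le> \<bar>V \<bullet> g\<bar>" using Vg ib[OF g(1)] s E by linarith+
      define D where "D = norm V"
      have r1: "\<bar>V \<bullet> e0\<bar> \<le> 9 / 10 * D" "14 * s \<le> D"
        unfolding D_def using inner_ratio_le[OF e0(1) g(1) e0(3) b1(1) b2(2) s(5)] by auto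
      have r2: "\<bar>V \<bullet> g\<bar> \<le> 9 / 10 * D"
        unfolding D_def using inner_ratio_le[OF g(1) e0(1) eg b2(1) b1(2) s(5)] by auto
      have Dle: "D \<le> 46 * s"
      proof -
        have "norm V \<le> norm (x' - x) + norm ((E / 2) *\<^sub>R g) + norm ((20 * s) *\<^sub>R e0) + norm \<delta>"
          unfolding V by (smt (verit) norm_triangle_ineq norm_triangle_ineq4)
        then show ?thesis using xx' \<delta> g e0 E s by (simp add: D_def)
      qed
      define e where "e = V /\<^sub>R D"
      have D0: "D > 0" using r1(2) s by linarith
      have e: "norm e = 1" using D0 unfolding e_def D_def by simp
      have ysD: "ys = xs + D *\<^sub>R e" using D0 by (simp add: e_def V_def)
      have ie: "\<bar>e \<bullet> e0\<bar> \<le> 9 / 10" "\<bar>e \<bullet> g\<bar> \<le> 9 / 10"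
        using r1(1) r2 D0 by (auto simp: e_def abs_mult field_simps)
      note n1 = norm_diff_ge_of_inner[OF e e0(1) ie(1)] and n2 = norm_diff_ge_of_inner[OF e g(1) ie(2)]
      have c1: "crossing (1 / 4) e h1 h2 xs (1 / 4 * D)"
        unfolding xs_def
      proof (rule crossing_near[OF e0(1), of "40 * s" _ _ "6 / 10 * s"])
        have eq: "h2 - h1 - (40 * s) *\<^sub>R e0 = (h2 - ?b) - (h1 - x)" by simp
        show "norm (h2 - h1 - (40 * s) *\<^sub>R e0) \<le> 6 / 10 * s"
          unfolding eq using norm_triangle_ineq4[of "h2 - ?b" "h1 - x"] hd by linarith
        have "2 * (6 / 10 * s) / (40 * s) = 3 / 100" using s by simp
        then show "1 / 4 + 2 * (6 / 10 * s) / (40 * s) \<le> norm (e - e0)" "1 / 4 + 2 * (6 / 10 * s) / (40 * s) \<le> norm (e + e0)"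
          using n1 by linarith+
      qed (use Dle s in auto)
      have c2: "crossing (1 / 4) e x' y' ys (1 / 4 * D)"
        unfolding ys_def
        by (rule crossing_near[OF g(1), of E _ _ 0]) (use Dle E g n2 s in auto)
      have Ds: "D \<ge> s" using r1 s by linarith
      have "\<exists>S\<in>events. prob (space P - S) \<le> exp (- (D powr \<beta>1)) \<and>
        (\<forall>w\<in>S. linked (\<C> w) h1 h2 x' y' xs (13 * D))"
        using s Ds by (intro TL[OF _ e ysD c1 c2]) linarith
      then obtain S where S: "S \<in> events" "prob (space P - S) \<le> exp (- (D powr \<beta>1))"
        "\<And>w. w \<in> S \<Longrightarrow> linked (\<C> w) h1 h2 x' y' xs (13 * D)" by blast
      have "s powr \<beta>1 \<le> D powr \<beta>1" using Ds s \<beta>1 by (intro powr_mono2) auto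
      then have "exp (- (D powr \<beta>1)) \<le> exp (- (s powr \<beta>1))" by simp
      then have "prob (space P - S) \<le> exp (- (s powr \<beta>1))" using S(2) by linarith
      moreover have "dist xs x \<le> 203 / 10 * s"
      proof -
        have eq: "xs - x = (20 * s) *\<^sub>R e0 + \<delta>" by (simp add: xsx)
        show ?thesis unfolding dist_norm eq using norm_triangle_ineq[of "(20 * s) *\<^sub>R e0" \<delta>] \<delta> e0 s by simp
      qed
      moreover have "13 * D \<le> 598 * s" using Dle by simp
      ultimately show ?thesis using S(1,3) by blast
    qed
    have "\<forall>q\<in>I. \<exists>S. S \<in> events \<and> prob (space P - S) \<le> exp (- (s powr \<beta>1)) \<and>
        (\<forall>w\<in>S. \<exists>xs L. dist xs x \<le> 203 / 10 * s \<and> L \<le> 598 * s \<and> linked (\<C> w) (fst q) (snd q) x' y' xs L)"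
      using W by (auto simp: I_def)
    from bchoice[OF this] obtain F where F0: "\<forall>q\<in>I. F q \<in> events \<and> prob (space P - F q) \<le> exp (- (s powr \<beta>1)) \<and>
        (\<forall>w\<in>F q. \<exists>xs L. dist xs x \<le> 203 / 10 * s \<and> L \<le> 598 * s \<and> linked (\<C> w) (fst q) (snd q) x' y' xs L)"
      by blast
    have v: "vac A \<in> events" using A(1) by (auto intro: vac_event openin_line_borel)
    define B where "B = (\<Union>q\<in>I. space P - F q)"
    have Bm: "B \<in> events" unfolding B_def using I F0 by (intro sets.finite_UN) auto
    have pB: "prob B \<le> exp (- (s powr \<beta>)) / 4"
    proof -
      have "prob B \<le> (\<Sum>q\<in>I. prob (space P - F q))"
        unfolding B_def using I F0 by (intro measure_UNION_le) auto
      also have "\<dots> \<le> (\<Sum>q\<in>I. exp (- (s powr \<beta>1)))" using F0 by (intro sum_mono) auto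
      also have "\<dots> = real (card I) * exp (- (s powr \<beta>1))" by simp
      also have "\<dots> \<le> Cc\<^sup>2 * s ^ (2 * DIM('a)) * exp (- (s powr \<beta>1))" using cI by (intro mult_right_mono) auto
      also have "\<dots> \<le> exp (- (s powr \<beta>)) / 4" using X2(2)[OF s(4)] by simp
      finally show ?thesis .
    qed
    define T where "T = space P - (vac A \<union> B)"
    have "T \<in> events" unfolding T_def using v Bm by auto
    moreover have "prob (space P - T) \<le> exp (- (s powr \<beta>))"
    proof -
      have "space P - T = vac A \<union> B"
        unfolding T_def using v Bm sets.sets_into_space[of _ P] by blast
      then have "prob (space P - T) \<le> prob (vac A) + prob B" using measure_Un_le[OF v Bm] by simp
      then show ?thesis using pA pB exp_gt_zero[of "- (s powr \<beta>)"] by linarith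
    qed
    moreover have "linked (\<C> w) x y x' y' x (2000 * s)" if wT: "w \<in> T" for w
    proof -
      have o: "w \<in> occ A" "w \<in> space P" "w \<notin> B" using wT by (auto simp: T_def occ_def)
      obtain m where m: "m \<in> line_support (\<omega> w)" "m \<in> A" using occ_line[OF o(1) openin_line_borel[OF A(1)]] by blast
      obtain t where t: "t \<in> {0..\<rho>}" "m \<in> hit (x + t *\<^sub>R f) (1 / 10)" "m \<in> hit ?b \<rho>" using A(3)[OF m(2)] by blast
      have m1: "m \<in> hit x (2 * \<rho>)"
        using t \<rho> f hit_mono[of "x + t *\<^sub>R f" x "1 / 10" "2 * \<rho>"] by (auto simp: dist_norm)
      have m2: "m \<in> hit ?b (2 * \<rho>)" using t(3) \<rho> hit_mono[of ?b ?b \<rho> "2 * \<rho>"] by auto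
      obtain h1 where h1: "h1 \<in> G x" "m \<in> hit h1 (1 / 10)" using G(4)[OF m1] by blast
      obtain h2 where h2: "h2 \<in> G ?b" "m \<in> hit h2 (1 / 10)" using G(4)[OF m2] by blast
      have q: "(h1, h2) \<in> I" using h1 h2 by (simp add: I_def)
      then have "w \<in> F (h1, h2)" using o(2,3) by (auto simp: B_def)
      then obtain xs L where L: "dist xs x \<le> 203 / 10 * s" "L \<le> 598 * s" "linked (\<C> w) h1 h2 x' y' xs L"
        using F0 q by fastforce
      have seg: "x + t *\<^sub>R f \<in> closed_segment x y"
      proof -
        have "t \<le> dist x y" using t(1) xy s by (simp add: \<rho>_def)
        moreover have "dist x y > 0" using xy s by linarith
        moreover have "x + t *\<^sub>R f = (1 - t / dist x y) *\<^sub>R x + (t / dist x y) *\<^sub>R y"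
        proof -
          have y: "y = x + dist x y *\<^sub>R f" using f(2) by (simp add: algebra_simps)
          have "(1 - t / dist x y) *\<^sub>R x + (t / dist x y) *\<^sub>R (x + dist x y *\<^sub>R f) = x + t *\<^sub>R f"
            using \<open>dist x y > 0\<close> by (simp add: algebra_simps)
          then show ?thesis using y by simp
        qed
        ultimately show ?thesis
          unfolding closed_segment_def using t(1) by (auto intro!: exI[of _ "t / dist x y"])
      qed
      have "dist (x + t *\<^sub>R f) x \<le> s" using t(1) f s by (simp add: dist_norm \<rho>_def)
      then have "dist (x + t *\<^sub>R f) xs + L + 1 \<le> 620 * s"
        \<comment> \<open>Sliding along \<open>f\<close>, the distance to the midpoint, the link
          length \<open>13 * 46 * s\<close> and the 1 add up to at most \<open>620 * s\<close>;
          tripling by \<open>linked_glue_left\<close> and recentring at \<open>x\<close> stay below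
          \<open>2000 * s\<close>.\<close>
        using L dist_triangle[of "x + t *\<^sub>R f" xs x] s by (simp add: dist_commute)
      then have "linked (\<C> w) x y x' y' xs (3 * (620 * s))"
        using h1 h2 by (intro linked_glue_left[OF L(3) _ t(2) cyl_subset[OF m(1)] seg]) auto
      then show ?thesis by (rule linked_mono) (use L(1) s in linarith)
    qed
    ultimately show "\<exists>S\<in>events. prob (space P - S) \<le> exp (- (s powr \<beta>)) \<and>
        (\<forall>w\<in>S. linked (\<C> w) x y x' y' x (2000 * s))" by blast
  qed
qed

end


section \<open>The internal distance is almost the Euclidean distance\<close>

text \<open>Passes from finitely many grid segments to all pairs of lines meeting a common ball:
  each line is represented by two of its points, replaced by nearby grid points.\<close>

lemma linked_of_grid:
  fixes C :: "'a::euclidean_space set"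
  assumes grid: "\<And>y. y \<in> cball 0 Q \<Longrightarrow> \<exists>g\<in>G. dist g y < 1 / 10"
    and L: "\<And>x y x' y'. x \<in> G \<Longrightarrow> y \<in> G \<Longrightarrow> x' \<in> G \<Longrightarrow> y' \<in> G \<Longrightarrow> s \<le> dist x y \<Longrightarrow> 40 * s \<le> dist x' y' \<Longrightarrow>
      dist x' y' \<le> 41 * s \<Longrightarrow> dist x x' \<le> 5 * s \<Longrightarrow> linked C x y x' y' x (2000 * s)"
    and s: "s \<ge> 1" and z: "norm z + 42 * s \<le> Q"
    and p: "p \<in> hit z s" "cyl p \<subseteq> C" and q: "q \<in> hit z s" "cyl q \<subseteq> C"
  shows "\<exists>a\<in>p. \<exists>b\<in>q. dist a z \<le> 2002 * s \<and> dist b z \<le> 2002 * s \<and> path_le C a b (2002 * s)"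
proof -
  obtain a0 where a0: "p \<in> lines" "a0 \<in> p" "dist z a0 < s" using p(1) by (rule hitE)
  obtain b0 where b0: "q \<in> lines" "b0 \<in> q" "dist z b0 < s" using q(1) by (rule hitE)
  obtain u where u: "dirn p u" using dirn_exists[OF a0(1)] by blast
  obtain v where v: "dirn q v" using dirn_exists[OF b0(1)] by blast
  \<comment> \<open>Lengths \<open>3 / 2 * s\<close> and \<open>81 / 2 * s\<close> lie in the
    interior of the ranges required of the grid segments, so moving the ends by 1/10 is
    harmless.\<close>
  define a1 where "a1 = a0 + (3 / 2 * s) *\<^sub>R u"
  define b1 where "b1 = b0 + (81 / 2 * s) *\<^sub>R v"
  have m: "a1 \<in> p" "b1 \<in> q" using dirn_mem[OF u a0(2)] dirn_mem[OF v b0(2)] by (auto simp: a1_def b1_def)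
  have d: "dist a0 a1 = 3 / 2 * s" "dist b0 b1 = 81 / 2 * s"
    using dirn_norm[OF u] dirn_norm[OF v] s by (auto simp: a1_def b1_def dist_norm)
  have nz: "norm y \<le> norm z + dist z y" for y using norm_triangle_sub[of y z] by (simp add: dist_norm norm_minus_commute)
  have "norm a0 \<le> Q" "norm b0 \<le> Q" "norm a1 \<le> Q" "norm b1 \<le> Q"
    using nz[of a0] nz[of b0] nz[of a1] nz[of b1] dist_triangle[of z a1 a0] dist_triangle[of z b1 b0] a0(3) b0(3) d z s by linarith+
  then obtain x y x' y' where g: "x \<in> G" "dist x a0 < 1 / 10" "y \<in> G" "dist y a1 < 1 / 10"
    "x' \<in> G" "dist x' b0 < 1 / 10" "y' \<in> G" "dist y' b1 < 1 / 10"
    using grid[of a0] grid[of b0] grid[of a1] grid[of b1] by auto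
  have "dist a0 a1 \<le> dist x a0 + dist x y + dist y a1"
    using dist_triangle[of a0 a1 x] dist_triangle[of x a1 y] by (simp add: dist_commute)
  then have c1: "s \<le> dist x y" using g d s by linarith
  have "dist b0 b1 \<le> dist x' b0 + dist x' y' + dist y' b1"
    using dist_triangle[of b0 b1 x'] dist_triangle[of x' b1 y'] by (simp add: dist_commute)
  then have c2: "40 * s \<le> dist x' y'" using g d s by linarith
  have "dist x' y' \<le> dist x' b0 + dist b0 b1 + dist y' b1"
    using dist_triangle[of x' y' b0] dist_triangle[of b0 y' b1] by (simp add: dist_commute)
  then have c3: "dist x' y' \<le> 41 * s" using g d s by linarith
  have "dist x x' \<le> dist x a0 + dist z a0 + dist z b0 + dist x' b0"
    using dist_triangle[of x x' a0] dist_triangle[of a0 x' z] dist_triangle[of z x' b0] by (simp add: dist_commute)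
  then have c4: "dist x x' \<le> 5 * s" using g a0 b0 s by linarith
  have "dist x z + 2000 * s \<le> 2002 * s"
    using dist_triangle[of x z a0] g a0 s by (simp add: dist_commute)
  from linked_mono[OF L[OF g(1,3,5,7) c1 c2 c3 c4] this]
  have "linked C x y x' y' z (2002 * s)" .
  moreover have "p \<in> hit x (1 / 10) \<inter> hit y (1 / 10)" "q \<in> hit x' (1 / 10) \<inter> hit y' (1 / 10)"
    using g a0 b0 m by (auto intro: hitI)
  ultimately show ?thesis using p q unfolding linked_def by blast
qed

lemma path_le_near_line:
  assumes "l \<in> lines" "cyl l \<subseteq> C" "c \<in> l" "dist x c \<le> 1" "a \<in> l" "dist x a \<le> M"
  shows "path_le C x a (M + 2)" "path_le C a x (M + 2)"
proof -
  have "dist c a \<le> M + 1" using assms dist_triangle[of c a x] by (simp add: dist_commute)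
  then have 1: "path_le C c a (M + 1)" "path_le C a c (M + 1)"
    using assms by (auto intro: path_le_line simp: dist_commute)
  have 2: "path_le C c x 1" "path_le C x c 1"
    using path_le_radius[OF assms(2,3), of x] assms(4) by (auto simp: dist_commute)
  show "path_le C x a (M + 2)" using path_le_trans[OF 2(2) 1(1)] by (simp add: algebra_simps)
  show "path_le C a x (M + 2)" using path_le_trans[OF 1(2) 2(1)] by (simp add: algebra_simps)
qed

lemma path_le_join_near:
  fixes C :: "'a::euclidean_space set"
  assumes p: "p \<in> lines" "cyl p \<subseteq> C" "c \<in> p" "norm c \<le> 1"
    and q: "q \<in> lines" "cyl q \<subseteq> C" "c' \<in> q" "dist x c' \<le> 1"
    and ab: "a \<in> p" "b \<in> q" "norm a \<le> M" "norm b \<le> M" "path_le C a b M" and M: "M \<ge> 1"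
  shows "path_le C 0 x (norm x + 10 * M)"
proof -
  have "path_le C 0 a (M + 2)" using path_le_near_line(1)[OF p(1-3) _ ab(1)] p(4) ab(3) by simp
  moreover have "dist x b \<le> norm x + M" using norm_triangle_ineq4[of x b] ab(4) by (simp add: dist_norm)
  then have "path_le C b x ((norm x + M) + 2)" using path_le_near_line(2)[OF q ab(2)] by simp
  ultimately have "path_le C 0 x ((M + 2) + M + ((norm x + M) + 2))" using ab(5) path_le_trans by blast
  then show ?thesis by (rule path_le_mono) (use M in linarith)
qed

text \<open>Only the stretch along \<open>m\<close> is long, at most \<open>norm x + 2 * M\<close>;
  every other piece is bounded by \<open>M\<close> up to a constant.\<close>

lemma path_le_join_far:
  fixes C :: "'a::euclidean_space set"
  assumes p: "p \<in> lines" "cyl p \<subseteq> C" "c \<in> p" "norm c \<le> 1"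
    and q: "q \<in> lines" "cyl q \<subseteq> C" "c' \<in> q" "dist x c' \<le> 1"
    and m: "m \<in> lines" "cyl m \<subseteq> C"
    and ab: "a \<in> p" "b \<in> m" "norm a \<le> M" "norm b \<le> M" "path_le C a b M"
    and ab': "a' \<in> m" "b' \<in> q" "dist a' x \<le> M" "dist b' x \<le> M" "path_le C a' b' M" and M: "M \<ge> 1"
  shows "path_le C 0 x (norm x + 10 * M)"
proof -
  have "path_le C 0 a (M + 2)" using path_le_near_line(1)[OF p(1-3) _ ab(1)] p(4) ab(3) by simp
  moreover have "path_le C b a' (norm x + 2 * M)"
  proof (rule path_le_line[OF m ab(2) ab'(1)])
    have "dist b a' \<le> norm b + norm x + dist a' x"
      using dist_triangle[of b a' 0] norm_triangle_sub[of a' x] by (simp add: dist_norm)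
    then show "dist b a' \<le> norm x + 2 * M" using ab ab' by linarith
  qed
  moreover have "path_le C b' x (M + 2)"
    using path_le_near_line(2)[OF q ab'(2)] ab'(4) by (simp add: dist_commute)
  ultimately have "path_le C 0 x ((M + 2) + M + (norm x + 2 * M) + M + (M + 2))"
    using ab(5) ab'(5) path_le_trans by blast
  then show ?thesis by (rule path_le_mono) (use M in linarith)
qed

section \<open>Union bound at one scale, and the Borel--Cantelli argument\<close>

context poisson_lines
begin

text \<open>Two kinds of failure are excluded: some admissible quadruple of grid points is not
  linked (\<open>B1\<close>), or no line joins the balls of radius \<open>r\<close> around 0 and
  some distant grid point (\<open>B2\<close>). Outside both, everything is deterministic and holds
  for all \<open>x\<close> simultaneously.\<close>

lemma good_scale:
  assumes dim: "DIM('a) \<ge> 3" and b: "1 / 2 < b" "b < 1"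
  obtains n0 :: nat where "n0 \<ge> 1"
    "\<And>n. n \<ge> n0 \<Longrightarrow> \<exists>F\<in>events. prob (space P - F) \<le> 1 / real n ^ 2 \<and>
      (\<forall>w\<in>F. \<forall>x. 0 \<in> \<C> w \<longrightarrow> x \<in> \<C> w \<longrightarrow> norm x \<le> real n \<longrightarrow>
         path_le (\<C> w) 0 x (norm x + 300000 * real n powr b))"
proof -
  obtain \<beta> s0 where \<beta>: "0 < \<beta>" "\<beta> < 1" "s0 \<ge> 1"
    and LL: "\<And>s x y x' y'. s \<ge> s0 \<Longrightarrow> s \<le> dist x y \<Longrightarrow> 40 * s \<le> dist x' y' \<Longrightarrow> dist x' y' \<le> 41 * s \<Longrightarrow> dist x x' \<le> 5 * s \<Longrightarrow>
      \<exists>S\<in>events. prob (space P - S) \<le> exp (- (s powr \<beta>)) \<and>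
        (\<forall>w\<in>S. linked (\<C> w) x y x' y' x (2000 * s))"
    by (rule link_lines[OF dim]) (rule that; assumption)
  obtain c where c: "c > 0"
    "\<And>r D x y. 4 \<le> r \<Longrightarrow> r \<le> D \<Longrightarrow> dist x y = D \<Longrightarrow>
      ennreal (c * (r\<^sup>2 / D) ^ (DIM('a) - 1)) \<le> emeasure \<mu> (hit x r \<inter> hit y r)"
    using fat_hit_bound by metis
  obtain Cg where Cg: "Cg > 0"
    "\<And>(x::'a) R. R \<ge> 1 \<Longrightarrow> \<exists>G. finite G \<and> real (card G) \<le> Cg * R ^ DIM('a) \<and>
      (\<forall>y\<in>cball x R. \<exists>g\<in>G. dist g y < 1 / 10)"
    using ball_cover[where 'a = 'a] by metis
  define C1 where "C1 = Cg * 100 ^ DIM('a)"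
  have C1: "C1 > 0" "C1 ^ 4 > 0" using Cg by (auto simp: C1_def)
  have \<alpha>: "0 < b * \<beta> / 2" "b * \<beta> / 2 < b * \<beta>" "0 < (2 * b - 1) / 2" "(2 * b - 1) / 2 < 2 * b - 1"
    using b \<beta> by auto
  have uc: "u * (c / 2) > 0" using u c by simp
  obtain X1 where X1: "X1 \<ge> 1" "\<And>x. x \<ge> X1 \<Longrightarrow> C1 ^ 4 * x ^ (4 * DIM('a) + 2) * exp (- (1 * x powr (b * \<beta>))) \<le> exp (- (x powr (b * \<beta> / 2))) / 4"
    using exp_powr_dominates[OF C1(2) zero_less_one \<alpha>(1,2), of "4 * DIM('a) + 2"] by blast
  obtain X2 where X2: "X2 \<ge> 1" "\<And>x. x \<ge> X2 \<Longrightarrow> C1 * x ^ (DIM('a) + 2) * exp (- (u * (c / 2) * x powr (2 * b - 1))) \<le> exp (- (x powr ((2 * b - 1) / 2))) / 4"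
    using exp_powr_dominates[OF C1(1) uc \<alpha>(3,4), of "DIM('a) + 2"] by blast
  \<comment> \<open>The entries ensure, in turn, the two exponential bounds,
    \<open>r \<ge> s0\<close>, \<open>r \<ge> 4\<close>, \<open>12 * r \<le> x\<close> and
    \<open>x powr (2 * b - 1) \<ge> 2\<close>.\<close>
  define X where "X = max (max X1 X2) (max (max (s0 powr (1 / b)) (4 powr (1 / b))) (max ((1 / 12) powr (- 1 / (1 - b))) (2 powr (1 / (2 * b - 1)))))"
  define n0 where "n0 = nat \<lceil>max 1 X\<rceil>"
  show ?thesis
  proof (rule that[of n0])
    show "n0 \<ge> 1" by (simp add: n0_def nat_le_eq_zle le_ceiling_iff Suc_le_eq)
  next
    fix n :: nat assume n: "n \<ge> n0"
    define x where "x = real n"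
    have "max 1 X \<le> x" using n unfolding n0_def x_def by linarith
    then have x: "x \<ge> 1" "x > 0" "x \<ge> X1" "x \<ge> X2" "x \<ge> s0 powr (1 / b)" "x \<ge> 4 powr (1 / b)"
      "x \<ge> (1 / 12) powr (- 1 / (1 - b))" "x \<ge> 2 powr (1 / (2 * b - 1))"
      unfolding X_def by auto
    define r where "r = x powr b"
    have r4: "r \<ge> 4" unfolding r_def using x b by (intro powr_ge_const) auto
    have rs0: "r \<ge> s0" unfolding r_def using x b \<beta> by (intro powr_ge_const) auto
    have rx: "12 * r \<le> x" using powr_le_linear[of b "1 / 12" x] x b by (simp add: r_def)
    \<comment> \<open>Large enough that for \<open>norm y < 9 * r\<close> the line covering
      \<open>y\<close> also meets \<open>ball 0 s\<close>, which settles nearby points without a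
      long line.\<close>
    define s where "s = 12 * r"
    have s: "s \<ge> s0" "s \<ge> 1" "s > 0" using r4 rs0 by (auto simp: s_def)
    \<comment> \<open>The radius leaves room for the auxiliary points of
      \<open>linked_of_grid\<close>, at most \<open>42 * s \<le> 42 * x\<close> away from a point of
      norm at most \<open>x\<close>.\<close>
    have "100 * x \<ge> 1" using x by simp
    then obtain G :: "'a set" where G: "finite G" "real (card G) \<le> Cg * (100 * x) ^ DIM('a)"
      "\<And>y. y \<in> cball 0 (100 * x) \<Longrightarrow> \<exists>g\<in>G. dist g y < 1 / 10" using Cg(2)[of "100 * x" 0] by blast
    have cG: "real (card G) \<le> C1 * x ^ DIM('a)" using G(2) by (simp add: C1_def power_mult_distrib mult.assoc)
    define J where "J = {(y1, y2, y3, y4). (y1, y2, y3, y4) \<in> G \<times> G \<times> G \<times> G \<and>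
      s \<le> dist y1 y2 \<and> 40 * s \<le> dist y3 y4 \<and> dist y3 y4 \<le> 41 * s \<and> dist y1 y3 \<le> 5 * s}"
    have JG: "J \<subseteq> G \<times> G \<times> G \<times> G" by (auto simp: J_def)
    have J: "finite J" using finite_subset[OF JG] G(1) by simp
    have cJ: "real (card J) \<le> C1 ^ 4 * x ^ (4 * DIM('a))"
    proof -
      have "card J \<le> card (G \<times> G \<times> G \<times> G)" using JG G(1) by (intro card_mono) auto
      then have "real (card J) \<le> real (card G) * (real (card G) * (real (card G) * real (card G)))"
        by (simp add: card_cartesian_product flip: of_nat_mult)
      also have "\<dots> \<le> (C1 * x ^ DIM('a)) * ((C1 * x ^ DIM('a)) * ((C1 * x ^ DIM('a)) * (C1 * x ^ DIM('a))))"
        using cG C1 x by (intro mult_mono) auto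
      also have "\<dots> = C1 ^ 4 * x ^ (4 * DIM('a))"
      proof -
        have "x ^ (4 * DIM('a)) = (x ^ DIM('a)) ^ 4" by (simp add: power_mult[symmetric] mult.commute)
        then show ?thesis by (simp add: power4_eq_xxxx mult_ac)
      qed
      finally show ?thesis .
    qed
    have "\<forall>q\<in>J. \<exists>S. S \<in> events \<and> prob (space P - S) \<le> exp (- (s powr \<beta>)) \<and>
        (\<forall>w\<in>S. linked (\<C> w) (fst q) (fst (snd q)) (fst (snd (snd q))) (snd (snd (snd q))) (fst q) (2000 * s))"
    proof
      fix q assume q: "q \<in> J"
      obtain y1 y2 y3 y4 where "q = (y1, y2, y3, y4)" by (rule prod_cases4)
      then show "\<exists>S. S \<in> events \<and> prob (space P - S) \<le> exp (- (s powr \<beta>)) \<and>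
        (\<forall>w\<in>S. linked (\<C> w) (fst q) (fst (snd q)) (fst (snd (snd q))) (snd (snd (snd q))) (fst q) (2000 * s))"
        using LL[OF s(1), of y1 y2 y3 y4] q by (auto simp: J_def)
    qed
    from bchoice[OF this] obtain S where S: "\<forall>q\<in>J. S q \<in> events \<and> prob (space P - S q) \<le> exp (- (s powr \<beta>)) \<and>
        (\<forall>w\<in>S q. linked (\<C> w) (fst q) (fst (snd q)) (fst (snd (snd q))) (snd (snd (snd q))) (fst q) (2000 * s))"
      by blast
    define B1 where "B1 = (\<Union>q\<in>J. space P - S q)"
    have B1: "B1 \<in> events" unfolding B1_def using J S by (intro sets.finite_UN) auto
    have x2: "x\<^sup>2 > 0" using x by simp
    have pB1: "prob B1 \<le> 1 / x\<^sup>2 / 4"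
    proof -
      have "prob B1 \<le> (\<Sum>q\<in>J. prob (space P - S q))"
        unfolding B1_def using J S by (intro measure_UNION_le) auto
      also have "\<dots> \<le> (\<Sum>q\<in>J. exp (- (s powr \<beta>)))" using S by (intro sum_mono) auto
      also have "\<dots> = real (card J) * exp (- (s powr \<beta>))" by simp
      also have "\<dots> \<le> (C1 ^ 4 * x ^ (4 * DIM('a))) * exp (- (1 * x powr (b * \<beta>)))"
      proof (intro mult_mono cJ)
        have "x powr (b * \<beta>) = r powr \<beta>" by (simp add: r_def powr_powr)
        also have "\<dots> \<le> s powr \<beta>" using r4 \<beta> by (intro powr_mono2) (auto simp: s_def)
        finally show "exp (- (s powr \<beta>)) \<le> exp (- (1 * x powr (b * \<beta>)))" by simp
      qed (use C1 x in auto)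
      \<comment> \<open>Multiplying by \<open>x\<^sup>2\<close> accounts for the \<open>+ 2\<close>
        in the degree used for \<open>X1\<close>; the resulting bound on \<open>prob B1\<close> is
        summable in \<open>n\<close>.\<close>
      finally have "prob B1 * x\<^sup>2 \<le> (C1 ^ 4 * x ^ (4 * DIM('a))) * exp (- (1 * x powr (b * \<beta>))) * x\<^sup>2"
        using x2 by (intro mult_right_mono) auto
      also have "\<dots> = C1 ^ 4 * x ^ (4 * DIM('a) + 2) * exp (- (1 * x powr (b * \<beta>)))"
        by (simp only: power_add mult_ac)
      also have "\<dots> \<le> exp (- (x powr (b * \<beta> / 2))) / 4" by (rule X1(2)[OF x(3)])
      also have "\<dots> \<le> 1 / 4" by simp
      finally show ?thesis using x2 by (simp add: field_simps)
    qed
    define H where "H g = hit 0 r \<inter> hit g r" for g :: 'a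
    define K where "K = {g \<in> G. 8 * r \<le> norm g \<and> norm g \<le> 2 * x}"
    have K: "finite K" using G(1) by (simp add: K_def)
    have Hm: "H g \<in> sets line_borel" for g unfolding H_def by (intro sets.Int hit_in_line_borel)
    define B2 where "B2 = (\<Union>g\<in>K. vac (H g))"
    have B2: "B2 \<in> events" unfolding B2_def using K vac_event[OF Hm] by (intro sets.finite_UN) auto
    have vH: "prob (vac (H g)) \<le> exp (- (u * (c / 2) * x powr (2 * b - 1)))" if g: "g \<in> K" for g
    proof -
      have gn: "8 * r \<le> norm g" "norm g \<le> 2 * x" using g by (auto simp: K_def)
      \<comment> \<open>A lower bound for \<open>r\<^sup>2 / norm g\<close>, growing because b >
        1/2. As \<open>Y \<ge> 1\<close>, the power \<open>d - 1\<close> only improves it, so a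
        bound linear in \<open>Y\<close> is enough.\<close>
      define Y where "Y = x powr (2 * b - 1) / 2"
      have "x powr (2 * b - 1) \<ge> 2" using x b by (intro powr_ge_const) auto
      then have Y1: "Y \<ge> 1" by (simp add: Y_def)
      have "Y = r\<^sup>2 / (2 * x)"
        using x by (simp add: Y_def r_def powr_diff power2_eq_square flip: powr_add)
      also have "\<dots> \<le> r\<^sup>2 / norm g" using gn r4 by (intro divide_left_mono mult_pos_pos) auto
      finally have Y: "Y \<le> r\<^sup>2 / norm g" .
      have "Y = Y ^ 1" by simp
      also have "\<dots> \<le> Y ^ (DIM('a) - 1)" using Y1 dim by (intro power_increasing) auto
      also have "\<dots> \<le> (r\<^sup>2 / norm g) ^ (DIM('a) - 1)" using Y Y1 by (intro power_mono) auto
      finally have "c * Y \<le> c * (r\<^sup>2 / norm g) ^ (DIM('a) - 1)" using c by (intro mult_left_mono) auto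
      then have "ennreal (c * Y) \<le> ennreal (c * (r\<^sup>2 / norm g) ^ (DIM('a) - 1))" by (rule ennreal_leI)
      also have "\<dots> \<le> emeasure \<mu> (H g)" unfolding H_def using gn r4 by (intro c(2)) auto
      finally have "prob (vac (H g)) \<le> exp (- (u * (c * Y)))" using c Y1 by (intro prob_vac_le Hm) auto
      then show ?thesis by (simp add: Y_def mult_ac)
    qed
    have pB2: "prob B2 \<le> 1 / x\<^sup>2 / 4"
    proof -
      have "prob B2 \<le> (\<Sum>g\<in>K. prob (vac (H g)))"
        unfolding B2_def using K vac_event[OF Hm] by (intro measure_UNION_le) auto
      also have "\<dots> \<le> (\<Sum>g\<in>K. exp (- (u * (c / 2) * x powr (2 * b - 1))))" by (intro sum_mono vH)
      also have "\<dots> = real (card K) * exp (- (u * (c / 2) * x powr (2 * b - 1)))" by simp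
      also have "\<dots> \<le> (C1 * x ^ DIM('a)) * exp (- (u * (c / 2) * x powr (2 * b - 1)))"
      proof (rule mult_right_mono)
        have "card K \<le> card G" using G(1) by (intro card_mono) (auto simp: K_def)
        then show "real (card K) \<le> C1 * x ^ DIM('a)" using cG by linarith
      qed simp
      finally have "prob B2 * x\<^sup>2 \<le> (C1 * x ^ DIM('a)) * exp (- (u * (c / 2) * x powr (2 * b - 1))) * x\<^sup>2"
        using x2 by (intro mult_right_mono) auto
      also have "\<dots> = C1 * x ^ (DIM('a) + 2) * exp (- (u * (c / 2) * x powr (2 * b - 1)))"
        by (simp only: power_add mult_ac)
      also have "\<dots> \<le> exp (- (x powr ((2 * b - 1) / 2))) / 4" by (rule X2(2)[OF x(4)])
      also have "\<dots> \<le> 1 / 4" by simp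
      finally show ?thesis using x2 by (simp add: field_simps)
    qed
    define F where "F = space P - (B1 \<union> B2)"
    have "F \<in> events" unfolding F_def using B1 B2 by auto
    moreover have "prob (space P - F) \<le> 1 / x\<^sup>2"
    proof -
      have "space P - F = B1 \<union> B2"
        unfolding F_def using B1 B2 sets.sets_into_space[of _ P] by blast
      then have "prob (space P - F) \<le> prob B1 + prob B2" using measure_Un_le[OF B1 B2] by simp
      moreover have "0 \<le> 1 / x\<^sup>2" by simp
      ultimately show ?thesis using pB1 pB2 by linarith
    qed
    moreover have "path_le (\<C> w) 0 y (norm y + 300000 * r)"
      if w: "w \<in> F" and y0: "0 \<in> \<C> w" and y: "y \<in> \<C> w" "norm y \<le> x" for w y
    proof -
      have ws: "w \<in> space P" "w \<notin> B1" "w \<notin> B2" using w by (auto simp: F_def)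
      let ?C = "\<C> w"
      have Lg: "linked ?C y1 y2 y3 y4 y1 (2000 * s)"
        if "y1 \<in> G" "y2 \<in> G" "y3 \<in> G" "y4 \<in> G" "s \<le> dist y1 y2" "40 * s \<le> dist y3 y4" "dist y3 y4 \<le> 41 * s" "dist y1 y3 \<le> 5 * s"
        for y1 y2 y3 y4
      proof -
        have q: "(y1, y2, y3, y4) \<in> J" using that by (simp add: J_def)
        then have "w \<in> S (y1, y2, y3, y4)" using ws by (auto simp: B1_def)
        then show ?thesis using S q by fastforce
      qed
      have rng: "norm z + 42 * s \<le> 100 * x" if "norm z \<le> x" for z :: 'a
        using that rx x by (simp add: s_def)
      have link: "\<exists>a\<in>p. \<exists>b\<in>q. dist a z \<le> 2002 * s \<and> dist b z \<le> 2002 * s \<and> path_le ?C a b (2002 * s)"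
        if "norm z \<le> x" "p \<in> hit z s" "cyl p \<subseteq> ?C" "q \<in> hit z s" "cyl q \<subseteq> ?C" for z p q
      proof (rule linked_of_grid)
        show "\<exists>g\<in>G. dist g y < 1 / 10" if "y \<in> cball 0 (100 * x)" for y using that by (rule G(3))
        show "linked ?C y1 y2 y3 y4 y1 (2000 * s)"
          if "y1 \<in> G" "y2 \<in> G" "y3 \<in> G" "y4 \<in> G" "s \<le> dist y1 y2" "40 * s \<le> dist y3 y4" "dist y3 y4 \<le> 41 * s" "dist y1 y3 \<le> 5 * s"
          for y1 y2 y3 y4 using that by (rule Lg)
        show "norm z + 42 * s \<le> 100 * x" using that(1) by (rule rng)
      qed (use s(2) that in auto)
      obtain p cp where p: "p \<in> line_support (\<omega> w)" "cp \<in> p" "norm cp \<le> 1"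
        using y0 unfolding cylinder_set_mem_iff by auto
      obtain q cq where q: "q \<in> line_support (\<omega> w)" "cq \<in> q" "dist y cq \<le> 1"
        using y(1) unfolding cylinder_set_mem_iff by auto
      have pl: "p \<in> lines" "cyl p \<subseteq> ?C" "q \<in> lines" "cyl q \<subseteq> ?C"
        using p q line_support_lines cyl_subset by blast+
      have ps: "p \<in> hit 0 s" using p pl r4 by (intro hitI[of _ cp]) (auto simp: s_def)
      have "2002 * s \<ge> 1" using s by simp
      have x0: "norm (0::'a) \<le> x" using x by simp
      \<comment> \<open>The constant 300000 exceeds \<open>10 * 2002 * 12\<close>.\<close>
      have fin: "norm y + 10 * (2002 * s) \<le> norm y + 300000 * r" using r4 by (simp add: s_def)
      show ?thesis
      proof (cases "norm y < 9 * r")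
        case True
        have "norm cq \<le> norm y + dist y cq" using norm_triangle_sub[of cq y] by (simp add: dist_norm norm_minus_commute)
        then have qs: "q \<in> hit 0 s" using q pl r4 True by (intro hitI[of _ cq]) (auto simp: s_def)
        obtain a b where "a \<in> p" "b \<in> q" "dist a 0 \<le> 2002 * s" "dist b 0 \<le> 2002 * s" "path_le ?C a b (2002 * s)"
          using link[OF x0 ps pl(2) qs pl(4)] by blast
        then have "path_le ?C 0 y (norm y + 10 * (2002 * s))"
          using p q pl \<open>2002 * s \<ge> 1\<close> by (intro path_le_join_near[of p _ cp q cq y a b]) auto
        then show ?thesis by (rule path_le_mono) (rule fin)
      next
        case False
        have "y \<in> cball 0 (100 * x)" using y x by simp
        then obtain g where g: "g \<in> G" "dist g y < 1 / 10" using G(3) by blast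
        have "norm g \<le> norm y + dist g y" "norm y \<le> norm g + dist g y"
          using norm_triangle_sub[of g y] norm_triangle_sub[of y g] by (auto simp: dist_norm norm_minus_commute)
        then have gK: "g \<in> K" using g False y x r4 by (auto simp: K_def)
        then have "w \<in> occ (H g)" using ws by (auto simp: B2_def occ_def)
        then obtain m where m: "m \<in> line_support (\<omega> w)" "m \<in> H g" using occ_line[OF _ Hm] by blast
        have ml: "m \<in> lines" "cyl m \<subseteq> ?C" using m line_support_lines cyl_subset by blast+
        have m0: "m \<in> hit 0 s" using m(2) hit_mono[of 0 0 r s] r4 by (auto simp: H_def s_def)
        have my: "m \<in> hit y s" using m(2) hit_mono[of g y r s] g r4 by (auto simp: H_def s_def)
        have qs: "q \<in> hit y s" using q pl r4 by (intro hitI[of _ cq]) (auto simp: s_def)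
        obtain a b where ab: "a \<in> p" "b \<in> m" "dist a 0 \<le> 2002 * s" "dist b 0 \<le> 2002 * s" "path_le ?C a b (2002 * s)"
          using link[OF x0 ps pl(2) m0 ml(2)] by blast
        obtain a' b' where ab': "a' \<in> m" "b' \<in> q" "dist a' y \<le> 2002 * s" "dist b' y \<le> 2002 * s" "path_le ?C a' b' (2002 * s)"
          using link[OF y(2) my ml(2) qs pl(4)] by blast
        have "path_le ?C 0 y (norm y + 10 * (2002 * s))"
          using p q pl ml ab ab' \<open>2002 * s \<ge> 1\<close> by (intro path_le_join_far[of p _ cp q cq y m a b _ a' b']) auto
        then show ?thesis by (rule path_le_mono) (rule fin)
      qed
    qed
    ultimately show "\<exists>F\<in>events. prob (space P - F) \<le> 1 / real n ^ 2 \<and>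
      (\<forall>w\<in>F. \<forall>x. 0 \<in> \<C> w \<longrightarrow> x \<in> \<C> w \<longrightarrow> norm x \<le> real n \<longrightarrow>
         path_le (\<C> w) 0 x (norm x + 300000 * real n powr b))"
      unfolding x_def r_def by blast
  qed
qed

text \<open>Integer radii suffice for Borel--Cantelli, since rounding \<open>R\<close> up to
  \<open>n\<close> at most doubles it. The implication from \<open>0 \<in> \<C> w\<close> postpones
  the conditioning to the very end.\<close>

lemma AE_internal_ball:
  assumes dim: "DIM('a) \<ge> 3" and a: "1 / 2 < a" "a < 1" and c: "c > 0"
  shows "AE w in P. 0 \<in> \<C> w \<longrightarrow> (\<exists>R0>0. \<forall>R>R0.
    \<C> w \<inter> cball 0 R \<subseteq> internal_ball (\<C> w) (R + c * R powr a))"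
proof -
  define b where "b = (1 / 2 + a) / 2"
  have b: "1 / 2 < b" "b < 1" "b < a" using a by (auto simp: b_def)
  obtain n0 :: nat where n0: "n0 \<ge> 1"
    "\<And>n. n \<ge> n0 \<Longrightarrow> \<exists>F\<in>events. prob (space P - F) \<le> 1 / real n ^ 2 \<and>
      (\<forall>w\<in>F. \<forall>x. 0 \<in> \<C> w \<longrightarrow> x \<in> \<C> w \<longrightarrow> norm x \<le> real n \<longrightarrow>
         path_le (\<C> w) 0 x (norm x + 300000 * real n powr b))"
    using good_scale[OF dim b(1,2)] by blast
  have "\<forall>n\<in>{n0..}. \<exists>F. F \<in> events \<and> prob (space P - F) \<le> 1 / real n ^ 2 \<and>
      (\<forall>w\<in>F. \<forall>x. 0 \<in> \<C> w \<longrightarrow> x \<in> \<C> w \<longrightarrow> norm x \<le> real n \<longrightarrow>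
         path_le (\<C> w) 0 x (norm x + 300000 * real n powr b))"
  proof
    fix n assume "n \<in> {n0..}"
    then have "n \<ge> n0" by simp
    from n0(2)[OF this] show "\<exists>F. F \<in> events \<and> prob (space P - F) \<le> 1 / real n ^ 2 \<and>
      (\<forall>w\<in>F. \<forall>x. 0 \<in> \<C> w \<longrightarrow> x \<in> \<C> w \<longrightarrow> norm x \<le> real n \<longrightarrow>
         path_le (\<C> w) 0 x (norm x + 300000 * real n powr b))" by blast
  qed
  from bchoice[OF this] obtain F0 where F0: "\<forall>n\<in>{n0..}. F0 n \<in> events \<and> prob (space P - F0 n) \<le> 1 / real n ^ 2 \<and>
      (\<forall>w\<in>F0 n. \<forall>x. 0 \<in> \<C> w \<longrightarrow> x \<in> \<C> w \<longrightarrow> norm x \<le> real n \<longrightarrow>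
         path_le (\<C> w) 0 x (norm x + 300000 * real n powr b))" by blast
  \<comment> \<open>Empty below \<open>n0\<close>, so that the sequence of bad events is defined for
    every index.\<close>
  define B where "B n = (if n \<ge> n0 then space P - F0 n else {})" for n
  have "AE w in P. eventually (\<lambda>n. w \<in> space P - B n) sequentially"
  proof (rule borel_cantelli_AE1)
    show "B n \<in> events" for n using F0 by (auto simp: B_def)
    show "emeasure P (B n) < \<infinity>" for n by (simp add: less_top[symmetric])
    show "summable (\<lambda>n. prob (B n))"
    proof (rule summable_comparison_test_ev)
      show "eventually (\<lambda>n. norm (prob (B n)) \<le> 1 / real n ^ 2) sequentially"
        using F0 by (auto simp: eventually_sequentially B_def intro!: exI[of _ n0])
      show "summable (\<lambda>n. 1 / real n ^ 2)"
        using inverse_power_summable[of 2, where 'a = real] by (simp add: inverse_eq_divide)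
    qed
  qed
  then show ?thesis
  proof (rule AE_mp, intro AE_I2 impI)
    fix w assume ws: "w \<in> space P" and ev: "eventually (\<lambda>n. w \<in> space P - B n) sequentially"
      and w0: "0 \<in> \<C> w"
    let ?C = "\<C> w"
    obtain n1 where n1: "\<And>n. n \<ge> n1 \<Longrightarrow> w \<notin> B n" using ev by (auto simp: eventually_sequentially)
    have P: "path_le ?C 0 x (norm x + 300000 * real n powr b)"
      if "n \<ge> max n0 n1" "x \<in> ?C" "norm x \<le> real n" for n x
    proof -
      have "w \<in> F0 n" using n1[of n] that ws by (auto simp: B_def)
      then show ?thesis using F0 that w0 by auto
    qed
    \<comment> \<open>Beyond the last entry the error \<open>300000 * (2 * R) powr b\<close>, at
      most \<open>600000 * R powr b\<close>, is absorbed by \<open>c * R powr a\<close>.\<close>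
    define R0 where "R0 = max (real (max n0 n1)) (max 1 ((600000 / c) powr (1 / (a - b))))"
    show "\<exists>R0>0. \<forall>R>R0. ?C \<inter> cball 0 R \<subseteq> internal_ball ?C (R + c * R powr a)"
    proof (intro exI[of _ R0] conjI allI impI subsetI)
      show "R0 > 0" by (simp add: R0_def)
    next
      fix R x assume R: "R > R0" and x: "x \<in> ?C \<inter> cball 0 R"
      have R1: "R \<ge> 1" "R \<ge> real (max n0 n1)" "R \<ge> (600000 / c) powr (1 / (a - b))" using R by (auto simp: R0_def)
      define n where "n = nat \<lceil>R\<rceil>"
      have n: "R \<le> real n" "real n \<le> 2 * R" using R1(1) unfolding n_def by linarith+
      have "n \<ge> max n0 n1" using R1(2) n(1) by linarith
      then have p: "path_le ?C 0 x (norm x + 300000 * real n powr b)" using P x n by auto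
      have "real n powr b \<le> (2 * R) powr b" using n b by (intro powr_mono2) auto
      also have "\<dots> = 2 powr b * R powr b" using R1 by (simp add: powr_mult)
      also have "\<dots> \<le> 2 powr 1 * R powr b" using b by (intro mult_right_mono powr_mono) auto
      finally have nb: "real n powr b \<le> 2 * R powr b" by simp
      have "600000 / c \<le> R powr (a - b)" using R1(3) b c by (intro powr_ge_const) auto
      then have "600000 \<le> c * R powr (a - b)" using c by (simp add: field_simps)
      then have "600000 * R powr b \<le> c * R powr (a - b) * R powr b" by (intro mult_right_mono) auto
      also have "\<dots> = c * R powr a" by (simp add: mult.assoc flip: powr_add)
      finally have "norm x + 300000 * real n powr b \<le> R + c * R powr a" using nb x by simp
      then have "internal_dist ?C 0 x \<le> ereal (R + c * R powr a)"
        using path_le_internal_dist path_le_mono p by blast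
      then show "x \<in> internal_ball ?C (R + c * R powr a)" by (simp add: internal_ball_def)
    qed
  qed
qed

end

theorem theorem1:
  fixes \<mu> :: "(real ^ 'd::finite) set measure"
    and P :: "'w measure"
    and \<omega> :: "'w \<Rightarrow> (real ^ 'd) set measure"
    and a u c :: real
  assumes "CARD('d) \<ge> 3"
    and "haar_line_measure \<mu>"
    and "1 / 2 < a" and "a < 1" and "u > 0" and "c > 0"
    and "poisson_line_process P (scale_measure (ennreal u) \<mu>) \<omega>"
  shows "AE w in uniform_measure P {w \<in> space P. 0 \<in> cylinder_set (\<omega> w)}.
    \<exists>R\<^sub>0>0. \<forall>R>R\<^sub>0.
      cylinder_set (\<omega> w) \<inter> cball 0 R \<subseteq> internal_ball (cylinder_set (\<omega> w)) (R + c * R powr a)"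
proof -
  interpret poisson_lines \<mu> P \<omega> u
    using assms by unfold_locales auto
  have "DIM(real ^ 'd) \<ge> 3" using assms(1) by simp
  \<comment> \<open>\<open>uniform_measure\<close> on the event that 0 is covered is the conditional
    law; the almost sure implication under \<open>P\<close> transfers to it.\<close>
  from AE_internal_ball[OF this assms(3,4,6)] show ?thesis
    by (intro AE_uniform_measureI cylinder_set_event) auto
qed

end
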